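(* Let $f:[0,1]\setminus\{c\}\to[0,1]$ be a $C^3$ non-flat contracting Lorenz map with negative Schwarzian derivative and without periodic attractors. (1) The topological attractor of $f$ contains the metrical attractor of $f$. (2) If the topological attractor of $f$ is not a cycle of intervals, then the topological attractor and the metrical attractor coincide.
   Context: A Lorenz map is a $C^2$ map $f:[0,1]\setminus\{c\}\to[0,1]$, $0<c<1$, with $f(0)=0$, $f(1)=1$ and $f'(x)>0$ for all $x\in[0,1]\setminus\{c\}$; it is contracting if $\lim_{x\to c}f'(x)=0$. It is non-flat if there are constants $\alpha>1$, $a,b\in[0,1]$ and $C^2$ orientation preserving diffeomorphisms $\phi_0:[0,c]\to[0,a^{1/\alpha}]$, $\phi_1:[c,1]\to[0,b^{1/\alpha}]$ with $f(x)=a-(\phi_0(c-x))^\alpha$ for $x<c$ and $f(x)=1-b+(\phi_1(x))^\alpha$ for $x>c$. A $C^3$ map $f$ has negative Schwarzian derivative if $Sf(x)=\frac{D^3f(x)}{Df(x)}-\frac32\left(\frac{D^2f(x)}{Df(x)}\right)^2<0$ at every $x$ with $Df(x)\neq0$. $\omega_f(x)$ is the set of limits of sequences $f^{n_j}(x)$, $n_j\to\infty$, and $\beta(A)=\{x:\omega_f(x)\subset A\}$. A periodic attractor is a finite set $\Lambda$ such that $\{x:\omega_f(x)=\Lambda\}$ has non-empty interior. A compact set $A$ is a topological attractor if $\beta(A)$ is residual in an open set and, for each closed forward invariant proper subset $A'\subset A$, $\beta(A)\setminus\beta(A')$ is residual in an open set. A compact set $A$ is a metrical attractor if $\beta(A)$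 has positive Lebesgue measure and, for each closed forward invariant proper subset $A'\subset A$, $\beta(A)\setminus\beta(A')$ has positive Lebesgue measure. For the maps $f$ considered, there is a single topological attractor $\Lambda$ with $\omega_f(x)=\Lambda$ for a residual set of $x\in[0,1]$ ("the" topological attractor), and a single metrical attractor $\Lambda'$ with $\omega_f(x)=\Lambda'$ for Lebesgue almost every $x\in[0,1]$ ("the" metrical attractor). A cycle of intervals is a forward invariant finite union of non-degenerate intervals. *)

theory Defs
  imports "HOL-Analysis.Analysis"
begin

text \<open>
  Derivatives are taken within the set \<open>S\<close>, so they are one-sided at its end points and do not
  depend on values of the function outside \<open>S\<close>. They are meaningful when \<open>S\<close> has no isolated
  points.
\<close>

definition nth_deriv_within :: "real set \<Rightarrow> nat \<Rightarrow> (real \<Rightarrow> real) \<Rightarrow> real \<Rightarrow> real" where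
  "nth_deriv_within S k f = ((\<lambda>g x. vector_derivative g (at x within S)) ^^ k) f"

definition Ck_on :: "nat \<Rightarrow> (real \<Rightarrow> real) \<Rightarrow> real set \<Rightarrow> bool" where
  "Ck_on k f S \<longleftrightarrow>
     (\<forall>i<k. nth_deriv_within S i f differentiable_on S) \<and>
     continuous_on S (nth_deriv_within S k f)"

definition C2_orientation_preserving_diffeo :: "(real \<Rightarrow> real) \<Rightarrow> real set \<Rightarrow> real set \<Rightarrow> bool" where
  "C2_orientation_preserving_diffeo \<phi> I J \<longleftrightarrow>
     bij_betw \<phi> I J \<and> Ck_on 2 \<phi> I \<and> Ck_on 2 (inv_into I \<phi>) J \<and> strict_mono_on I \<phi>"

text \<open>
  A map \<open>[0,1] \<setminus> {c} \<rightarrow> [0,1]\<close> is represented by a total function \<open>f\<close> together with \<open>c\<close>; no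
  definition below depends on \<open>f c\<close> or on values of \<open>f\<close> outside \<open>[0,1]\<close>.
\<close>

abbreviation punctured :: "real \<Rightarrow> real set" where
  "punctured c \<equiv> {0..1} - {c}"

definition lorenz_map :: "(real \<Rightarrow> real) \<Rightarrow> real \<Rightarrow> bool" where
  "lorenz_map f c \<longleftrightarrow>
     0 < c \<and> c < 1 \<and> f ` punctured c \<subseteq> {0..1} \<and> Ck_on 2 f (punctured c) \<and>
     f 0 = 0 \<and> f 1 = 1 \<and> (\<forall>x\<in>punctured c. nth_deriv_within (punctured c) 1 f x > 0)"

definition contracting :: "(real \<Rightarrow> real) \<Rightarrow> real \<Rightarrow> bool" where
  "contracting f c \<longleftrightarrow>
     (nth_deriv_within (punctured c) 1 f \<longlongrightarrow> 0) (at c within punctured c)"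

definition non_flat :: "(real \<Rightarrow> real) \<Rightarrow> real \<Rightarrow> bool" where
  "non_flat f c \<longleftrightarrow>
     (\<exists>\<alpha> a b \<phi>0 \<phi>1. \<alpha> > 1 \<and> a \<in> {0..1} \<and> b \<in> {0..1} \<and>
        C2_orientation_preserving_diffeo \<phi>0 {0..c} {0..a powr (1 / \<alpha>)} \<and>
        C2_orientation_preserving_diffeo \<phi>1 {c..1} {0..b powr (1 / \<alpha>)} \<and>
        (\<forall>x\<in>{0..<c}. f x = a - \<phi>0 (c - x) powr \<alpha>) \<and>
        (\<forall>x\<in>{c<..1}. f x = 1 - b + \<phi>1 x powr \<alpha>))"

definition schwarzian :: "real set \<Rightarrow> (real \<Rightarrow> real) \<Rightarrow> real \<Rightarrow> real" where
  "schwarzian S f x =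
     nth_deriv_within S 3 f x / nth_deriv_within S 1 f x
     - 3 / 2 * (nth_deriv_within S 2 f x / nth_deriv_within S 1 f x)\<^sup>2"

definition negative_schwarzian :: "(real \<Rightarrow> real) \<Rightarrow> real \<Rightarrow> bool" where
  "negative_schwarzian f c \<longleftrightarrow>
     (\<forall>x\<in>punctured c. nth_deriv_within (punctured c) 1 f x \<noteq> 0 \<longrightarrow> schwarzian (punctured c) f x < 0)"

text \<open>
  Since \<open>f\<close> is undefined at \<open>c\<close>, an orbit that reaches \<open>c\<close> stops there. Such points have only
  finitely many iterates, hence an empty \<open>\<omega>\<close>-limit set.
\<close>

definition omega_limit :: "(real \<Rightarrow> real) \<Rightarrow> real \<Rightarrow> real \<Rightarrow> real set" where
  "omega_limit f c x =
     {y. (\<forall>n. (f ^^ n) x \<noteq> c) \<and>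
         (\<exists>r :: nat \<Rightarrow> nat. filterlim r at_top sequentially \<and> (\<lambda>j. (f ^^ r j) x) \<longlonglongrightarrow> y)}"

definition basin :: "(real \<Rightarrow> real) \<Rightarrow> real \<Rightarrow> real set \<Rightarrow> real set" where
  "basin f c A = {x \<in> {0..1}. omega_limit f c x \<subseteq> A}"

definition forward_invariant :: "(real \<Rightarrow> real) \<Rightarrow> real \<Rightarrow> real set \<Rightarrow> bool" where
  "forward_invariant f c A \<longleftrightarrow> A \<subseteq> {0..1} \<and> f ` (A - {c}) \<subseteq> A"

definition periodic_attractor :: "(real \<Rightarrow> real) \<Rightarrow> real \<Rightarrow> real set \<Rightarrow> bool" where
  "periodic_attractor f c A \<longleftrightarrow>
     finite A \<and> interior {x \<in> {0..1}. omega_limit f c x = A} \<noteq> {}"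

definition residual_in :: "'a::topological_space set \<Rightarrow> 'a set \<Rightarrow> bool" where
  "residual_in R U \<longleftrightarrow>
     (\<exists>\<G>. countable \<G> \<and> (\<forall>T\<in>\<G>. openin (top_of_set U) T \<and> U \<subseteq> closure T) \<and> U \<inter> \<Inter>\<G> \<subseteq> R)"

text \<open>
  The open set has to be non-empty: every set is residual in the empty set.
\<close>

definition residual_in_some_open :: "real set \<Rightarrow> bool" where
  "residual_in_some_open R \<longleftrightarrow>
     (\<exists>U. openin (top_of_set {0..1}) U \<and> U \<noteq> {} \<and> residual_in R U)"

definition topological_attractor :: "(real \<Rightarrow> real) \<Rightarrow> real \<Rightarrow> real set \<Rightarrow> bool" where
  "topological_attractor f c A \<longleftrightarrow>
     A \<subseteq> {0..1} \<and> compact A \<and> residual_in_some_open (basin f c A) \<and>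
     (\<forall>A'. closed A' \<and> forward_invariant f c A' \<and> A' \<subset> A \<longrightarrow>
        residual_in_some_open (basin f c A - basin f c A'))"

definition metrical_attractor :: "(real \<Rightarrow> real) \<Rightarrow> real \<Rightarrow> real set \<Rightarrow> bool" where
  "metrical_attractor f c A \<longleftrightarrow>
     A \<subseteq> {0..1} \<and> compact A \<and> emeasure lebesgue (basin f c A) > 0 \<and>
     (\<forall>A'. closed A' \<and> forward_invariant f c A' \<and> A' \<subset> A \<longrightarrow>
        emeasure lebesgue (basin f c A - basin f c A') > 0)"

definition cycle_of_intervals :: "(real \<Rightarrow> real) \<Rightarrow> real \<Rightarrow> real set \<Rightarrow> bool" where
  "cycle_of_intervals f c A \<longleftrightarrow>
     forward_invariant f c A \<and>
     (\<exists>\<I>. finite \<I> \<and> \<I> \<noteq> {} \<and> A = \<Union>\<I> \<and>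
        (\<forall>I\<in>\<I>. is_interval I \<and> (\<exists>x\<in>I. \<exists>y\<in>I. x < y)))"

end

theory Submission
  imports Defs
begin

text \<open>
  Both attractors are identified through two properties of \<open>f\<close>. First, negative Schwarzian
  derivative makes \<open>f\<close>, and hence every iterate on an interval where it is monotone, expand
  cross-ratios (lemmas \<open>schwarzian_cross\<close> and \<open>iter_cross\<close>). Secondly, without
  periodic attractors no iterate maps a monotone branch into itself
  (\<open>trapped_branch_attractor\<close>). A \<^emph>\<open>homterval\<close> is an interval on which all iterates are
  monotone; it follows that its images are pairwise disjoint, so their lengths tend to zero.

  Let \<open>Q \<ge> c\<close> be the infimum of the preimages of \<open>c\<close> (of any order) to the right of \<open>c\<close>, and
  \<open>L \<le> c\<close> the supremum of those to its left. The first half of the proof shows that almost every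
  point and a generic point accumulate at \<open>Q\<close> from the right and at \<open>L\<close> from the left
  (\<open>good_ae\<close>, \<open>good_generic\<close>). A point that avoids \<open>(c, q)\<close>, with \<open>q\<close> a preimage of \<open>c\<close>, sees
  around it the pullbacks of \<open>(c, q)\<close> at the left ends of the monotone branches of \<open>f ^^ n\<close>. As \<open>q\<close>
  reaches \<open>c\<close> in boundedly many steps, such a pullback has an image of definite length under
  \<open>f ^^ n\<close>, and if there is also room on the right, cross-ratio expansion makes it a definite
  proportion of its neighbourhood: the set of these points is porous, hence null. When \<open>c\<close> is the end
  point of a homterval, room is found by looking at the times at which the images of the homterval are shorter
  than ever before; this also shows that \<open>c\<close> is the end point of at most one homterval
  (\<open>not_two_homtervals\<close>), so that typical orbits accumulate at \<open>c\<close>.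

  Let \<open>core_limit\<close> be the set of points that are in the limit set of every typical orbit. A typical point
  whose orbit comes close to some \<open>y\<close> outside \<open>core_limit\<close> has a branch of \<open>f ^^ n\<close> around it that
  covers a whole neighbourhood of \<open>y\<close> (\<open>extend_left\<close>, \<open>extend_right\<close>), with room on both sides and
  therefore with bounded distortion. Hence two cases (\<open>metric_dichotomy\<close>). Either almost every limit
  set is \<open>core_limit\<close>; or, by a density point argument, \<open>f\<close> is ergodic and the limit
  sets of almost every and of generic points are one and the same set, which has interior. In the second case
  both attractors equal that set.

  In the first case the metrical attractor is \<open>core_limit\<close>, which generic limit sets contain; so it is
  contained in the topological attractor. If the inclusion is strict, generic orbits come close to a point outside
  \<open>core_limit\<close>, and the same covering branches, now used topologically, show that the topological
  attractor contains a neighbourhood of \<open>c\<close>. It is then swept out by the images of the two halves of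
  its component at \<open>c\<close> before they return (\<open>omega_cycle\<close>), and so it is a cycle of intervals.
\<close>

section \<open>Negative Schwarzian derivative expands cross-ratios\<close>

text \<open>
  The number \<open>|T| |J| / (|T1| |T2|)\<close> for \<open>T = [a, e]\<close> and \<open>J = [b, d]\<close>, where \<open>T1\<close>, \<open>T2\<close> are the two
  components of \<open>T - J\<close>. An upper bound on it says that \<open>J\<close> has room on both sides within \<open>T\<close>.
\<close>

definition cross_ratio :: "real \<Rightarrow> real \<Rightarrow> real \<Rightarrow> real \<Rightarrow> real" where
  "cross_ratio a b d e = (e - a) * (d - b) / ((b - a) * (e - d))"

lemma convex_tangent:
  fixes h :: "real \<Rightarrow> real"
  assumes h: "\<And>x. l < x \<Longrightarrow> x < r \<Longrightarrow> (h has_real_derivative h1 x) (at x)"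
    and h1: "\<And>x. l < x \<Longrightarrow> x < r \<Longrightarrow> (h1 has_real_derivative h2 x) (at x)"
    and pos: "\<And>x. l < x \<Longrightarrow> x < r \<Longrightarrow> 0 < h2 x"
    and xy: "l < x" "x < y" "y < r"
  shows "h y + (x - y) * h1 y < h x"
proof -
  obtain z where z: "x < z" "z < y" "h y - h x = (y - x) * h1 z"
    using MVT2[of x y h h1] h xy by (metis le_less_trans less_le_trans)
  have "h1 z < h1 y"
    by (rule DERIV_pos_imp_increasing[OF z(2)]) (use h1 pos z xy in \<open>meson le_less_trans less_le_trans less_trans\<close>)
  then have "(y - x) * h1 z < (y - x) * h1 y" using xy by simp
  then show ?thesis using z(3) by (simp add: algebra_simps)
qed

text \<open>With \<open>h = 1 / sqrt f'\<close> one has \<open>h'' = - h * S f / 2 > 0\<close>; comparing \<open>1 / h\<^sup>2\<close> with the value at the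
  tangent line gives the infinitesimal form of the expansion.\<close>

lemma schwarzian_two_point:
  fixes f :: "real \<Rightarrow> real"
  assumes f: "\<And>x. l < x \<Longrightarrow> x < r \<Longrightarrow> (f has_real_derivative f1 x) (at x)"
    and f1: "\<And>x. l < x \<Longrightarrow> x < r \<Longrightarrow> (f1 has_real_derivative f2 x) (at x)"
    and f2: "\<And>x. l < x \<Longrightarrow> x < r \<Longrightarrow> (f2 has_real_derivative f3 x) (at x)"
    and pos: "\<And>x. l < x \<Longrightarrow> x < r \<Longrightarrow> 0 < f1 x"
    and S: "\<And>x. l < x \<Longrightarrow> x < r \<Longrightarrow> f3 x / f1 x - 3 / 2 * (f2 x / f1 x)\<^sup>2 < 0"
    and xy: "l < x" "x < y" "y < r"
  shows "(y - x)\<^sup>2 * (f1 x * f1 y) < (f y - f x)\<^sup>2"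
proof -
  define h where "h x = 1 / sqrt (f1 x)" for x
  define h1 where "h1 x = - (f2 x * h x / (2 * f1 x))" for x
  define h2 where "h2 x = - (1 / 2) * h x * (f3 x / f1 x - 3 / 2 * (f2 x / f1 x)\<^sup>2)" for x
  have hp: "0 < h x" if "l < x" "x < r" for x using pos[OF that] by (simp add: h_def)
  have hsq: "h x * h x = 1 / f1 x" if "l < x" "x < r" for x using pos[OF that] by (simp add: h_def)
  have dh: "(h has_real_derivative h1 x) (at x)" if x: "l < x" "x < r" for x
  proof -
    have p: "0 < f1 x" by (rule pos[OF x])
    have "((\<lambda>x. 1 / sqrt (f1 x)) has_real_derivative - (f2 x * (inverse (sqrt (f1 x)) / 2)) / (sqrt (f1 x) * sqrt (f1 x))) (at x)"
      using p by (auto intro!: derivative_eq_intros f1[OF x] simp: field_simps)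
    moreover have "- (f2 x * (inverse (sqrt (f1 x)) / 2)) / (sqrt (f1 x) * sqrt (f1 x)) = h1 x"
      using p by (simp add: h1_def h_def field_simps)
    ultimately show ?thesis by (simp add: h_def[abs_def])
  qed
  have dh1: "(h1 has_real_derivative h2 x) (at x)" if x: "l < x" "x < r" for x
  proof -
    have p: "0 < f1 x" by (rule pos[OF x])
    have "((\<lambda>x. - (f2 x * h x / (2 * f1 x))) has_real_derivative
        - (((f3 x * h x + h1 x * f2 x) * (2 * f1 x) - f2 x * h x * (2 * f2 x)) / (2 * f1 x * (2 * f1 x)))) (at x)"
      using p by (auto intro!: derivative_eq_intros f1[OF x] f2[OF x] dh[OF x])
    moreover have "- (((f3 x * h x + h1 x * f2 x) * (2 * f1 x) - f2 x * h x * (2 * f2 x)) / (2 * f1 x * (2 * f1 x))) = h2 x"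
      using p by (simp add: h1_def h2_def field_simps power2_eq_square)
    ultimately show ?thesis by (simp add: h1_def[abs_def])
  qed
  have h2p: "0 < h2 x" if x: "l < x" "x < r" for x
    using mult_pos_neg[OF hp[OF x] S[OF x]] by (simp add: h2_def)
  have lower: "(y - x) / (h x * h y) < f y - f x"
  proof -
    define F where "F t = f t - (t - x) / (h x * h t)" for t
    have hx: "0 < h x" using hp xy by simp
    have dF: "\<exists>d. (F has_real_derivative d) (at t) \<and> (x < t \<longrightarrow> 0 < d)" if t: "x \<le> t" "t \<le> y" for t
    proof -
      have tl: "l < t" "t < r" using t xy by auto
      have ht: "0 < h t" using hp tl by simp
      have "(F has_real_derivative f1 t - (1 * (h x * h t) - (t - x) * (h x * h1 t)) / (h x * h t * (h x * h t))) (at t)"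
        unfolding F_def using hx ht by (auto intro!: derivative_eq_intros f[OF tl] dh[OF tl])
      moreover have "0 < f1 t - (1 * (h x * h t) - (t - x) * (h x * h1 t)) / (h x * h t * (h x * h t))" if "x < t"
      proof -
        have "h t + (x - t) * h1 t < h x"
          by (rule convex_tangent[OF dh dh1 h2p]) (use that xy tl in auto)
        then have "0 < (h x - h t + (t - x) * h1 t) / (h x * (h t * h t))"
          using hx ht by (intro divide_pos_pos) (auto simp: algebra_simps)
        also have "\<dots> = 1 / (h t * h t) - (1 * (h x * h t) - (t - x) * (h x * h1 t)) / (h x * h t * (h x * h t))"
          using hx ht by (simp add: field_simps)
        also have "1 / (h t * h t) = f1 t" using hsq[OF tl] by simp
        finally show ?thesis .
      qed
      ultimately show ?thesis by blast
    qed
    have "F x < F y"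
    proof (rule DERIV_pos_imp_increasing_open[OF xy(2)])
      fix t assume "x < t" "t < y"
      then show "\<exists>d. (F has_real_derivative d) (at t) \<and> 0 < d" using dF[of t] by auto
    next
      show "continuous_on {x..y} F"
        by (rule continuous_at_imp_continuous_on) (use dF DERIV_isCont in force)
    qed
    then show ?thesis by (simp add: F_def)
  qed
  have hxy: "0 < h x" "0 < h y" using hp xy by auto
  have "0 < (y - x) / (h x * h y)" using hxy xy by simp
  then have "((y - x) / (h x * h y))\<^sup>2 < (f y - f x)\<^sup>2"
    using lower by (intro power_strict_mono) auto
  moreover have "((y - x) / (h x * h y))\<^sup>2 = (y - x)\<^sup>2 / ((h x * h x) * (h y * h y))"
    by (simp add: power2_eq_square)
  moreover have "\<dots> = (y - x)\<^sup>2 * (f1 x * f1 y)"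
    using hsq[of x] hsq[of y] xy by (simp add: field_simps)
  ultimately show ?thesis by simp
qed

text \<open>
  The two-point inequality says that the mixed derivative of \<open>ln ((f y - f x) / (y - x))\<close> is negative.
  The claim is its integral over \<open>x \<in> [a, b]\<close>, \<open>y \<in> [d, e]\<close>, taken one variable at a time: first \<open>key\<close>,
  then the monotonicity of \<open>G\<close>.
\<close>

lemma schwarzian_cross:
  fixes f :: "real \<Rightarrow> real"
  assumes f: "\<And>x. l < x \<Longrightarrow> x < r \<Longrightarrow> (f has_real_derivative f1 x) (at x)"
    and f1: "\<And>x. l < x \<Longrightarrow> x < r \<Longrightarrow> (f1 has_real_derivative f2 x) (at x)"
    and f2: "\<And>x. l < x \<Longrightarrow> x < r \<Longrightarrow> (f2 has_real_derivative f3 x) (at x)"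
    and pos: "\<And>x. l < x \<Longrightarrow> x < r \<Longrightarrow> 0 < f1 x"
    and S: "\<And>x. l < x \<Longrightarrow> x < r \<Longrightarrow> f3 x / f1 x - 3 / 2 * (f2 x / f1 x)\<^sup>2 < 0"
    and abde: "l < a" "a < b" "b < d" "d < e" "e < r"
  shows "cross_ratio a b d e < cross_ratio (f a) (f b) (f d) (f e)"
proof -
  have mono: "f x < f y" if "l < x" "x < y" "y < r" for x y
    by (rule DERIV_pos_imp_increasing[OF that(2)]) (use f pos that in \<open>meson le_less_trans less_le_trans\<close>)
  have key: "f1 y / (f y - f b) - 1 / (y - b) < f1 y / (f y - f a) - 1 / (y - a)" if y: "b < y" "y < r" for y
  proof (rule DERIV_neg_imp_decreasing[OF abde(2)])
    fix x assume x: "a \<le> x" "x \<le> b"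
    then have xl: "l < x" "x < y" "x < r" using abde y by auto
    have fxy: "0 < f y - f x" using mono[of x y] xl y by simp
    have "((\<lambda>x. f1 y / (f y - f x) - 1 / (y - x)) has_real_derivative
        f1 y * f1 x / (f y - f x)\<^sup>2 - 1 / (y - x)\<^sup>2) (at x)"
      using fxy xl by (auto intro!: derivative_eq_intros f simp: power2_eq_square)
    moreover have "(y - x)\<^sup>2 * (f1 x * f1 y) < (f y - f x)\<^sup>2"
      by (rule schwarzian_two_point[OF f f1 f2 pos S]) (use xl y in auto)
    then have "f1 y * f1 x / (f y - f x)\<^sup>2 - 1 / (y - x)\<^sup>2 < 0"
      using fxy xl by (simp add: field_simps)
    ultimately show "\<exists>d. ((\<lambda>x. f1 y / (f y - f x) - 1 / (y - x)) has_real_derivative d) (at x) \<and> d < 0"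
      by blast
  qed
  define G where "G y = ln (f y - f b) + ln (y - a) - ln (f y - f a) - ln (y - b)" for y
  have "G e < G d"
  proof (rule DERIV_neg_imp_decreasing[OF abde(4)])
    fix y assume y: "d \<le> y" "y \<le> e"
    then have yl: "b < y" "a < y" "y < r" "l < y" using abde by auto
    have p: "0 < f y - f b" "0 < f y - f a" using mono[of b y] mono[of a y] yl abde by auto
    have "(G has_real_derivative f1 y / (f y - f b) + 1 / (y - a) - f1 y / (f y - f a) - 1 / (y - b)) (at y)"
      unfolding G_def using p yl
      by (auto intro!: derivative_eq_intros f simp: divide_inverse mult.commute)
    moreover have "f1 y / (f y - f b) + 1 / (y - a) - f1 y / (f y - f a) - 1 / (y - b) < 0"
      using key[OF yl(1,3)] by simp
    ultimately show "\<exists>d. (G has_real_derivative d) (at y) \<and> d < 0" by blast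
  qed
  have m: "f a < f b" "f b < f d" "f d < f e" using mono abde by auto
  define A where "A = f b - f a" define J where "J = f d - f b" define B where "B = f e - f d"
  define A' where "A' = b - a" define J' where "J' = d - b" define B' where "B' = e - d"
  have P: "0 < A" "0 < J" "0 < B" "0 < A'" "0 < J'" "0 < B'"
    using m abde by (auto simp: A_def J_def B_def A'_def J'_def B'_def)
  have "ln (J + B) + ln (A' + J' + B') - ln (A + J + B) - ln (J' + B') <
        ln J + ln (A' + J') - ln (A + J) - ln J'"
    using \<open>G e < G d\<close> by (simp add: G_def A_def J_def B_def A'_def J'_def B'_def)
  then have "ln ((J + B) * (A' + J' + B') * ((A + J) * J')) < ln (J * (A' + J') * ((A + J + B) * (J' + B')))"
    using P by (simp add: ln_mult)
  then have lt: "(J + B) * (A' + J' + B') * ((A + J) * J') < J * (A' + J') * ((A + J + B) * (J' + B'))"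
    using P by (subst (asm) ln_less_cancel_iff) auto
  have "(A' + J' + B') * J' * (A * B) < (A + J + B) * J * (A' * B')"
  proof -
    have "(J + B) * (A + J) = (A + J + B) * J + A * B" "(A' + J') * (J' + B') = (A' + J' + B') * J' + A' * B'"
      by (simp_all add: algebra_simps)
    then have "((A + J + B) * J + A * B) * ((A' + J' + B') * J') < (A + J + B) * J * ((A' + J' + B') * J' + A' * B')"
      using lt by (metis (no_types, opaque_lifting) mult.assoc mult.commute mult.left_commute)
    then show ?thesis by (simp add: algebra_simps)
  qed
  then have "(A' + J' + B') * J' / (A' * B') < (A + J + B) * J / (A * B)"
    using P by (simp add: divide_simps mult_ac)
  then show ?thesis by (simp add: cross_ratio_def A_def J_def B_def A'_def J'_def B'_def)
qed

section \<open>Lorenz maps that expand cross-ratios\<close>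

text \<open>
  The points at which \<open>f ^^ n\<close> is the \<open>n\<close>-th iterate of the map on \<open>[0, 1] - {c}\<close>, independently of the
  value chosen for \<open>f c\<close>.
\<close>

definition free :: "(real \<Rightarrow> real) \<Rightarrow> real \<Rightarrow> nat \<Rightarrow> real \<Rightarrow> bool" where
  "free f c n x \<longleftrightarrow> (\<forall>k<n. (f ^^ k) x \<noteq> c)"

definition branch :: "(real \<Rightarrow> real) \<Rightarrow> real \<Rightarrow> nat \<Rightarrow> real \<Rightarrow> real \<Rightarrow> bool" where
  "branch f c n a b \<longleftrightarrow> 0 \<le> a \<and> a < b \<and> b \<le> 1 \<and> (\<forall>x. a < x \<and> x < b \<longrightarrow> free f c n x)"

text \<open>
  Preimages of \<open>c\<close> of exact order \<open>j\<close>: branches of higher iterates end there.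
\<close>

definition cut :: "(real \<Rightarrow> real) \<Rightarrow> real \<Rightarrow> nat \<Rightarrow> real \<Rightarrow> bool" where
  "cut f c j x \<longleftrightarrow> free f c j x \<and> (f ^^ j) x = c"

text \<open>
  The consequences of the hypotheses on \<open>f\<close> that enter the dynamical arguments. They are invariant under
  reversal of the orientation of \<open>[0, 1]\<close>, so every one-sided lemma has a mirror image.
\<close>

locale lorenz_cross =
  fixes f :: "real \<Rightarrow> real" and c :: real
  assumes c01: "0 < c" "c < 1"
    and f0: "f 0 = 0" and f1: "f 1 = 1"
    and cont: "continuous_on ({0..1} - {c}) f"
    and monoL: "\<And>x y. 0 \<le> x \<Longrightarrow> x < y \<Longrightarrow> y < c \<Longrightarrow> f x < f y"
    and monoR: "\<And>x y. c < x \<Longrightarrow> x < y \<Longrightarrow> y \<le> 1 \<Longrightarrow> f x < f y"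
    and range: "\<And>x. 0 \<le> x \<Longrightarrow> x \<le> 1 \<Longrightarrow> x \<noteq> c \<Longrightarrow> 0 \<le> f x \<and> f x \<le> 1"
    and deriv: "\<And>x. 0 < x \<Longrightarrow> x < 1 \<Longrightarrow> x \<noteq> c \<Longrightarrow> \<exists>d>0. (f has_real_derivative d) (at x)"
    and cross: "\<And>a b d e. 0 < a \<Longrightarrow> a < b \<Longrightarrow> b < d \<Longrightarrow> d < e \<Longrightarrow> e < 1 \<Longrightarrow> e < c \<or> c < a \<Longrightarrow>
                  cross_ratio a b d e < cross_ratio (f a) (f b) (f d) (f e)"
begin

abbreviation "fr \<equiv> free f c"
abbreviation "br \<equiv> branch f c"
abbreviation "ct \<equiv> cut f c"

lemma free_Suc: "fr (Suc n) x \<longleftrightarrow> fr n x \<and> (f ^^ n) x \<noteq> c"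
  by (auto simp: free_def less_Suc_eq)

lemma free_mono: "fr n x \<Longrightarrow> m \<le> n \<Longrightarrow> fr m x"
  by (auto simp: free_def)

lemma funpow_plus: "(f ^^ k) ((f ^^ m) x) = (f ^^ (m + k)) x"
  by (simp add: funpow_add add.commute)

lemma free_add: "fr (m + n) x \<longleftrightarrow> fr m x \<and> fr n ((f ^^ m) x)"
proof (induction n)
  case 0 then show ?case by (simp add: free_def)
next
  case (Suc n) then show ?case by (auto simp: free_Suc funpow_plus)
qed

lemma f_inner: assumes "0 < x" "x < 1" "x \<noteq> c" shows "0 < f x" "f x < 1"
proof -
  show "0 < f x"
  proof (cases "x < c")
    case True then show ?thesis using monoL[of 0 x] f0 assms by simp
  next
    case False
    then have "f ((c + x)/2) < f x" using monoR[of "(c+x)/2" x] assms by simp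
    moreover have "0 \<le> f ((c + x)/2)" using range[of "(c+x)/2"] assms c01 False by simp
    ultimately show ?thesis by simp
  qed
  show "f x < 1"
  proof (cases "x < c")
    case False then show ?thesis using monoR[of x 1] f1 assms by simp
  next
    case True
    then have "f x < f ((c + x)/2)" using monoL[of x "(c+x)/2"] assms by simp
    moreover have "f ((c + x)/2) \<le> 1" using range[of "(c+x)/2"] assms c01 True by simp
    ultimately show ?thesis by simp
  qed
qed

lemma iter_inner: assumes "0 < x" "x < 1" "fr n x" shows "0 < (f ^^ n) x \<and> (f ^^ n) x < 1"
  using assms(3)
proof (induction n)
  case 0 then show ?case using assms by simp
next
  case (Suc n)
  then show ?case using f_inner[of "(f ^^ n) x"] by (simp add: free_Suc)
qed

lemma iter_range: assumes "0 \<le> x" "x \<le> 1" "fr n x" shows "0 \<le> (f ^^ n) x \<and> (f ^^ n) x \<le> 1"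
  using assms(3)
proof (induction n)
  case 0 then show ?case using assms by simp
next
  case (Suc n)
  then show ?case using range[of "(f ^^ n) x"] by (simp add: free_Suc)
qed

lemma iter_0: "(f ^^ n) 0 = 0" by (induction n) (auto simp: f0)
lemma iter_1: "(f ^^ n) 1 = 1" by (induction n) (auto simp: f1)
lemma free_0: "fr n 0" using c01 by (simp add: free_def iter_0)
lemma free_1: "fr n 1" using c01 by (simp add: free_def iter_1)

lemma isCont_iter: assumes "0 < x" "x < 1" "fr n x" shows "isCont (f ^^ n) x"
  using assms(3)
proof (induction n)
  case 0 then show ?case by (simp add: id_def)
next
  case (Suc n)
  have "isCont f ((f ^^ n) x)"
    using deriv[of "(f ^^ n) x"] iter_inner[OF assms(1,2), of n] Suc.prems DERIV_isCont
    by (auto simp: free_Suc)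
  moreover have "isCont (f ^^ n) x" using Suc by (simp add: free_Suc)
  ultimately have "isCont (f \<circ> (f ^^ n)) x"
    by (rule continuous_at_compose[rotated])
  then show ?case by (simp add: comp_def)
qed

lemma iter_deriv: assumes "0 < x" "x < 1" "fr n x"
  shows "\<exists>d>0. ((f ^^ n) has_real_derivative d) (at x)"
  using assms(3)
proof (induction n)
  case 0 then show ?case
    by (intro exI[of _ 1]) (auto simp: id_def)
next
  case (Suc n)
  then obtain d where d: "d > 0" "((f ^^ n) has_real_derivative d) (at x)" by (auto simp: free_Suc)
  obtain d' where d': "d' > 0" "(f has_real_derivative d') (at ((f ^^ n) x))"
    using deriv[of "(f ^^ n) x"] iter_inner[OF assms(1,2), of n] Suc.prems
    by (auto simp: free_Suc)
  have "((f \<circ> (f ^^ n)) has_real_derivative d' * d) (at x)"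
    by (rule DERIV_chain[OF d'(2) d(2)])
  then have "((f ^^ Suc n) has_real_derivative d' * d) (at x)" by simp
  then show ?case using d d' mult_pos_pos by blast
qed

lemma iter_cont_on:
  assumes "S \<subseteq> {0..1}" "\<And>x. x \<in> S \<Longrightarrow> fr n x" shows "continuous_on S (f ^^ n)"
  using assms(2)
proof (induction n)
  case 0 then show ?case by (simp add: id_def)
next
  case (Suc n)
  have "(f ^^ n) ` S \<subseteq> {0..1} - {c}"
    using iter_range[of _ n] assms(1) Suc.prems by (force simp: free_Suc)
  then have "continuous_on ((f ^^ n) ` S) f"
    using cont continuous_on_subset by blast
  then have "continuous_on S (f \<circ> (f ^^ n))"
    using Suc by (intro continuous_on_compose) (auto simp: free_Suc)
  then show ?case by simp
qed

lemma iter_ivt: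
  assumes "0 \<le> x" "x \<le> y" "y \<le> 1" "\<And>z. x \<le> z \<Longrightarrow> z \<le> y \<Longrightarrow> fr n z"
    and "(f ^^ n) x \<le> w" "w \<le> (f ^^ n) y"
  obtains z where "x \<le> z" "z \<le> y" "(f ^^ n) z = w"
proof -
  have "continuous_on {x..y} (f ^^ n)"
    by (rule iter_cont_on) (use assms in auto)
  then show thesis using IVT'[of "f ^^ n" x w y] assms that by auto
qed

lemma iter_side:
  assumes "0 \<le> x" "x \<le> y" "y \<le> 1" "\<And>z. x \<le> z \<Longrightarrow> z \<le> y \<Longrightarrow> fr (Suc n) z"
  shows "((f ^^ n) x < c \<and> (f ^^ n) y < c) \<or> (c < (f ^^ n) x \<and> c < (f ^^ n) y)"
proof (rule ccontr)
  assume *: "\<not> ?thesis"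
  have ne: "(f ^^ n) z \<noteq> c" if "x \<le> z" "z \<le> y" for z
    using assms(4)[OF that] by (simp add: free_Suc)
  have "continuous_on {x..y} (f ^^ n)"
    by (rule iter_cont_on) (use assms in \<open>auto simp: free_Suc\<close>)
  moreover have "((f ^^ n) x < c \<and> c < (f ^^ n) y) \<or> ((f ^^ n) y < c \<and> c < (f ^^ n) x)"
    using * ne[of x] ne[of y] assms(2) by force
  ultimately have "\<exists>z. x \<le> z \<and> z \<le> y \<and> (f ^^ n) z = c"
    using IVT'[of "f ^^ n" x c y] IVT2'[of "f ^^ n" y c x] assms(2) by force
  then show False using ne by auto
qed

lemma iter_mono:
  assumes "0 \<le> x" "x < y" "y \<le> 1" "\<And>z. x \<le> z \<Longrightarrow> z \<le> y \<Longrightarrow> fr n z"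
  shows "(f ^^ n) x < (f ^^ n) y"
  using assms(4)
proof (induction n)
  case 0 then show ?case using assms by simp
next
  case (Suc n)
  have lt: "(f ^^ n) x < (f ^^ n) y" using Suc by (simp add: free_Suc)
  have s: "((f ^^ n) x < c \<and> (f ^^ n) y < c) \<or> (c < (f ^^ n) x \<and> c < (f ^^ n) y)"
    by (rule iter_side) (use assms Suc.prems in auto)
  have "0 \<le> (f ^^ n) x" "(f ^^ n) y \<le> 1"
    using iter_range[of x n] iter_range[of y n] assms Suc.prems[of x] Suc.prems[of y]
    by (auto simp: free_Suc)
  then show ?case using s lt monoL[of "(f ^^ n) x" "(f ^^ n) y"] monoR[of "(f ^^ n) x" "(f ^^ n) y"]
    by auto
qed

text \<open>
  Expansion of cross-ratios is inherited by compositions.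
\<close>

lemma iter_cross:
  assumes "0 < a" "a < b" "b < d" "d < e" "e < 1" "\<And>z. a \<le> z \<Longrightarrow> z \<le> e \<Longrightarrow> fr n z"
  shows "cross_ratio a b d e \<le> cross_ratio ((f ^^ n) a) ((f ^^ n) b) ((f ^^ n) d) ((f ^^ n) e) \<and>
   (n > 0 \<longrightarrow> cross_ratio a b d e < cross_ratio ((f ^^ n) a) ((f ^^ n) b) ((f ^^ n) d) ((f ^^ n) e))"
  using assms(6)
proof (induction n)
  case 0 then show ?case by simp
next
  case (Suc n)
  have fr: "fr n z" if "a \<le> z" "z \<le> e" for z using Suc.prems[OF that] by (simp add: free_Suc)
  have m: "(f ^^ n) a < (f ^^ n) b" "(f ^^ n) b < (f ^^ n) d" "(f ^^ n) d < (f ^^ n) e"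
    using assms by (auto intro!: iter_mono fr)
  have s: "((f ^^ n) a < c \<and> (f ^^ n) e < c) \<or> (c < (f ^^ n) a \<and> c < (f ^^ n) e)"
    by (rule iter_side) (use assms Suc.prems in auto)
  have "0 < (f ^^ n) a" "(f ^^ n) e < 1"
    using iter_inner[of a n] iter_inner[of e n] assms fr by auto
  then have "cross_ratio ((f ^^ n) a) ((f ^^ n) b) ((f ^^ n) d) ((f ^^ n) e)
     < cross_ratio (f ((f ^^ n) a)) (f ((f ^^ n) b)) (f ((f ^^ n) d)) (f ((f ^^ n) e))"
    using cross[of "(f ^^ n) a" "(f ^^ n) b" "(f ^^ n) d" "(f ^^ n) e"] m s by auto
  then show ?case using Suc.IH[OF fr] by auto
qed

lemma branchD:
  assumes "br n a b"
  shows "0 \<le> a" "a < b" "b \<le> 1" "\<And>x. a < x \<Longrightarrow> x < b \<Longrightarrow> fr n x"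
  using assms by (auto simp: branch_def)

lemma branch_free: "br n a b \<Longrightarrow> a < x \<Longrightarrow> x < b \<Longrightarrow> k \<le> n \<Longrightarrow> fr k x"
  using free_mono by (auto simp: branch_def)

lemma branch_mono:
  assumes "br n a b" "k \<le> n" "a < x" "x < y" "y < b" shows "(f ^^ k) x < (f ^^ k) y"
  by (rule iter_mono) (use assms branchD(1,3)[OF assms(1)] branch_free[OF assms(1)] in auto)

lemma branch_ivt:
  assumes "br n a b" "a < x" "x \<le> y" "y < b" "k \<le> n" "(f ^^ k) x \<le> w" "w \<le> (f ^^ k) y"
  obtains z where "x \<le> z" "z \<le> y" "(f ^^ k) z = w"
  by (rule iter_ivt[of x y k w])
    (use assms(2-) branchD(1,3)[OF assms(1)] branch_free[OF assms(1)] in auto)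

lemma branch_inner: assumes "br n a b" "a < x" "x < b" "k \<le> n"
  shows "0 < (f ^^ k) x" "(f ^^ k) x < 1"
  using iter_inner[of x k] assms branch_free[OF assms(1)] branchD(1,3)[OF assms(1)] by auto

lemma branch_cross:
  assumes "br n a b" "a < p" "p < q" "q < r" "r < s" "s < b"
  shows "cross_ratio p q r s \<le> cross_ratio ((f ^^ n) p) ((f ^^ n) q) ((f ^^ n) r) ((f ^^ n) s)"
  using iter_cross[of p q r s n] assms by (auto simp: branch_def)

text \<open>
  One more iterate cuts a maximal branch in at most one point, because the previous iterate is injective on
  it and takes the value \<open>c\<close> at most once.
\<close>

lemma max_branch:
  assumes "0 < x" "x < 1" "fr n x"
  obtains a b where "br n a b" "a < x" "x < b"
    "a = 0 \<or> (0 < a \<and> (\<exists>j<n. ct j a))" "b = 1 \<or> (b < 1 \<and> (\<exists>j<n. ct j b))"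
  using assms(3)
proof (induction n arbitrary: thesis)
  case 0
  show ?case by (rule 0(1)[of 0 1]) (use assms in \<open>auto simp: branch_def free_def\<close>)
next
  case (Suc n)
  then obtain a b where ab: "br n a b" "a < x" "x < b"
    "a = 0 \<or> (0 < a \<and> (\<exists>j<n. ct j a))" "b = 1 \<or> (b < 1 \<and> (\<exists>j<n. ct j b))"
    by (metis free_Suc)
  show ?case
  proof (cases "\<exists>z. a < z \<and> z < b \<and> (f ^^ n) z = c")
    case False
    have "br (Suc n) a b" using ab(1) False by (auto simp: branch_def free_Suc)
    moreover have "a = 0 \<or> (0 < a \<and> (\<exists>j<Suc n. ct j a))" using ab(4) less_SucI by blast
    moreover have "b = 1 \<or> (b < 1 \<and> (\<exists>j<Suc n. ct j b))" using ab(5) less_SucI by blast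
    ultimately show ?thesis using ab(2,3) Suc.prems(1) by blast
  next
    case True
    then obtain z where z: "a < z" "z < b" "(f ^^ n) z = c" by blast
    have ctz: "ct n z" using z ab(1) by (auto simp: cut_def branch_def)
    have neq: "(f ^^ n) y \<noteq> c" if "a < y" "y < b" "y \<noteq> z" for y
      using branch_mono[OF ab(1) order_refl, of y z] branch_mono[OF ab(1) order_refl, of z y] z that
      by force
    have "x \<noteq> z" using Suc.prems z by (auto simp: free_Suc)
    then consider "z < x" | "x < z" by linarith
    then show ?thesis
    proof cases
      case 1
      have "br (Suc n) z b" using ab(1) 1 z neq by (auto simp: branch_def free_Suc)
      moreover have "0 < z \<and> (\<exists>j<Suc n. ct j z)" using ctz z branchD(1)[OF ab(1)] by auto
      moreover have "b = 1 \<or> (b < 1 \<and> (\<exists>j<Suc n. ct j b))" using ab(5) less_SucI by blast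
      ultimately show ?thesis using 1 ab(3) Suc.prems(1) by blast
    next
      case 2
      have "br (Suc n) a z" using ab(1) 2 z neq by (auto simp: branch_def free_Suc)
      moreover have "z < 1 \<and> (\<exists>j<Suc n. ct j z)" using ctz z branchD(3)[OF ab(1)] by auto
      moreover have "a = 0 \<or> (0 < a \<and> (\<exists>j<Suc n. ct j a))" using ab(4) less_SucI by blast
      ultimately show ?thesis using 2 ab(2) Suc.prems(1) by blast
    qed
  qed
qed

text \<open>
  At the left end of a maximal branch, cut at time \<open>j\<close>, the branch is mapped by \<open>f ^^ j\<close> onto a right
  neighbourhood of \<open>c\<close>.
\<close>

lemma left_cut_free:
  assumes "br n t s" "ct j t" "j \<le> n" "t \<le> z" "z < s"
  shows "fr j z"
  using branch_free[OF assms(1), of z j] assms by (cases "z = t") (auto simp: cut_def)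

lemma left_cut_above:
  assumes "br n t s" "0 < t" "ct j t" "j \<le> n" "t < y" "y < s"
  shows "c < (f ^^ j) y"
proof -
  have "(f ^^ j) t < (f ^^ j) y"
    by (rule iter_mono)
      (use assms branchD(3)[OF assms(1)] left_cut_free[OF assms(1,3,4)] in auto)
  then show ?thesis using assms by (simp add: cut_def)
qed

lemma left_cut_ivt:
  assumes "br n t s" "0 < t" "ct j t" "j \<le> n" "t < y" "y < s" "c < w" "w \<le> (f ^^ j) y"
  obtains z where "t < z" "z \<le> y" "(f ^^ j) z = w"
proof -
  have "\<exists>z. t \<le> z \<and> z \<le> y \<and> (f ^^ j) z = w"
    by (rule iter_ivt[of t y j w])
      (use assms branchD(3)[OF assms(1)] left_cut_free[OF assms(1,3,4)] in \<open>auto simp: cut_def\<close>)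
  then show thesis using that assms by (metis cut_def less_le)
qed

end

section \<open>Trapped branches carry periodic attractors\<close>

context lorenz_cross
begin

lemma funpow_mult_plus: "(f ^^ (k * n + i)) x = (f ^^ i) (((f ^^ n) ^^ k) x)"
proof -
  have "(f ^^ n) ^^ k = f ^^ (k * n)" by (simp add: funpow_mult mult.commute)
  then show ?thesis by (simp add: funpow_plus)
qed

text \<open>
  The return map \<open>g = f ^^ n\<close> is increasing and expands cross-ratios strictly, so it is not the identity.
  Between a point \<open>x0\<close> and \<open>g x0 \<noteq> x0\<close> all orbits move monotonically in each residue class of times modulo
  \<open>n\<close>, with the same limits; these finitely many limits form a set that attracts an open interval.
\<close>

lemma trapped_branch_attractor:
  assumes b: "br n a b" and n: "0 < n"
    and trap: "\<And>x. a < x \<Longrightarrow> x < b \<Longrightarrow> a < (f ^^ n) x \<and> (f ^^ n) x < b"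
  shows "\<exists>A. periodic_attractor f c A"
proof -
  define g where "g = f ^^ n"
  have ab: "0 \<le> a" "a < b" "b \<le> 1" using branchD[OF b] by auto
  have gin: "a < (g ^^ k) x \<and> (g ^^ k) x < b" if "a < x" "x < b" for x k
    using that trap by (induction k) (auto simp: g_def)
  have split: "(f ^^ m) x = (f ^^ (m mod n)) ((g ^^ (m div n)) x)" for m x
    using funpow_mult_plus[of "m div n" n "m mod n" x] by (simp add: g_def)
  have nc: "(f ^^ m) x \<noteq> c" if "a < x" "x < b" for m x
  proof -
    have "fr n ((g ^^ (m div n)) x)" using branchD(4)[OF b] gin[OF that] by blast
    then show ?thesis using split[of m x] n by (simp add: free_def)
  qed
  have gm: "g x < g y" if "a < x" "x < y" "y < b" for x y
    unfolding g_def by (rule branch_mono[OF b order_refl that])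
  have gkm: "(g ^^ k) x < (g ^^ k) y" if "a < x" "x < y" "y < b" for x y k
    using that by (induction k) (auto intro!: gm simp: gin)
  have "\<exists>x. a < x \<and> x < b \<and> g x \<noteq> x"
  proof (rule ccontr)
    assume *: "\<not> ?thesis"
    define p where "p i = a + i * (b - a) / 5" for i :: real
    have p: "a < p 1" "p 1 < p 2" "p 2 < p 3" "p 3 < p 4" "p 4 < b" using ab by (auto simp: p_def field_simps)
    have "cross_ratio (p 1) (p 2) (p 3) (p 4) <
        cross_ratio ((f ^^ n) (p 1)) ((f ^^ n) (p 2)) ((f ^^ n) (p 3)) ((f ^^ n) (p 4))"
      using iter_cross[of "p 1" "p 2" "p 3" "p 4" n] p ab n branchD(4)[OF b] by auto
    moreover have "(f ^^ n) (p i) = p i" if "i \<in> {1, 2, 3, 4}" for i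
      using * p that unfolding g_def by force
    ultimately show False by simp
  qed
  then obtain x0 where x0: "a < x0" "x0 < b" "g x0 \<noteq> x0" by blast
  define u where "u k = (g ^^ k) x0" for k
  have uin: "a < u k" "u k < b" for k using gin[OF x0(1,2)] by (auto simp: u_def)
  have uS: "u (Suc k) = (g ^^ k) (g x0)" for k by (simp add: u_def funpow_swap1)
  have g0: "a < g x0" "g x0 < b" using gin[OF x0(1,2), of 1] by auto
  have fim: "(f ^^ i) x < (f ^^ i) y" if "i < n" "a < x" "x < y" "y < b" for i x y
    by (rule branch_mono[OF b _ that(2-4)]) (use that in simp)
  have mon: "monoseq (\<lambda>k. (f ^^ i) (u k))" if i: "i < n" for i
  proof (cases "x0 < g x0")
    case True
    then have "(f ^^ i) (u k) \<le> (f ^^ i) (u (Suc k))" for k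
      using fim[OF i uin(1) _ uin(2), of k "Suc k"] gkm[OF x0(1) True g0(2), of k] uS[of k] by (simp add: u_def)
    then show ?thesis by (simp add: monoseq_Suc)
  next
    case False
    then have "g x0 < x0" using x0 by simp
    then have "(f ^^ i) (u (Suc k)) \<le> (f ^^ i) (u k)" for k
      using fim[OF i uin(1) _ uin(2), of "Suc k" k] gkm[OF g0(1) _ x0(2), of k] uS[of k] by (simp add: u_def)
    then show ?thesis by (simp add: monoseq_Suc)
  qed
  have "convergent (\<lambda>k. (f ^^ i) (u k))" if i: "i < n" for i
  proof (rule Bseq_monoseq_convergent[OF _ mon[OF i]])
    show "Bseq (\<lambda>k. (f ^^ i) (u k))"
    proof (rule BseqI')
      fix k show "norm ((f ^^ i) (u k)) \<le> 1"
        using branch_inner[OF b uin, of i k] i by simp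
    qed
  qed
  then have "\<forall>i\<in>{..<n}. \<exists>l. (\<lambda>k. (f ^^ i) (u k)) \<longlonglongrightarrow> l" by (simp add: convergent_def)
  then obtain l where "\<forall>i\<in>{..<n}. (\<lambda>k. (f ^^ i) (u k)) \<longlonglongrightarrow> l i" by (auto dest: bchoice)
  then have l: "(\<lambda>k. (f ^^ i) (u k)) \<longlonglongrightarrow> l i" if "i < n" for i using that by simp
  define J where "J = {min x0 (g x0)<..<max x0 (g x0)}"
  have Jin: "a < t" "t < b" if "t \<in> J" for t using that x0 g0 by (auto simp: J_def)
  have lt: "(\<lambda>k. (f ^^ i) ((g ^^ k) t)) \<longlonglongrightarrow> l i" if t: "t \<in> J" and i: "i < n" for t i
  proof (rule tendsto_sandwich)
    have "min ((f ^^ i) (u k)) ((f ^^ i) (u (Suc k))) \<le> (f ^^ i) ((g ^^ k) t) \<and>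
        (f ^^ i) ((g ^^ k) t) \<le> max ((f ^^ i) (u k)) ((f ^^ i) (u (Suc k)))" for k
    proof -
      note tin = Jin[OF t] gin[OF Jin[OF t], of k]
      consider "x0 < t" "t < g x0" | "g x0 < t" "t < x0" using t by (auto simp: J_def min_def max_def split: if_splits)
      then show ?thesis
      proof cases
        case 1
        have "u k < (g ^^ k) t" "(g ^^ k) t < u (Suc k)"
          using gkm[OF x0(1) 1(1) tin(2), of k] gkm[OF tin(1) 1(2) g0(2), of k] uS[of k] by (auto simp: u_def)
        then have "(f ^^ i) (u k) < (f ^^ i) ((g ^^ k) t)" "(f ^^ i) ((g ^^ k) t) < (f ^^ i) (u (Suc k))"
          using fim[OF i] uin tin by auto
        then show ?thesis by auto
      next
        case 2
        have "u (Suc k) < (g ^^ k) t" "(g ^^ k) t < u k"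
          using gkm[OF g0(1) 2(1) tin(2), of k] gkm[OF tin(1) 2(2) x0(2), of k] uS[of k] by (auto simp: u_def)
        then have "(f ^^ i) (u (Suc k)) < (f ^^ i) ((g ^^ k) t)" "(f ^^ i) ((g ^^ k) t) < (f ^^ i) (u k)"
          using fim[OF i] uin tin by auto
        then show ?thesis by auto
      qed
    qed
    then show "\<forall>\<^sub>F k in sequentially. min ((f ^^ i) (u k)) ((f ^^ i) (u (Suc k))) \<le> (f ^^ i) ((g ^^ k) t)"
      "\<forall>\<^sub>F k in sequentially. (f ^^ i) ((g ^^ k) t) \<le> max ((f ^^ i) (u k)) ((f ^^ i) (u (Suc k)))"
      by (auto intro: always_eventually)
    have s: "(\<lambda>k. (f ^^ i) (u (Suc k))) \<longlonglongrightarrow> l i" using l[OF i] by (rule LIMSEQ_Suc)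
    show "(\<lambda>k. min ((f ^^ i) (u k)) ((f ^^ i) (u (Suc k)))) \<longlonglongrightarrow> l i" using tendsto_min[OF l[OF i] s] by simp
    show "(\<lambda>k. max ((f ^^ i) (u k)) ((f ^^ i) (u (Suc k)))) \<longlonglongrightarrow> l i" using tendsto_max[OF l[OF i] s] by simp
  qed
  have om: "omega_limit f c t = l ` {..<n}" if t: "t \<in> J" for t
  proof
    show "l ` {..<n} \<subseteq> omega_limit f c t"
    proof
      fix y assume "y \<in> l ` {..<n}"
      then obtain i where i: "i < n" "y = l i" by auto
      have "(\<lambda>j. (f ^^ (j * n + i)) t) \<longlonglongrightarrow> y"
        using lt[OF t i(1)] i(2) by (simp add: funpow_mult_plus g_def)
      moreover have "filterlim (\<lambda>j. j * n + i) at_top sequentially"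
        unfolding filterlim_at_top
      proof
        fix Z
        have "Z \<le> j * n + i" if "Z \<le> j" for j
        proof -
          have "j * 1 \<le> j * n" by (rule mult_le_mono2) (use n in simp)
          then show ?thesis using that by linarith
        qed
        then show "\<forall>\<^sub>F j in sequentially. Z \<le> j * n + i" unfolding eventually_sequentially by blast
      qed
      ultimately show "y \<in> omega_limit f c t"
        unfolding omega_limit_def using nc[OF Jin[OF t]] by blast
    qed
    show "omega_limit f c t \<subseteq> l ` {..<n}"
    proof
      fix y assume "y \<in> omega_limit f c t"
      then obtain r :: "nat \<Rightarrow> nat" where r: "filterlim r at_top sequentially" "(\<lambda>j. (f ^^ r j) t) \<longlonglongrightarrow> y"
        by (auto simp: omega_limit_def)
      show "y \<in> l ` {..<n}"
      proof (rule ccontr)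
        assume ny: "y \<notin> l ` {..<n}"
        define e where "e = Min ((\<lambda>i. \<bar>y - l i\<bar>) ` {..<n})"
        have e: "0 < e" unfolding e_def using ny n by (subst Min_gr_iff) auto
        have ele: "e \<le> \<bar>y - l i\<bar>" if "i < n" for i unfolding e_def using that by (intro Min_le) auto
        have "\<exists>K. \<forall>k\<ge>K. \<bar>(f ^^ i) ((g ^^ k) t) - l i\<bar> < e / 2" if "i < n" for i
          using tendstoD[OF lt[OF t that], of "e / 2"] e by (simp add: eventually_sequentially dist_real_def)
        then obtain K where K: "\<And>i k. i < n \<Longrightarrow> k \<ge> K i \<Longrightarrow> \<bar>(f ^^ i) ((g ^^ k) t) - l i\<bar> < e / 2" by metis
        define K0 where "K0 = Max (K ` {..<n})"
        have K0: "K i \<le> K0" if "i < n" for i unfolding K0_def using that by (intro Max_ge) auto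
        have far: "e / 2 \<le> \<bar>(f ^^ m) t - y\<bar>" if m: "m \<ge> K0 * n" for m
        proof -
          have "K0 \<le> m div n" using m n by (simp add: less_eq_div_iff_mult_less_eq)
          moreover have mn: "m mod n < n" using n by simp
          ultimately have "K (m mod n) \<le> m div n" using K0 order_trans by blast
          then have "\<bar>(f ^^ m) t - l (m mod n)\<bar> < e / 2" using K[OF mn] split[of m t] by simp
          then show ?thesis using ele[OF mn] by linarith
        qed
        have e2: "0 < e / 2" using e by simp
        have "\<forall>\<^sub>F j in sequentially. dist ((f ^^ r j) t) y < e / 2" by (rule tendstoD[OF r(2) e2])
        moreover have "\<forall>\<^sub>F j in sequentially. K0 * n \<le> r j" using r(1) by (simp add: filterlim_at_top)
        ultimately have "\<forall>\<^sub>F j in sequentially. False"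
        proof eventually_elim
          case (elim j) then show ?case using far[of "r j"] by (simp add: dist_real_def)
        qed
        then show False by simp
      qed
    qed
  qed
  have "J \<subseteq> {x \<in> {0..1}. omega_limit f c x = l ` {..<n}}"
    using om Jin ab by (force simp: less_imp_le)
  moreover have "open J" by (simp add: J_def)
  ultimately have "J \<subseteq> interior {x \<in> {0..1}. omega_limit f c x = l ` {..<n}}" by (rule interior_maximal)
  moreover have "J \<noteq> {}" using x0(3) by (auto simp: J_def min_def max_def)
  ultimately have "periodic_attractor f c (l ` {..<n})" unfolding periodic_attractor_def by auto
  then show ?thesis by blast
qed

end

section \<open>Homtervals wander\<close>

definition regular :: "(real \<Rightarrow> real) \<Rightarrow> real \<Rightarrow> real \<Rightarrow> bool" where
  "regular f c x \<longleftrightarrow> 0 < x \<and> x < 1 \<and> (\<forall>n. (f ^^ n) x \<noteq> c)"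

definition homterval :: "(real \<Rightarrow> real) \<Rightarrow> real \<Rightarrow> real \<Rightarrow> real \<Rightarrow> bool" where
  "homterval f c a b \<longleftrightarrow> 0 \<le> a \<and> a < b \<and> b \<le> 1 \<and> (\<forall>x. a < x \<and> x < b \<longrightarrow> regular f c x)"

definition reflect :: "(real \<Rightarrow> real) \<Rightarrow> real \<Rightarrow> real" where
  "reflect f x = 1 - f (1 - x)"

text \<open>
  Absence of periodic attractors, in a form that refers to iterates only and is therefore preserved
  by reflection.
\<close>

locale lorenz_dyn = lorenz_cross +
  assumes no_trap: "\<And>a b n. branch f c n a b \<Longrightarrow> 0 < n \<Longrightarrow>
     (\<forall>x. a < x \<and> x < b \<longrightarrow> a < (f ^^ n) x \<and> (f ^^ n) x < b) \<Longrightarrow> False"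
begin

abbreviation "reg \<equiv> regular f c"
abbreviation "hom \<equiv> homterval f c"

lemma reg_free: "reg x \<Longrightarrow> fr n x"
  by (simp add: regular_def free_def)

lemma reg_inner: "reg x \<Longrightarrow> 0 < x" "reg x \<Longrightarrow> x < 1"
  by (simp_all add: regular_def)

lemma reg_iter: "reg x \<Longrightarrow> reg ((f ^^ n) x)"
  using iter_inner[of x n] reg_free[of x n] by (auto simp: regular_def funpow_plus)

lemma not_reg_cut:
  assumes "0 < x" "x < 1" "\<not> reg x" obtains k where "ct k x"
proof -
  from assms obtain n where n: "(f ^^ n) x = c" by (auto simp: regular_def)
  define k where "k = (LEAST n. (f ^^ n) x = c)"
  have "(f ^^ k) x = c" unfolding k_def by (rule LeastI[of _ n]) (rule n)
  moreover have "(f ^^ i) x \<noteq> c" if "i < k" for i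
    using not_less_Least[of i "\<lambda>n. (f ^^ n) x = c"] that unfolding k_def by blast
  ultimately have "ct k x" by (simp add: cut_def free_def)
  then show thesis by (rule that)
qed

lemma cut_not_reg: "ct k x \<Longrightarrow> \<not> reg x"
  by (auto simp: cut_def regular_def)

lemma hom_branch: "hom a b \<Longrightarrow> br n a b"
  by (auto simp: homterval_def branch_def intro: reg_free)

lemma homD: "hom a b \<Longrightarrow> a < x \<Longrightarrow> x < b \<Longrightarrow> reg x" "hom a b \<Longrightarrow> 0 \<le> a"
  "hom a b \<Longrightarrow> a < b" "hom a b \<Longrightarrow> b \<le> 1"
  by (auto simp: homterval_def)

lemma hom_subset: "hom a b \<Longrightarrow> a \<le> a' \<Longrightarrow> a' < b' \<Longrightarrow> b' \<le> b \<Longrightarrow> hom a' b'"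
  by (auto simp: homterval_def)

lemma not_hom_cut:
  assumes "0 \<le> a" "a < b" "b \<le> 1" "\<not> hom a b"
  obtains y k where "a < y" "y < b" "ct k y"
proof -
  from assms obtain y where y: "a < y" "y < b" "\<not> reg y" by (auto simp: homterval_def)
  obtain k where "ct k y" using not_reg_cut[of y] assms y by auto
  with y show thesis by (intro that)
qed

text \<open>
  If two images met, the images under all multiples of the time difference would form a chain of overlapping
  intervals, and their union would be a trapped branch.
\<close>

lemma hom_wandering:
  assumes h: "hom a b" and xy: "a < x" "x < b" "a < y" "y < b" and mn: "m < n"
  shows "(f ^^ m) x \<noteq> (f ^^ n) y"
proof
  assume eq: "(f ^^ m) x = (f ^^ n) y"
  define p where "p = n - m"
  have p: "0 < p" "n = m + p" using mn by (auto simp: p_def)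
  define C where "C k = (f ^^ (m + k * p)) ` {a<..<b}" for k
  define I where "I = (\<Union>k. C k)"
  have contC: "connected (C k)" for k
    unfolding C_def
  proof (intro connected_continuous_image iter_cont_on)
    show "{a<..<b} \<subseteq> {0..1}" using homD(2,4)[OF h] by auto
    show "fr (m + k * p) x" if "x \<in> {a<..<b}" for x
      using homD(1)[OF h, of x] that reg_free[of x] by simp
  qed simp
  have meet: "C k \<inter> C (Suc k) \<noteq> {}" for k
  proof -
    have "(f ^^ (m + k * p)) x = (f ^^ (k * p)) ((f ^^ m) x)" by (simp add: funpow_plus)
    also have "\<dots> = (f ^^ (m + Suc k * p)) y" by (simp add: eq p funpow_plus ac_simps)
    finally have "(f ^^ (m + k * p)) x \<in> C (Suc k)" unfolding C_def using xy by simp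
    moreover have "(f ^^ (m + k * p)) x \<in> C k" unfolding C_def using xy by simp
    ultimately show ?thesis by blast
  qed
  have conU: "connected (\<Union>k\<le>K. C k)" for K
  proof (induction K)
    case 0 then show ?case using contC by simp
  next
    case (Suc K)
    have "(\<Union>k\<le>Suc K. C k) = (\<Union>k\<le>K. C k) \<union> C (Suc K)" by (auto simp: le_Suc_eq)
    moreover have "(\<Union>k\<le>K. C k) \<inter> C (Suc K) \<noteq> {}" using meet[of K] by blast
    ultimately show ?case using connected_Un[OF Suc contC] by simp
  qed
  have "connected (\<Union>(range (\<lambda>K. \<Union>k\<le>K. C k)))"
  proof (rule connected_Union)
    have "C 0 \<subseteq> (\<Union>k\<le>K. C k)" for K by blast
    moreover have "C 0 \<noteq> {}" using xy by (auto simp: C_def)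
    ultimately show "\<Inter> (range (\<lambda>K. \<Union>k\<le>K. C k)) \<noteq> {}" by blast
  qed (use conU in auto)
  moreover have "\<Union>(range (\<lambda>K. \<Union>k\<le>K. C k)) = I" unfolding I_def by auto
  ultimately have conI: "connected I" by simp
  have regI: "reg z" if "z \<in> I" for z
    using that reg_iter[OF homD(1)[OF h]] by (auto simp: I_def C_def)
  have stepI: "(f ^^ p) z \<in> I" if "z \<in> I" for z
  proof -
    from that obtain k w where w: "a < w" "w < b" "z = (f ^^ (m + k * p)) w" by (auto simp: I_def C_def)
    have "(f ^^ p) z = (f ^^ (m + Suc k * p)) w" by (simp add: w funpow_plus ac_simps)
    then have "(f ^^ p) z \<in> C (Suc k)" unfolding C_def using w by (simp del: mult_Suc)
    then show ?thesis unfolding I_def by blast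
  qed
  have openI: "\<exists>u\<in>I. \<exists>v\<in>I. u < z \<and> z < v" if "z \<in> I" for z
  proof -
    from that obtain k w where w: "a < w" "w < b" "z = (f ^^ (m + k * p)) w" by (auto simp: I_def C_def)
    have "(f ^^ (m + k * p)) ((a + w)/2) < z" "z < (f ^^ (m + k * p)) ((b + w)/2)"
      using w by (auto intro!: branch_mono[OF hom_branch[OF h] order_refl])
    moreover have "(f ^^ (m + k * p)) ((a + w)/2) \<in> I" "(f ^^ (m + k * p)) ((b + w)/2) \<in> I"
      unfolding I_def C_def using w by (auto intro!: exI[of _ k])
    ultimately show ?thesis by blast
  qed
  have "bdd_below I"
    by (rule bdd_belowI[of _ 0]) (simp add: less_imp_le reg_inner(1)[OF regI])
  moreover have "bdd_above I"
    by (rule bdd_aboveI[of _ 1]) (simp add: less_imp_le reg_inner(2)[OF regI])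
  ultimately have bdd: "bdd_below I" "bdd_above I" .
  have ne: "I \<noteq> {}" using xy by (auto simp: I_def C_def)
  let ?l = "Inf I" and ?r = "Sup I"
  have strict: "?l < z \<and> z < ?r" if zI: "z \<in> I" for z
  proof -
    obtain u v where "u \<in> I" "v \<in> I" "u < z" "z < v" using openI[OF zI] by blast
    then show ?thesis
      using cInf_lower[OF _ bdd(1), of u] cSup_upper[OF _ bdd(2), of v] by linarith
  qed
  have inI: "z \<in> I" if z: "?l < z" "z < ?r" for z
  proof -
    obtain u where u: "u \<in> I" "u < z" using cInf_lessD[OF ne z(1)] by blast
    obtain v where v: "v \<in> I" "z < v" using less_cSupD[OF ne z(2)] by blast
    show ?thesis using connected_contains_Icc[OF conI u(1) v(1)] u v by auto
  qed
  have "0 \<le> ?l" by (rule cInf_greatest[OF ne]) (simp add: less_imp_le reg_inner(1)[OF regI])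
  moreover have "?r \<le> 1" by (rule cSup_least[OF ne]) (simp add: less_imp_le reg_inner(2)[OF regI])
  moreover have "?l < ?r" using strict ne by force
  ultimately have "br p ?l ?r"
    using inI regI reg_free by (auto simp: branch_def)
  then show False
    using no_trap[OF _ p(1)] inI stepI strict by blast
qed

text \<open>
  The images are disjoint subintervals of \<open>[0, 1]\<close>, so their lengths are summable.
\<close>

lemma lengths_tendsto_0:
  assumes "x < y" and r: "\<And>z. x \<le> z \<Longrightarrow> z \<le> y \<Longrightarrow> reg z"
  shows "(\<lambda>n. (f ^^ n) y - (f ^^ n) x) \<longlonglongrightarrow> 0"
proof -
  have h: "hom x y"
    unfolding homterval_def using assms reg_inner[of x] reg_inner[of y] by auto
  have ord: "(f ^^ n) x < (f ^^ n) y" for n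
    by (rule iter_mono) (use assms reg_inner[OF r] reg_free[OF r] in \<open>auto intro: less_imp_le\<close>)
  define A where "A n = {(f ^^ n) x<..<(f ^^ n) y}" for n
  have pre: "\<exists>u. x < u \<and> u < y \<and> (f ^^ n) u = w" if "w \<in> A n" for n w
  proof -
    have "\<exists>u. x \<le> u \<and> u \<le> y \<and> (f ^^ n) u = w"
      by (rule iter_ivt[of x y n w])
        (use that assms reg_inner[OF r] reg_free[OF r] in \<open>auto simp: A_def intro: less_imp_le\<close>)
    then show ?thesis using that unfolding A_def
      by (metis greaterThanLessThan_iff less_irrefl order_le_imp_less_or_eq)
  qed
  have disj: "A m \<inter> A n = {}" if "m < n" for m n
  proof (rule ccontr)
    assume "\<not> ?thesis"
    then obtain w where "w \<in> A m" "w \<in> A n" by blast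
    then obtain u v where "x < u" "u < y" "(f ^^ m) u = w" "x < v" "v < y" "(f ^^ n) v = w"
      using pre by metis
    then show False using hom_wandering[OF h _ _ _ _ that, of u v] by simp
  qed
  have df: "disjoint_family_on A {..<N}" for N
    unfolding disjoint_family_on_def
  proof (intro ballI impI)
    fix i j :: nat assume "i \<noteq> j"
    then show "A i \<inter> A j = {}" using disj[of i j] disj[of j i] by (cases "i < j") auto
  qed
  have sub: "A n \<subseteq> {0..1}" for n
    using reg_inner(1)[OF reg_iter[OF r], of x n] reg_inner(2)[OF reg_iter[OF r], of y n] assms(1)
    unfolding A_def by auto
  have "(\<Sum>n<N. (f ^^ n) y - (f ^^ n) x) \<le> 1" for N
  proof -
    have "(\<Sum>n<N. (f ^^ n) y - (f ^^ n) x) = (\<Sum>n<N. measure lebesgue (A n))"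
      using ord by (simp add: A_def less_imp_le)
    also have "\<dots> = measure lebesgue (\<Union>n<N. A n)"
    proof (rule measure_finite_Union[symmetric])
      show "emeasure lebesgue (A n) \<noteq> \<infinity>" for n
        using ord[of n] by (simp add: A_def less_imp_le)
      show "A ` {..<N} \<subseteq> sets lebesgue" by (auto simp: A_def)
    qed (rule finite_lessThan df)+
    also have "\<dots> \<le> measure lebesgue {0..1::real}"
      by (rule measure_mono_fmeasurable) (use sub in \<open>auto simp: A_def intro!: sets.finite_UN\<close>)
    finally show ?thesis by simp
  qed
  then have "summable (\<lambda>n. (f ^^ n) y - (f ^^ n) x)"
    by (intro summableI_nonneg_bounded[of _ 1]) (use ord in \<open>auto simp: less_imp_le\<close>)
  then show ?thesis by (rule summable_LIMSEQ_zero)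
qed

text \<open>
  The image of \<open>(0, b)\<close> always starts at the fixed point \<open>0\<close>, so it stays to the left of \<open>c\<close> if
  it never contains \<open>c\<close>; then the union of the images is trapped.
\<close>

lemma not_hom_0: "\<not> hom 0 b"
proof
  assume h: "hom 0 b"
  define x where "x = b / 2"
  have x: "0 < x" "x < b" "b \<le> 1" using homD(3,4)[OF h] by (auto simp: x_def)
  have r: "reg z" if "0 < z" "z \<le> x" for z using homD(1)[OF h] that x by auto
  have below: "(f ^^ n) x < c" for n
  proof (rule ccontr)
    assume "\<not> ?thesis"
    moreover have "fr n z" if "0 \<le> z" "z \<le> x" for z
    proof (cases "z = 0")
      case False
      then show ?thesis using that r[of z] reg_free[of z n] by simp
    qed (simp add: free_0)
    moreover have "(f ^^ n) 0 \<le> c" "0 \<le> x" "x \<le> 1" using x c01 by (auto simp: iter_0)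
    ultimately obtain z where z: "0 \<le> z" "z \<le> x" "(f ^^ n) z = c"
      using iter_ivt[of 0 x n c] by (metis order_refl not_less)
    then have "z \<noteq> 0" using c01 by (auto simp: iter_0)
    then show False using r[of z] z by (simp add: regular_def)
  qed
  define z where "z = Sup (range (\<lambda>n. (f ^^ n) x))"
  have bdd: "bdd_above (range (\<lambda>n. (f ^^ n) x))" using less_imp_le[OF below] by (intro bdd_aboveI[of _ c]) auto
  have up: "(f ^^ n) x \<le> z" for n unfolding z_def by (rule cSup_upper[OF _ bdd]) simp
  have zc: "z \<le> c" unfolding z_def by (rule cSup_least) (use less_imp_le[OF below] in auto)
  have z0: "0 < z" using up[of 0] x by simp
  have "br 1 0 z" using z0 zc c01 by (auto simp: branch_def free_def)
  moreover have "0 < (f ^^ 1) y \<and> (f ^^ 1) y < z" if y: "0 < y" "y < z" for y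
  proof -
    obtain n where n: "y < (f ^^ n) x"
      using \<open>y < z\<close> unfolding z_def less_cSUP_iff[OF UNIV_not_empty bdd] by blast
    have "f y < f ((f ^^ n) x)" using monoL[OF _ n below] \<open>0 < y\<close> by simp
    also have "\<dots> \<le> z" using up[of "Suc n"] by simp
    finally show ?thesis using f_inner(1)[of y] y zc c01 by simp
  qed
  ultimately show False using no_trap[of 1 0 z] by simp
qed

end

subsection \<open>Reversing the orientation of the interval\<close>

lemma funpow_reflect: "(reflect f ^^ n) x = 1 - (f ^^ n) (1 - x)"
  by (induction n) (auto simp: reflect_def)

lemma free_reflect: "free (reflect f) (1 - c) n x \<longleftrightarrow> free f c n (1 - x)"
  by (auto simp: free_def funpow_reflect)

lemma cut_reflect: "cut (reflect f) (1 - c) n x \<longleftrightarrow> cut f c n (1 - x)"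
  by (auto simp: cut_def free_reflect funpow_reflect)

lemma branch_reflect: "branch (reflect f) (1 - c) n a b \<longleftrightarrow> branch f c n (1 - b) (1 - a)"
proof -
  have "(\<forall>x. a < x \<and> x < b \<longrightarrow> free f c n (1 - x)) \<longleftrightarrow>
        (\<forall>x. 1 - b < x \<and> x < 1 - a \<longrightarrow> free f c n x)"
  proof (intro iffI allI impI)
    fix x assume "\<forall>x. a < x \<and> x < b \<longrightarrow> free f c n (1 - x)" "1 - b < x \<and> x < 1 - a"
    then show "free f c n x" by (auto dest!: spec[of _ "1 - x"])
  qed auto
  then show ?thesis by (auto simp: branch_def free_reflect)
qed

lemma regular_reflect: "regular (reflect f) (1 - c) x \<longleftrightarrow> regular f c (1 - x)"
  by (auto simp: regular_def funpow_reflect)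

lemma homterval_reflect: "homterval (reflect f) (1 - c) a b \<longleftrightarrow> homterval f c (1 - b) (1 - a)"
proof -
  have "(\<forall>x. a < x \<and> x < b \<longrightarrow> regular f c (1 - x)) \<longleftrightarrow>
        (\<forall>x. 1 - b < x \<and> x < 1 - a \<longrightarrow> regular f c x)"
  proof (intro iffI allI impI)
    fix x assume "\<forall>x. a < x \<and> x < b \<longrightarrow> regular f c (1 - x)" "1 - b < x \<and> x < 1 - a"
    then show "regular f c x" by (auto dest!: spec[of _ "1 - x"])
  qed auto
  then show ?thesis by (auto simp: homterval_def regular_reflect)
qed

lemma cross_ratio_reflect:
  "cross_ratio (1 - e) (1 - d) (1 - b) (1 - a) = cross_ratio a b d e"
  by (simp add: cross_ratio_def algebra_simps)

context lorenz_dyn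
begin

lemma reflect_dyn: "lorenz_dyn (reflect f) (1 - c)"
proof unfold_locales
  show "0 < 1 - c" "1 - c < 1" using c01 by auto
  show "reflect f 0 = 0" "reflect f 1 = 1" by (auto simp: reflect_def f0 f1)
  have "continuous_on ({0..1} - {1 - c}) (f \<circ> (\<lambda>x. 1 - x))"
  proof (intro continuous_on_compose)
    show "continuous_on ({0..1} - {1 - c}) (\<lambda>x. 1 - x)" by (intro continuous_intros)
    show "continuous_on ((\<lambda>x. 1 - x) ` ({0..1} - {1 - c})) f"
      by (rule continuous_on_subset[OF cont]) auto
  qed
  then show "continuous_on ({0..1} - {1 - c}) (reflect f)"
    unfolding reflect_def comp_def by (intro continuous_intros)
  show "reflect f x < reflect f y" if "0 \<le> x" "x < y" "y < 1 - c" for x y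
    using monoR[of "1 - y" "1 - x"] that by (simp add: reflect_def)
  show "reflect f x < reflect f y" if "1 - c < x" "x < y" "y \<le> 1" for x y
    using monoL[of "1 - y" "1 - x"] that by (simp add: reflect_def)
  show "0 \<le> reflect f x \<and> reflect f x \<le> 1" if "0 \<le> x" "x \<le> 1" "x \<noteq> 1 - c" for x
    using range[of "1 - x"] that by (auto simp: reflect_def)
  show "\<exists>d>0. (reflect f has_real_derivative d) (at x)" if x: "0 < x" "x < 1" "x \<noteq> 1 - c" for x
  proof -
    obtain d where d: "d > 0" "(f has_real_derivative d) (at (1 - x))"
      using deriv[of "1 - x"] x by auto
    have "((\<lambda>y. 1 - f (1 - y)) has_real_derivative d) (at x)"
      using d(2) by (auto intro!: derivative_eq_intros DERIV_chain2[where f=f])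
    then show ?thesis using d(1) unfolding reflect_def by blast
  qed
  show "cross_ratio a b d e < cross_ratio (reflect f a) (reflect f b) (reflect f d) (reflect f e)"
    if "0 < a" "a < b" "b < d" "d < e" "e < 1" "e < 1 - c \<or> 1 - c < a" for a b d e
  proof -
    have "cross_ratio (1 - e) (1 - d) (1 - b) (1 - a) <
        cross_ratio (f (1 - e)) (f (1 - d)) (f (1 - b)) (f (1 - a))"
      by (rule cross) (use that in auto)
    also have "\<dots> = cross_ratio (1 - f (1 - a)) (1 - f (1 - b)) (1 - f (1 - d)) (1 - f (1 - e))"
      by (simp add: cross_ratio_reflect)
    finally show ?thesis by (simp add: cross_ratio_reflect reflect_def)
  qed
  show False if b: "branch (reflect f) (1 - c) n a b" and n: "0 < n"
    and tr: "\<forall>x. a < x \<and> x < b \<longrightarrow> a < (reflect f ^^ n) x \<and> (reflect f ^^ n) x < b" for a b n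
  proof (rule no_trap)
    show "br n (1 - b) (1 - a)" using b by (simp add: branch_reflect)
    show "\<forall>x. 1 - b < x \<and> x < 1 - a \<longrightarrow> 1 - b < (f ^^ n) x \<and> (f ^^ n) x < 1 - a"
    proof (intro allI impI)
      fix x assume "1 - b < x \<and> x < 1 - a"
      then show "1 - b < (f ^^ n) x \<and> (f ^^ n) x < 1 - a"
        using tr[rule_format, of "1 - x"] by (simp add: funpow_reflect)
    qed
  qed (rule n)
qed

lemma not_hom_1: "\<not> hom a 1"
  using lorenz_dyn.not_hom_0[OF reflect_dyn, of "1 - a"] by (simp add: homterval_reflect)

section \<open>Gaps next to a cut\<close>

text \<open>
  If \<open>f ^^ j\<close> sends the left end of a branch of \<open>f ^^ n\<close> to \<open>c\<close> and the point \<open>x\<close> beyond \<open>q\<close>, then the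
  branch contains a preimage of \<open>q\<close>, which reaches \<open>c\<close> at time \<open>j + m\<close>. Hence \<open>n - j \<le> m\<close>, and
  the pullback of \<open>(c, q)\<close> has an image under \<open>f ^^ n\<close> whose length depends on \<open>q\<close> only. This is the source of
  all the room needed to apply cross-ratio expansion.
\<close>

lemma gap_left:
  assumes q: "ct m q" "c < q" "q < 1" "br m c q"
  obtains lam where "0 < lam"
    "\<And>n t s x j. br n t s \<Longrightarrow> 0 < t \<Longrightarrow> j < n \<Longrightarrow> ct j t \<Longrightarrow> t < x \<Longrightarrow> x < s \<Longrightarrow> q < (f ^^ j) x \<Longrightarrow>
       \<exists>p1 p2 y. t < p1 \<and> p1 < p2 \<and> p2 < y \<and> y < x \<and> lam \<le> (f ^^ n) p2 - (f ^^ n) p1 \<and>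
         (\<forall>z. p1 < z \<and> z < p2 \<longrightarrow> c < (f ^^ j) z \<and> (f ^^ j) z < q) \<and> ct (j + m) y"
proof -
  have m: "0 < m" using q by (cases m) (auto simp: cut_def)
  define q1 where "q1 = (2 * c + q) / 3"
  define q2 where "q2 = (c + 2 * q) / 3"
  have qq: "c < q1" "q1 < q2" "q2 < q" using q by (auto simp: q1_def q2_def field_simps)
  define lam where "lam = Min ((\<lambda>i. (f ^^ i) q2 - (f ^^ i) q1) ` {1..m})"
  have "0 < lam"
    unfolding lam_def using m qq
    by (subst Min_gr_iff) (auto intro!: branch_mono[OF q(4)])
  have lam_le: "lam \<le> (f ^^ i) q2 - (f ^^ i) q1" if "1 \<le> i" "i \<le> m" for i
    unfolding lam_def using that by (intro Min_le) auto
  show thesis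
  proof (rule that[OF \<open>0 < lam\<close>])
    fix n t s x j
    assume H: "br n t s" "0 < t" "j < n" "ct j t" "t < x" "x < s" "q < (f ^^ j) x"
    note ivt = left_cut_ivt[OF H(1,2,4) less_imp_le[OF H(3)]]
    obtain y where y: "t < y" "y \<le> x" "(f ^^ j) y = q"
      using ivt[of x q] H q by auto
    have yx: "y < x" using y H by (cases "y = x") auto
    have ys: "y < s" using yx H by simp
    obtain p2 where p2: "t < p2" "p2 \<le> y" "(f ^^ j) p2 = q2"
      using ivt[of y q2] y ys qq by auto
    have p2y: "p2 < y" using p2 y qq by (cases "p2 = y") auto
    obtain p1 where p1: "t < p1" "p1 \<le> p2" "(f ^^ j) p1 = q1"
      using ivt[of p2 q1] p2 p2y ys qq by auto
    have p12: "p1 < p2" using p1 p2 qq by (cases "p1 = p2") auto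
    have cty: "ct (j + m) y"
      using q(1) y(3) left_cut_free[OF H(1,4) less_imp_le[OF H(3)], of y] y(1) ys
      by (auto simp: cut_def free_add funpow_plus[symmetric])
    have "n \<le> j + m"
    proof (rule ccontr)
      assume "\<not> ?thesis"
      then have "(f ^^ (j + m)) y \<noteq> c" using branch_free[OF H(1), of y n] y ys by (auto simp: free_def)
      then show False using cty by (simp add: cut_def)
    qed
    then have "lam \<le> (f ^^ (n - j)) q2 - (f ^^ (n - j)) q1" using H(3) by (intro lam_le) auto
    moreover have "(f ^^ n) p2 = (f ^^ (n - j)) q2" "(f ^^ n) p1 = (f ^^ (n - j)) q1"
      using H(3) funpow_plus[of "n - j" j] p1 p2 by auto
    moreover have "c < (f ^^ j) z \<and> (f ^^ j) z < q" if "p1 < z" "z < p2" for z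
      using branch_mono[OF H(1) less_imp_le[OF H(3)], of p1 z]
        branch_mono[OF H(1) less_imp_le[OF H(3)], of z p2] that p1 p2 p2y ys qq by auto
    ultimately show "\<exists>p1 p2 y. t < p1 \<and> p1 < p2 \<and> p2 < y \<and> y < x \<and> lam \<le> (f ^^ n) p2 - (f ^^ n) p1 \<and>
         (\<forall>z. p1 < z \<and> z < p2 \<longrightarrow> c < (f ^^ j) z \<and> (f ^^ j) z < q) \<and> ct (j + m) y"
      using p1(1) p12 p2y yx cty by (intro exI[of _ p1] exI[of _ p2] exI[of _ y]) auto
  qed
qed

lemma gap_right:
  assumes q: "ct m q" "0 < q" "q < c" "br m q c"
  obtains lam where "0 < lam"
    "\<And>n t s x j. br n t s \<Longrightarrow> s < 1 \<Longrightarrow> j < n \<Longrightarrow> ct j s \<Longrightarrow> t < x \<Longrightarrow> x < s \<Longrightarrow> (f ^^ j) x < q \<Longrightarrow>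
       \<exists>p1 p2 y. x < y \<and> y < p1 \<and> p1 < p2 \<and> p2 < s \<and> lam \<le> (f ^^ n) p2 - (f ^^ n) p1 \<and>
         (\<forall>z. p1 < z \<and> z < p2 \<longrightarrow> q < (f ^^ j) z \<and> (f ^^ j) z < c) \<and> ct (j + m) y"
proof -
  interpret R: lorenz_dyn "reflect f" "1 - c" by (rule reflect_dyn)
  obtain lam where lam: "0 < lam"
    "\<And>n t s x j. R.br n t s \<Longrightarrow> 0 < t \<Longrightarrow> j < n \<Longrightarrow> R.ct j t \<Longrightarrow> t < x \<Longrightarrow> x < s \<Longrightarrow>
        1 - q < (reflect f ^^ j) x \<Longrightarrow>
       \<exists>p1 p2 y. t < p1 \<and> p1 < p2 \<and> p2 < y \<and> y < x \<and> lam \<le> (reflect f ^^ n) p2 - (reflect f ^^ n) p1 \<and>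
         (\<forall>z. p1 < z \<and> z < p2 \<longrightarrow> 1 - c < (reflect f ^^ j) z \<and> (reflect f ^^ j) z < 1 - q) \<and> R.ct (j + m) y"
  proof (rule R.gap_left[of m "1 - q"])
    show "R.ct m (1 - q)" "1 - c < 1 - q" "1 - q < 1" "R.br m (1 - c) (1 - q)"
      using q by (simp_all add: cut_reflect branch_reflect)
  qed (rule that)
  show thesis
  proof (rule that[OF lam(1)])
    fix n t s x j
    assume H: "br n t s" "s < 1" "j < n" "ct j s" "t < x" "x < s" "(f ^^ j) x < q"
    have "\<exists>p1 p2 y. 1 - s < p1 \<and> p1 < p2 \<and> p2 < y \<and> y < 1 - x \<and>
         lam \<le> (reflect f ^^ n) p2 - (reflect f ^^ n) p1 \<and>
         (\<forall>z. p1 < z \<and> z < p2 \<longrightarrow> 1 - c < (reflect f ^^ j) z \<and> (reflect f ^^ j) z < 1 - q) \<and> R.ct (j + m) y"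
      by (rule lam(2)[of n "1 - s" "1 - t" j "1 - x"])
        (use H in \<open>auto simp: branch_reflect cut_reflect funpow_reflect\<close>)
    then obtain p1 p2 y where p: "1 - s < p1" "p1 < p2" "p2 < y" "y < 1 - x"
         "lam \<le> (f ^^ n) (1 - p1) - (f ^^ n) (1 - p2)"
         "\<And>z. p1 < z \<Longrightarrow> z < p2 \<Longrightarrow> q < (f ^^ j) (1 - z) \<and> (f ^^ j) (1 - z) < c" "ct (j + m) (1 - y)"
      by (auto simp: funpow_reflect cut_reflect)
    have "q < (f ^^ j) z \<and> (f ^^ j) z < c" if "1 - p2 < z" "z < 1 - p1" for z
      using p(6)[of "1 - z"] that by simp
    then show "\<exists>p1 p2 y. x < y \<and> y < p1 \<and> p1 < p2 \<and> p2 < s \<and> lam \<le> (f ^^ n) p2 - (f ^^ n) p1 \<and>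
         (\<forall>z. p1 < z \<and> z < p2 \<longrightarrow> q < (f ^^ j) z \<and> (f ^^ j) z < c) \<and> ct (j + m) y"
      using p by (intro exI[of _ "1 - p2"] exI[of _ "1 - p1"] exI[of _ "1 - y"]) auto
  qed
qed

text \<open>
  A preimage of \<open>c\<close> of least order in the given interval.
\<close>

lemma first_cut_right:
  assumes "c < w" "w \<le> 1" "ct k y" "c < y" "y < w"
  obtains q m where "ct m q" "c < q" "q < w" "br m c q"
proof -
  let ?P = "\<lambda>m. \<exists>q. c < q \<and> q < w \<and> ct m q"
  have ex: "?P k" using assms by blast
  define m where "m = (LEAST m. ?P m)"
  obtain q where q: "c < q" "q < w" "ct m q" using LeastI[of ?P, OF ex] unfolding m_def by blast
  have "fr m z" if z: "c < z" "z < q" for z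
  proof (rule ccontr)
    assume nf: "\<not> fr m z"
    then have "\<not> reg z" using reg_free by blast
    then obtain l where l: "ct l z" using not_reg_cut[of z] z q assms c01 by auto
    have "l < m" using nf l free_mono[of l z m] by (metis cut_def not_less)
    then show False using not_less_Least[of l ?P] l z q unfolding m_def by force
  qed
  then have "br m c q" using q assms c01 by (auto simp: branch_def)
  then show thesis using that q by blast
qed

end

section \<open>Null sets\<close>

text \<open>
  Choose an open cover \<open>U\<close> of \<open>A\<close> of nearly minimal measure and cover almost all of \<open>A\<close> by
  disjoint intervals inside \<open>U\<close> (Vitali). Removing the holes of these intervals from \<open>U\<close> leaves a cover
  of \<open>A\<close> that is smaller by a factor, contradicting minimality. The set \<open>A\<close> need not be measurable.
\<close>

lemma porous_negligible:
  fixes A :: "real set"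
  assumes k: "0 < k" and A: "A \<subseteq> {0..1}"
    and porous: "\<And>x e. x \<in> A \<Longrightarrow> 0 < e \<Longrightarrow> \<exists>u v G. u \<le> x \<and> x \<le> v \<and> u < v \<and> v - u < e \<and>
       G \<in> lmeasurable \<and> G \<subseteq> {u..v} \<and> G \<inter> A = {} \<and> k * (v - u) \<le> measure lebesgue G"
  shows "negligible A"
proof -
  define M where "M = {measure lebesgue S |S. S \<in> lmeasurable \<and> A \<subseteq> S}"
  have Mne: "M \<noteq> {}" unfolding M_def using A lmeasurable_interval(1)[of "0::real" 1] by auto
  have Mbdd: "bdd_below M" unfolding M_def by (rule bdd_belowI[of _ 0]) auto
  have Mle: "Inf M \<le> measure lebesgue S" if "S \<in> lmeasurable" "A \<subseteq> S" for S
    using that Mbdd unfolding M_def by (intro cInf_lower) auto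
  have "Inf M \<le> 0"
  proof (rule ccontr)
    assume "\<not> Inf M \<le> 0"
    then have m: "0 < Inf M" by simp
    then have "Inf M < Inf M + k * Inf M / 4" using k by simp
    then obtain S where S: "S \<in> lmeasurable" "A \<subseteq> S" "measure lebesgue S < Inf M + k * Inf M / 4"
      using cInf_lessD[OF Mne] unfolding M_def by blast
    obtain U where U: "open U" "S \<subseteq> U" "U \<in> lmeasurable" "measure lebesgue U < measure lebesgue S + k * Inf M / 4"
    proof (rule sets_lebesgue_outer_open)
      show "S \<in> sets lebesgue" using S(1) by (simp add: fmeasurable_def)
      show "0 < k * Inf M / 4" using m k by simp
      fix T assume T: "open T" "S \<subseteq> T" "T - S \<in> lmeasurable" "emeasure lebesgue (T - S) < ennreal (k * Inf M / 4)"
      have TS: "T = S \<union> (T - S)" using T by blast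
      have Tl: "T \<in> lmeasurable" by (subst TS) (rule fmeasurable.Un[OF S(1) T(3)])
      have "measure lebesgue (T - S) < k * Inf M / 4"
        using T(3,4) k m by (simp add: emeasure_eq_measure2 ennreal_less_iff)
      moreover have "measure lebesgue T \<le> measure lebesgue S + measure lebesgue (T - S)"
        by (subst TS) (rule measure_Un_le, use S(1) T(3) in \<open>simp_all add: fmeasurable_def\<close>)
      ultimately show thesis using that[OF T(1,2) Tl] by simp
    qed
    have mU: "measure lebesgue U < Inf M + k * Inf M / 2" using S U by simp
    define P where "P i G \<longleftrightarrow> G \<in> lmeasurable \<and> G \<subseteq> cball (fst i) (snd i) \<and> G \<inter> A = {} \<and>
        k * (2 * snd i) \<le> measure lebesgue G" for i :: "real \<times> real" and G
    define K where "K = {i :: real \<times> real. 0 < snd i \<and> cball (fst i) (snd i) \<subseteq> U \<and> (\<exists>G. P i G)}"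
    have cover: "\<exists>i. i \<in> K \<and> x \<in> cball (fst i) (snd i) \<and> snd i < d" if x: "x \<in> A" and d: "0 < d" for x d
    proof -
      obtain e where e: "0 < e" "cball x e \<subseteq> U"
        using U(1,2) S(2) x open_contains_cball by (metis subsetD)
      obtain u v G where G: "u \<le> x" "x \<le> v" "u < v" "v - u < min d e"
        "G \<in> lmeasurable" "G \<subseteq> {u..v}" "G \<inter> A = {}" "k * (v - u) \<le> measure lebesgue G"
        using porous[OF x, of "min d e"] d e by auto
      let ?i = "((u + v) / 2, (v - u) / 2)"
      have cb: "cball (fst ?i) (snd ?i) = {u..v}"
        using cball_eq_atLeastAtMost[of "(u + v) / 2" "(v - u) / 2"] by (simp add: field_simps)
      have "{u..v} \<subseteq> cball x e"
      proof
        fix z assume "z \<in> {u..v}"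
        then show "z \<in> cball x e" using G(1-4) by (auto simp: dist_real_def)
      qed
      moreover have "P ?i G" unfolding P_def cb using G(5-8) by (simp add: algebra_simps)
      ultimately have "?i \<in> K" unfolding K_def mem_Collect_eq cb using G(3) e(2) by (auto simp del: cball_eq_atLeastAtMost)
      then show ?thesis using cb G by (intro exI[of _ ?i]) auto
    qed
    obtain C where C: "countable C" "C \<subseteq> K"
      "pairwise (\<lambda>i j. disjnt (cball (fst i) (snd i)) (cball (fst j) (snd j))) C"
      "negligible (A - (\<Union>i\<in>C. cball (fst i) (snd i)))"
      by (rule Vitali_covering_theorem_cballs[of K snd A fst]) (use cover in \<open>auto simp: K_def\<close>)
    define G where "G i = (SOME G. P i G)" for i
    have G: "P i (G i)" if "i \<in> C" for i
      unfolding G_def by (rule someI_ex) (use that C(2) in \<open>auto simp: K_def\<close>)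
    define B where "B = (\<Union>i\<in>C. cball (fst i) (snd i))"
    define H where "H = (\<Union>i\<in>C. G i)"
    have Gs: "G i \<in> sets lebesgue" if "i \<in> C" for i using G[OF that] by (auto simp: P_def)
    have BU: "B \<subseteq> U" using C(2) by (auto simp: B_def K_def)
    have Bs: "B \<in> sets lebesgue" unfolding B_def using C(1) by (intro sets.countable_UN') auto
    have Bl: "B \<in> lmeasurable" by (rule fmeasurableI2[OF U(3) BU Bs])
    have HB: "H \<subseteq> B" using G by (fastforce simp: H_def B_def P_def)
    have Hs: "H \<in> sets lebesgue" unfolding H_def using C(1) Gs by (intro sets.countable_UN') auto
    have Hl: "H \<in> lmeasurable" by (rule fmeasurableI2[OF Bl HB Hs])
    have dB: "disjoint_family_on (\<lambda>i. cball (fst i) (snd i)) C"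
      using C(3) by (simp add: disjoint_family_on_def pairwise_def disjnt_def)
    have dG: "disjoint_family_on G C"
      unfolding disjoint_family_on_def
    proof (intro ballI impI)
      fix i j assume ij: "i \<in> C" "j \<in> C" "i \<noteq> j"
      then have "cball (fst i) (snd i) \<inter> cball (fst j) (snd j) = {}"
        using dB by (simp add: disjoint_family_on_def)
      then show "G i \<inter> G j = {}" using G[OF ij(1)] G[OF ij(2)] unfolding P_def by blast
    qed
    have eB: "emeasure lebesgue (cball (fst i) (snd i)) = ennreal (2 * snd i)" if "i \<in> C" for i
    proof -
      have "0 < snd i" using that C(2) by (auto simp: K_def)
      then show ?thesis using emeasure_lborel_Icc[of "fst i - snd i" "fst i + snd i"]
        by (simp add: cball_eq_atLeastAtMost)
    qed
    have "ennreal k * emeasure lebesgue B =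
        ennreal k * (\<integral>\<^sup>+i. emeasure lebesgue (cball (fst i) (snd i)) \<partial>count_space C)"
      unfolding B_def by (subst emeasure_UN_countable[OF _ C(1) dB]) auto
    also have "\<dots> = (\<integral>\<^sup>+i. ennreal k * emeasure lebesgue (cball (fst i) (snd i)) \<partial>count_space C)"
      by (rule nn_integral_cmult[symmetric]) simp
    also have "\<dots> \<le> (\<integral>\<^sup>+i. emeasure lebesgue (G i) \<partial>count_space C)"
    proof (rule nn_integral_mono)
      fix i assume "i \<in> space (count_space C)"
      then have i: "i \<in> C" by simp
      have "ennreal k * ennreal (2 * snd i) = ennreal (k * (2 * snd i))"
        by (rule ennreal_mult'[symmetric]) (use k in simp)
      also have "\<dots> \<le> ennreal (measure lebesgue (G i))"
        using G[OF i] by (intro ennreal_leI) (simp add: P_def)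
      also have "\<dots> = emeasure lebesgue (G i)"
        using G[OF i] by (intro emeasure_eq_measure2[symmetric]) (simp add: P_def)
      finally show "ennreal k * emeasure lebesgue (cball (fst i) (snd i)) \<le> emeasure lebesgue (G i)"
        by (simp add: eB[OF i])
    qed
    also have "\<dots> = emeasure lebesgue H"
      unfolding H_def by (subst emeasure_UN_countable[OF Gs C(1) dG]) auto
    finally have "ennreal (k * measure lebesgue B) \<le> ennreal (measure lebesgue H)"
      using Bl Hl k by (simp add: emeasure_eq_measure2 ennreal_mult')
    then have kB: "k * measure lebesgue B \<le> measure lebesgue H"
      by (simp add: ennreal_le_iff)
    have "Inf M \<le> measure lebesgue (B \<union> (A - B))"
    proof (rule Mle)
      show "B \<union> (A - B) \<in> lmeasurable"
        using Bl C(4) by (intro fmeasurable.Un) (auto simp: B_def negligible_iff_measure)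
    qed auto
    also have "\<dots> \<le> measure lebesgue B + measure lebesgue (A - B)"
      by (rule measure_Un_le) (use Bs C(4) in \<open>auto simp: B_def negligible_iff_measure fmeasurable_def\<close>)
    also have "measure lebesgue (A - B) = 0" using C(4) by (simp add: B_def negligible_iff_measure)
    finally have "Inf M \<le> measure lebesgue B" by simp
    then have "k * Inf M \<le> measure lebesgue H" using kB k by (meson mult_left_mono less_imp_le order_trans)
    moreover have "Inf M \<le> measure lebesgue (U - H)"
    proof (rule Mle)
      show "A \<subseteq> U - H" using S U G by (fastforce simp: H_def P_def)
    qed (use U Hl in auto)
    moreover have "measure lebesgue (U - H) = measure lebesgue U - measure lebesgue H"
      using U(3) Hl HB BU by (intro measurable_measure_Diff) (auto simp: fmeasurable_def)
    ultimately have "k * Inf M < k * Inf M / 2" using mU by simp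
    then show False using m k by simp
  qed
  show ?thesis
    unfolding negligible_outer
  proof (intro allI impI)
    fix e :: real assume "0 < e"
    then have "Inf M < e" using \<open>Inf M \<le> 0\<close> by simp
    then show "\<exists>T. A \<subseteq> T \<and> T \<in> lmeasurable \<and> measure lebesgue T < e"
      using cInf_lessD[OF Mne] unfolding M_def by blast
  qed
qed

text \<open>
  The inverse of \<open>f\<close> is Lipschitz at each point because the derivative of \<open>f\<close> does not vanish.
\<close>

lemma mono_preimage_negligible:
  fixes f :: "real \<Rightarrow> real"
  assumes mono: "\<And>x y. a < x \<Longrightarrow> x < y \<Longrightarrow> y < b \<Longrightarrow> f x < f y"
    and der: "\<And>x. a < x \<Longrightarrow> x < b \<Longrightarrow> \<exists>d>0. (f has_real_derivative d) (at x)"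
    and S: "negligible S"
  shows "negligible {x. a < x \<and> x < b \<and> f x \<in> S}"
proof -
  have inj: "x = y" if "a < x" "x < b" "a < y" "y < b" "f x = f y" for x y
    using mono[of x y] mono[of y x] that by (cases x y rule: linorder_cases) auto
  define g where "g y = (THE x. a < x \<and> x < b \<and> f x = y)" for y
  have g: "g (f x) = x" if "a < x" "x < b" for x
    unfolding g_def by (rule the_equality) (use that inj in auto)
  have lt: "x < y" if "a < x" "x < b" "a < y" "y < b" "f x < f y" for x y
    using mono[of y x] that by (cases x y rule: linorder_cases) auto
  define T where "T = f ` {x. a < x \<and> x < b \<and> f x \<in> S}"
  have "negligible (g ` T)"
  proof (rule negligible_locally_Lipschitz_image[OF order_refl])
    show "negligible T" by (rule negligible_subset[OF S]) (auto simp: T_def)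
    fix y0 assume "y0 \<in> T"
    then obtain x0 where x0: "a < x0" "x0 < b" "y0 = f x0" by (auto simp: T_def)
    obtain d where d: "d > 0" "(f has_real_derivative d) (at x0)" using der x0 by blast
    have "((\<lambda>x. (f x - f x0) / (x - x0)) \<longlongrightarrow> d) (at x0)"
      using d(2) by (simp add: has_field_derivative_iff)
    then have "\<forall>\<^sub>F x in at x0. d / 2 < (f x - f x0) / (x - x0)"
      by (rule order_tendstoD) (use d in simp)
    then obtain e where e: "e > 0" "\<And>x. x \<noteq> x0 \<Longrightarrow> dist x x0 < e \<Longrightarrow> d / 2 < (f x - f x0) / (x - x0)"
      unfolding eventually_at by blast
    define h where "h = min e (min (x0 - a) (b - x0)) / 2"
    have h: "0 < h" "h < e" "a < x0 - h" "x0 + h < b" using e x0 by (auto simp: h_def min_def field_simps)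
    let ?T = "{f (x0 - h)<..<f (x0 + h)}"
    have "norm (g y - g y0) \<le> (2 / d) * norm (y - y0)" if y: "y \<in> T \<inter> ?T" for y
    proof -
      from y obtain x where x: "a < x" "x < b" "y = f x" by (auto simp: T_def)
      have "x0 - h < x" "x < x0 + h" using lt[of "x0 - h" x] lt[of x "x0 + h"] y x x0 h by auto
      then have dx: "dist x x0 < e" using h by (auto simp: dist_real_def)
      show ?thesis
      proof (cases "x = x0")
        case False
        have "d / 2 < (f x - f x0) / (x - x0)" by (rule e(2)[OF False dx])
        also have "\<dots> \<le> \<bar>f x - f x0\<bar> / \<bar>x - x0\<bar>" by (metis abs_divide abs_ge_self)
        finally have "d / 2 * \<bar>x - x0\<bar> \<le> \<bar>f x - f x0\<bar>" using False by (simp add: field_simps)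
        then show ?thesis using d x x0 by (simp add: g field_simps)
      qed (use x x0 g in simp)
    qed
    moreover have "y0 \<in> ?T" using mono[of "x0 - h" x0] mono[of x0 "x0 + h"] x0 h by simp
    ultimately show "\<exists>U B. open U \<and> y0 \<in> U \<and> (\<forall>y\<in>T \<inter> U. norm (g y - g y0) \<le> B * norm (y - y0))"
      by (intro exI[of _ ?T] exI[of _ "2 / d"]) auto
  qed
  moreover have "{x. a < x \<and> x < b \<and> f x \<in> S} \<subseteq> g ` T" unfolding T_def using g by force
  ultimately show ?thesis by (rule negligible_subset)
qed

context lorenz_dyn
begin

lemma null_preimage:
  assumes "negligible S" shows "negligible {x. 0 < x \<and> x < 1 \<and> fr n x \<and> (f ^^ n) x \<in> S}"
  using assms
proof (induction n arbitrary: S)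
  case 0 then show ?case by (rule negligible_subset) auto
next
  case (Suc n)
  let ?S = "{x. 0 < x \<and> x < 1 \<and> fr n x \<and> (f ^^ n) x \<in> S}"
  have "negligible {x. 0 < x \<and> x < c \<and> f x \<in> ?S}"
    by (rule mono_preimage_negligible[OF _ _ Suc.IH[OF Suc.prems]]) (use monoL deriv c01 in auto)
  moreover have "negligible {x. c < x \<and> x < 1 \<and> f x \<in> ?S}"
    by (rule mono_preimage_negligible[OF _ _ Suc.IH[OF Suc.prems]]) (use monoR deriv c01 in auto)
  ultimately have "negligible ({x. 0 < x \<and> x < c \<and> f x \<in> ?S} \<union> {x. c < x \<and> x < 1 \<and> f x \<in> ?S})"
    by (rule negligible_Un)
  then show ?case
  proof (rule negligible_subset, intro subsetI)
    fix x assume x: "x \<in> {x. 0 < x \<and> x < 1 \<and> fr (Suc n) x \<and> (f ^^ Suc n) x \<in> S}"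
    then have "fr 1 x" "fr n (f x)" using free_add[of 1 n x] by simp_all
    then have "x \<noteq> c" by (simp add: free_def)
    then show "x \<in> {x. 0 < x \<and> x < c \<and> f x \<in> ?S} \<union> {x. c < x \<and> x < 1 \<and> f x \<in> ?S}"
      using x f_inner[of x] \<open>fr n (f x)\<close> by (auto simp: funpow_swap1)
  qed
qed

lemma null_image:
  assumes "negligible S" shows "negligible ((f ^^ n) ` {x\<in>S. 0 < x \<and> x < 1 \<and> fr n x})"
proof (rule negligible_differentiable_image_negligible[OF order_refl])
  show "negligible {x\<in>S. 0 < x \<and> x < 1 \<and> fr n x}" by (rule negligible_subset[OF assms]) auto
  show "(f ^^ n) differentiable_on {x\<in>S. 0 < x \<and> x < 1 \<and> fr n x}"
    unfolding differentiable_on_def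
  proof
    fix x assume "x \<in> {x\<in>S. 0 < x \<and> x < 1 \<and> fr n x}"
    then obtain d where "((f ^^ n) has_real_derivative d) (at x)" using iter_deriv[of x n] by blast
    then show "(f ^^ n) differentiable at x within {x\<in>S. 0 < x \<and> x < 1 \<and> fr n x}"
      using has_field_derivative_at_within field_differentiable_def field_differentiable_imp_differentiable
      by blast
  qed
qed

lemma irregular_null: "negligible {x. 0 < x \<and> x < 1 \<and> \<not> reg x}"
proof -
  have "negligible (\<Union>n. {x. 0 < x \<and> x < 1 \<and> fr n x \<and> (f ^^ n) x \<in> {c}})"
  proof (rule negligible_countable_Union)
    show "negligible T" if "T \<in> range (\<lambda>n. {x. 0 < x \<and> x < 1 \<and> fr n x \<and> (f ^^ n) x \<in> {c}})" for T
      using that null_preimage[OF negligible_sing[of c]] by auto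
  qed simp
  then show ?thesis
  proof (rule negligible_subset, intro subsetI)
    fix x assume "x \<in> {x. 0 < x \<and> x < 1 \<and> \<not> reg x}"
    moreover from this obtain k where "ct k x" using not_reg_cut by blast
    ultimately show "x \<in> (\<Union>n. {x. 0 < x \<and> x < 1 \<and> fr n x \<and> (f ^^ n) x \<in> {c}})"
      by (auto simp: cut_def)
  qed
qed

section \<open>Orbits that avoid a one-sided neighbourhood of the discontinuity\<close>

text \<open>
  The maximal branch of \<open>f ^^ n\<close> around \<open>x\<close>.
\<close>

definition max_at :: "nat \<Rightarrow> real \<Rightarrow> real \<Rightarrow> real \<Rightarrow> bool" where
  "max_at n t x s \<longleftrightarrow> br n t s \<and> t < x \<and> x < s \<and>
     (t = 0 \<or> (0 < t \<and> (\<exists>j<n. ct j t))) \<and> (s = 1 \<or> (s < 1 \<and> (\<exists>j<n. ct j s)))"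

lemma max_at_exists: assumes "reg x" obtains t s where "max_at n t x s"
  using max_branch[of x n] reg_inner[OF assms] reg_free[OF assms] unfolding max_at_def by blast

text \<open>
  Here \<open>l\<close> is the supremum of the preimages of \<open>c\<close> to the left of \<open>x\<close>; the left ends of the branches around \<open>x\<close>
  converge to it. They are positive in the end because no homterval starts at \<open>0\<close>.
\<close>

lemma left_shrink:
  assumes x: "reg x"
  obtains l where "0 < l" "l \<le> x" "\<And>y. l < y \<Longrightarrow> y < x \<Longrightarrow> reg y"
    "\<And>e. 0 < e \<Longrightarrow> \<exists>N. \<forall>n\<ge>N. \<forall>t s. br n t s \<longrightarrow> t < x \<longrightarrow> x < s \<longrightarrow> l - e < t \<and> 0 < t"
proof -
  define Y where "Y = {y. 0 < y \<and> y < x \<and> \<not> reg y}"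
  have "\<not> hom 0 x" by (rule not_hom_0)
  then have ne: "Y \<noteq> {}" using reg_inner[OF x] by (auto simp: homterval_def Y_def)
  have bdd: "bdd_above Y" by (rule bdd_aboveI[of _ x]) (auto simp: Y_def)
  obtain y0 where y0: "y0 \<in> Y" using ne by blast
  show thesis
  proof (rule that[of "Sup Y"])
    show "0 < Sup Y" using cSup_upper[OF y0 bdd] y0 by (auto simp: Y_def)
    show "Sup Y \<le> x" by (rule cSup_least[OF ne]) (auto simp: Y_def)
    show "reg y" if "Sup Y < y" "y < x" for y
    proof (rule ccontr)
      assume "\<not> reg y"
      moreover have "0 < y" using that \<open>0 < Sup Y\<close> by simp
      ultimately have "y \<in> Y" using that by (simp add: Y_def)
      then show False using cSup_upper[OF _ bdd, of y] that by simp
    qed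
    fix e :: real assume "0 < e"
    then obtain y where y: "y \<in> Y" "Sup Y - e < y" using less_cSupD[OF ne, of "Sup Y - e"] by auto
    have "0 < y" "y < x" "\<not> reg y" using y by (auto simp: Y_def)
    then obtain k where k: "ct k y" using not_reg_cut[of y] reg_inner[OF x] by auto
    have "Sup Y - e < t \<and> 0 < t" if n: "n \<ge> Suc k" and b: "br n t s" "t < x" "x < s" for n t s
    proof -
      have "\<not> t < y"
      proof
        assume "t < y"
        then have "fr n y" using branch_free[OF b(1), of y n] b \<open>y < x\<close> by simp
        then show False using k n by (auto simp: cut_def free_def)
      qed
      then show ?thesis using y \<open>0 < y\<close> by simp
    qed
    then show "\<exists>N. \<forall>n\<ge>N. \<forall>t s. br n t s \<longrightarrow> t < x \<longrightarrow> x < s \<longrightarrow> Sup Y - e < t \<and> 0 < t" by blast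
  qed
qed

lemma right_shrink:
  assumes x: "reg x"
  obtains l where "l < 1" "x \<le> l" "\<And>y. x < y \<Longrightarrow> y < l \<Longrightarrow> reg y"
    "\<And>e. 0 < e \<Longrightarrow> \<exists>N. \<forall>n\<ge>N. \<forall>t s. br n t s \<longrightarrow> t < x \<longrightarrow> x < s \<longrightarrow> s < l + e \<and> s < 1"
proof -
  interpret R: lorenz_dyn "reflect f" "1 - c" by (rule reflect_dyn)
  obtain l where l: "0 < l" "l \<le> 1 - x" "\<And>y. l < y \<Longrightarrow> y < 1 - x \<Longrightarrow> R.reg y"
    "\<And>e. 0 < e \<Longrightarrow> \<exists>N. \<forall>n\<ge>N. \<forall>t s. R.br n t s \<longrightarrow> t < 1 - x \<longrightarrow> 1 - x < s \<longrightarrow> l - e < t \<and> 0 < t"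
    using R.left_shrink[of "1 - x"] x by (auto simp: regular_reflect)
  show thesis
  proof (rule that[of "1 - l"])
    show "1 - l < 1" "x \<le> 1 - l" using l by auto
    show "reg y" if "x < y" "y < 1 - l" for y using l(3)[of "1 - y"] that by (simp add: regular_reflect)
    fix e :: real assume "0 < e"
    then obtain N where N: "\<forall>n\<ge>N. \<forall>t s. R.br n t s \<longrightarrow> t < 1 - x \<longrightarrow> 1 - x < s \<longrightarrow> l - e < t \<and> 0 < t"
      using l(4) by blast
    have "s < 1 - l + e \<and> s < 1" if "n \<ge> N" "br n t s" "t < x" "x < s" for n t s
      using N[rule_format, of n "1 - s" "1 - t"] that by (simp add: branch_reflect)
    then show "\<exists>N. \<forall>n\<ge>N. \<forall>t s. br n t s \<longrightarrow> t < x \<longrightarrow> x < s \<longrightarrow> s < 1 - l + e \<and> s < 1" by blast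
  qed
qed

text \<open>
  If the images of the two outer intervals have definite length, the outer intervals are comparable to or longer than the
  middle one.
\<close>

lemma cross_gap:
  assumes b: "br n t s" "t < p1" "p1 < p2" "p2 < p3" "p3 < p4" "p4 < s"
    and l: "0 < l1" "0 < l2" "l1 \<le> (f ^^ n) p2 - (f ^^ n) p1" "l2 \<le> (f ^^ n) p4 - (f ^^ n) p3"
  shows "l1 * l2 * (p3 - p2) \<le> p2 - p1" "l1 * l2 * (p3 - p2) \<le> p4 - p3"
proof -
  let ?a = "(f ^^ n) p1" and ?b = "(f ^^ n) p2" and ?d = "(f ^^ n) p3" and ?e = "(f ^^ n) p4"
  have m: "?a < ?b" "?b < ?d" "?d < ?e"
    using b by (auto intro!: branch_mono[OF b(1) order_refl])
  have r: "0 < ?a" "?e < 1" using branch_inner[OF b(1), of p1 n] branch_inner[OF b(1), of p4 n] b by auto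
  have "cross_ratio p1 p2 p3 p4 \<le> cross_ratio ?a ?b ?d ?e" by (rule branch_cross[OF b])
  also have "\<dots> \<le> 1 / (l1 * l2)"
    unfolding cross_ratio_def
  proof (rule frac_le)
    show "(?e - ?a) * (?d - ?b) \<le> 1" using m r by (intro mult_le_one) auto
    show "l1 * l2 \<le> (?b - ?a) * (?e - ?d)" using l by (intro mult_mono) auto
  qed (use l m in auto)
  finally have "(p4 - p1) * (p3 - p2) / ((p2 - p1) * (p4 - p3)) \<le> 1 / (l1 * l2)"
    by (simp add: cross_ratio_def)
  moreover have "0 < (p2 - p1) * (p4 - p3)" using b by simp
  ultimately have "(p4 - p1) * (p3 - p2) * (l1 * l2) \<le> (p2 - p1) * (p4 - p3)"
    using l by (simp add: pos_divide_le_eq pos_le_divide_eq)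
  moreover have "(p2 - p1) * (p4 - p3) \<le> (p2 - p1) * (p4 - p1)" "(p2 - p1) * (p4 - p3) \<le> (p4 - p3) * (p4 - p1)"
    using b by (auto intro!: mult_mono simp: mult.commute)
  ultimately have "(p4 - p1) * (l1 * l2 * (p3 - p2)) \<le> (p4 - p1) * (p2 - p1)"
     "(p4 - p1) * (l1 * l2 * (p3 - p2)) \<le> (p4 - p1) * (p4 - p3)"
    by (auto simp: algebra_simps)
  then show "l1 * l2 * (p3 - p2) \<le> p2 - p1" "l1 * l2 * (p3 - p2) \<le> p4 - p3"
    using b by (auto simp: mult_le_cancel_left)
qed

text \<open>
  The pullback \<open>(p1, p2)\<close> of a piece of \<open>(c, q)\<close> at the left end of the branch is disjoint from \<open>A\<close>. By
  \<open>cross_gap\<close> it is a definite proportion of \<open>(p1, p3)\<close>, which contains \<open>x\<close>. Such intervals exist at all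
  scales: \<open>p2\<close> lies to the left of a preimage of \<open>c\<close>, so \<open>(p1, p2)\<close> is caught between the end of
  the branch and the point \<open>l\<close> to which the ends converge.
\<close>

lemma avoid_right_porous:
  assumes q: "ct m q" "c < q" "q < 1" "br m c q" and k: "0 < k"
    and A: "\<And>x n. x \<in> A \<Longrightarrow> reg x \<and> \<not> (c < (f ^^ n) x \<and> (f ^^ n) x < q)"
    and space: "\<And>x N. x \<in> A \<Longrightarrow> \<exists>n\<ge>N. \<forall>t s. max_at n t x s \<longrightarrow>
        (\<exists>p3 p4. x < p3 \<and> p3 < p4 \<and> p4 < s \<and> k \<le> (f ^^ n) p4 - (f ^^ n) p3)"
  shows "negligible A"
proof -
  obtain lam where lam: "0 < lam"
    "\<And>n t s x j. br n t s \<Longrightarrow> 0 < t \<Longrightarrow> j < n \<Longrightarrow> ct j t \<Longrightarrow> t < x \<Longrightarrow> x < s \<Longrightarrow> q < (f ^^ j) x \<Longrightarrow>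
       \<exists>p1 p2 y. t < p1 \<and> p1 < p2 \<and> p2 < y \<and> y < x \<and> lam \<le> (f ^^ n) p2 - (f ^^ n) p1 \<and>
         (\<forall>z. p1 < z \<and> z < p2 \<longrightarrow> c < (f ^^ j) z \<and> (f ^^ j) z < q) \<and> ct (j + m) y"
    proof (rule gap_left[OF q], goal_cases)
    case (1 lam) show ?case by (rule that) (fact 1)+
  qed
  \<comment> \<open>the proportion \<open>h\<close> turns \<open>lam * k * (p3 - p2) \<le> p2 - p1\<close> into \<open>h * (p3 - p1) \<le> p2 - p1\<close>\<close>
  define h where "h = lam * k / (1 + lam * k)"
  have lk: "0 < lam * k" using lam k by simp
  have h: "0 < h" "h \<le> 1" using lk by (auto simp: h_def)
  show ?thesis
  proof (rule porous_negligible[OF h(1)])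
    show "A \<subseteq> {0..1}" using A reg_inner by force
    fix x e assume x: "x \<in> A" and e: "0 < (e::real)"
    have rx: "reg x" using A x by blast
    obtain l where l: "0 < l" "l \<le> x" "\<And>y. l < y \<Longrightarrow> y < x \<Longrightarrow> reg y"
      "\<And>e. 0 < e \<Longrightarrow> \<exists>N. \<forall>n\<ge>N. \<forall>t s. br n t s \<longrightarrow> t < x \<longrightarrow> x < s \<longrightarrow> l - e < t \<and> 0 < t"
      proof (rule left_shrink[OF rx], goal_cases)
    case (1 l) show ?case by (rule that) (fact 1)+
  qed
    obtain N where N: "\<forall>n\<ge>N. \<forall>t s. br n t s \<longrightarrow> t < x \<longrightarrow> x < s \<longrightarrow> l - h * e < t \<and> 0 < t"
      using l(4)[of "h * e"] h e by auto
    obtain n where n: "n \<ge> N" "\<And>t s. max_at n t x s \<Longrightarrow>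
        (\<exists>p3 p4. x < p3 \<and> p3 < p4 \<and> p4 < s \<and> k \<le> (f ^^ n) p4 - (f ^^ n) p3)"
      using space[OF x, of N] by blast
    obtain t s where ts: "max_at n t x s" using max_at_exists[OF rx] .
    then have b: "br n t s" "t < x" "x < s" by (auto simp: max_at_def)
    have t: "l - h * e < t" "0 < t" using N n(1) b by blast+
    obtain j where j: "j < n" "ct j t" using ts t by (auto simp: max_at_def)
    have "c < (f ^^ j) x" by (rule left_cut_above[OF b(1) t(2) j(2)]) (use j b in auto)
    moreover have "(f ^^ j) x \<noteq> q" using reg_iter[OF rx, of j] cut_not_reg[OF q(1)] by auto
    ultimately have "q < (f ^^ j) x" using A[OF x, of j] by force
    then obtain p1 p2 y where p: "t < p1" "p1 < p2" "p2 < y" "y < x" "lam \<le> (f ^^ n) p2 - (f ^^ n) p1"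
         "\<forall>z. p1 < z \<and> z < p2 \<longrightarrow> c < (f ^^ j) z \<and> (f ^^ j) z < q" "ct (j + m) y"
      using lam(2)[OF b(1) t(2) j b(2,3)] by blast
    obtain p3 p4 where p': "x < p3" "p3 < p4" "p4 < s" "k \<le> (f ^^ n) p4 - (f ^^ n) p3"
      using n(2)[OF ts] by blast
    have "y \<le> l" using l(3)[of y] p cut_not_reg by force
    then have small: "p2 - p1 < h * e" using p t by simp
    have "lam * k * (p3 - p2) \<le> p2 - p1"
      by (rule cross_gap[OF b(1) p(1,2) _ p'(2,3) lam(1) k p(5) p'(4)]) (use p p' in simp)
    then have "lam * k * (p3 - p1) \<le> (1 + lam * k) * (p2 - p1)" by (simp add: algebra_simps)
    then have gap: "h * (p3 - p1) \<le> p2 - p1" using lk by (simp add: h_def field_simps)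
    then have "h * (p3 - p1) < h * e" using small by simp
    then have "p3 - p1 < e" using h by simp
    moreover have "{p1<..<p2} \<inter> A = {}" using A p(6) by force
    ultimately show "\<exists>u v G. u \<le> x \<and> x \<le> v \<and> u < v \<and> v - u < e \<and> G \<in> lmeasurable \<and> G \<subseteq> {u..v} \<and>
        G \<inter> A = {} \<and> h * (v - u) \<le> measure lebesgue G"
      using p p' gap by (intro exI[of _ p1] exI[of _ p3] exI[of _ "{p1<..<p2}"]) auto
  qed
qed

text \<open>
  Room on the right is provided by the pullback of \<open>(r, c)\<close>, in the same way as on the left.
\<close>

lemma avoid_two_sided_null:
  assumes q: "ct m q" "c < q" "q < 1" "br m c q" and r: "ct k r" "0 < r" "r < c" "br k r c"
  shows "negligible {x. reg x \<and> (\<forall>n. \<not> (r < (f ^^ n) x \<and> (f ^^ n) x < q))}" (is "negligible ?A")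
proof -
  obtain lam where lam: "0 < lam"
    "\<And>n t s x j. br n t s \<Longrightarrow> s < 1 \<Longrightarrow> j < n \<Longrightarrow> ct j s \<Longrightarrow> t < x \<Longrightarrow> x < s \<Longrightarrow> (f ^^ j) x < r \<Longrightarrow>
       \<exists>p1 p2 y. x < y \<and> y < p1 \<and> p1 < p2 \<and> p2 < s \<and> lam \<le> (f ^^ n) p2 - (f ^^ n) p1 \<and>
         (\<forall>z. p1 < z \<and> z < p2 \<longrightarrow> r < (f ^^ j) z \<and> (f ^^ j) z < c) \<and> ct (j + k) y"
    proof (rule gap_right[OF r], goal_cases)
    case (1 lam) show ?case by (rule that) (fact 1)+
  qed
  show ?thesis
  proof (rule avoid_right_porous[OF q lam(1)])
    show "reg x \<and> \<not> (c < (f ^^ n) x \<and> (f ^^ n) x < q)" if "x \<in> ?A" for x n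
      using that r by force
    fix x N assume x: "x \<in> ?A"
    then have rx: "reg x" by simp
    obtain l where "l < 1" "x \<le> l" "\<And>y. x < y \<Longrightarrow> y < l \<Longrightarrow> reg y"
      and l: "\<And>e. 0 < e \<Longrightarrow> \<exists>N. \<forall>n\<ge>N. \<forall>t s. br n t s \<longrightarrow> t < x \<longrightarrow> x < s \<longrightarrow> s < l + e \<and> s < 1"
      proof (rule right_shrink[OF rx], goal_cases)
    case (1 l) show ?case by (rule that) (fact 1)+
  qed
    obtain N' where N': "\<And>n t s. n \<ge> N' \<Longrightarrow> br n t s \<Longrightarrow> t < x \<Longrightarrow> x < s \<Longrightarrow> s < 1"
      using l[OF zero_less_one] by blast
    have "\<exists>p3 p4. x < p3 \<and> p3 < p4 \<and> p4 < s \<and> lam \<le> (f ^^ max N N') p4 - (f ^^ max N N') p3"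
      if ts: "max_at (max N N') t x s" for t s
    proof -
      have b: "br (max N N') t s" "t < x" "x < s" using ts by (auto simp: max_at_def)
      have s: "s < 1" by (rule N'[OF _ b]) simp
      then obtain j where j: "j < max N N'" "ct j s" using ts by (auto simp: max_at_def)
      have "(f ^^ j) x < (f ^^ j) s"
      proof (rule iter_mono)
        fix z assume z: "x \<le> z" "z \<le> s"
        show "fr j z"
          using branch_free[OF b(1), of z j] z b j by (cases "z = s") (auto simp: cut_def)
      qed (use b s reg_inner[OF rx] in auto)
      then have "(f ^^ j) x < c" using j by (simp add: cut_def)
      moreover have "(f ^^ j) x \<noteq> r" using reg_iter[OF rx, of j] cut_not_reg[OF r(1)] by auto
      moreover have "\<not> (r < (f ^^ j) x \<and> (f ^^ j) x < q)" using x by blast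
      ultimately have "(f ^^ j) x < r" using q by linarith
      then obtain p1 p2 y where "x < y" "y < p1" "p1 < p2" "p2 < s"
          "lam \<le> (f ^^ max N N') p2 - (f ^^ max N N') p1"
        using lam(2)[OF b(1) s j b(2,3)] by blast
      then show ?thesis by (intro exI[of _ p1] exI[of _ p2]) auto
    qed
    then show "\<exists>n\<ge>N. \<forall>t s. max_at n t x s \<longrightarrow>
        (\<exists>p3 p4. x < p3 \<and> p3 < p4 \<and> p4 < s \<and> lam \<le> (f ^^ n) p4 - (f ^^ n) p3)"
      by (intro exI[of _ "max N N'"]) simp
  qed
qed

text \<open>
  Room on the right is found at the times \<open>n\<close> of closest approach to \<open>c\<close> from the left. If the branch
  ends on the right because of \<open>c\<close> at time \<open>i\<close>, then \<open>f ^^ (n - i)\<close> is monotone on \<open>(f ^^ i) x < w < c\<close>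
  and sends the left end to \<open>(f ^^ n) x\<close>, which is closer to \<open>c\<close>. The image must pass \<open>c\<close>, or it
  would be trapped; it must reach \<open>q\<close>, or the points of the orbit close to \<open>c\<close> would be sent into \<open>(c, q)\<close>.
\<close>

lemma avoid_right_accumulate_left_null:
  assumes q: "ct m q" "c < q" "q < 1" "br m c q"
  shows "negligible {x. reg x \<and> (\<forall>n. \<not> (c < (f ^^ n) x \<and> (f ^^ n) x < q)) \<and>
      (\<forall>e>0. \<exists>n. c - e < (f ^^ n) x \<and> (f ^^ n) x < c)}" (is "negligible ?A")
proof -
  define q1 where "q1 = (2 * c + q) / 3"
  define q2 where "q2 = (c + 2 * q) / 3"
  have qq: "c < q1" "q1 < q2" "q2 < q" using q by (auto simp: q1_def q2_def field_simps)
  show ?thesis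
  proof (rule avoid_right_porous[OF q, of "q2 - q1"])
    show "0 < q2 - q1" using qq by simp
    show "reg x \<and> \<not> (c < (f ^^ n) x \<and> (f ^^ n) x < q)" if "x \<in> ?A" for x n using that by blast
    fix x N assume x: "x \<in> ?A"
    then have rx: "reg x" and av: "\<And>n. \<not> (c < (f ^^ n) x \<and> (f ^^ n) x < q)"
      and ac: "\<And>e. e > 0 \<Longrightarrow> \<exists>n. c - e < (f ^^ n) x \<and> (f ^^ n) x < c" by auto
    have nc: "(f ^^ i) x \<noteq> c" for i using rx by (simp add: regular_def)
    \<comment> \<open>\<open>n\<close> is the first time after \<open>N\<close> at which the orbit sets a record of closeness to \<open>c\<close> from the left\<close>
    define d where "d = Min ((\<lambda>i. \<bar>c - (f ^^ i) x\<bar>) ` {..N})"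
    have d: "0 < d" unfolding d_def using nc by (subst Min_gr_iff) auto
    have dle: "d \<le> \<bar>c - (f ^^ i) x\<bar>" if "i \<le> N" for i unfolding d_def using that by (intro Min_le) auto
    define n where "n = (LEAST n. c - d < (f ^^ n) x \<and> (f ^^ n) x < c)"
    have n: "c - d < (f ^^ n) x" "(f ^^ n) x < c" using LeastI_ex[OF ac[OF d]] by (auto simp: n_def)
    have nN: "N < n" using dle[of n] n by (cases "n \<le> N") auto
    have rec: "(f ^^ i) x < (f ^^ n) x" if i: "i < n" "(f ^^ i) x < c" for i
    proof -
      have "\<not> (c - d < (f ^^ i) x \<and> (f ^^ i) x < c)" using i(1) not_less_Least unfolding n_def by blast
      then show ?thesis using i n by simp
    qed
    have "\<exists>p3 p4. x < p3 \<and> p3 < p4 \<and> p4 < s \<and> q2 - q1 \<le> (f ^^ n) p4 - (f ^^ n) p3"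
      if ts: "max_at n t x s" for t s
    proof -
      have b: "br n t s" "t < x" "x < s" using ts by (auto simp: max_at_def)
      have "\<exists>y. x < y \<and> y < s \<and> q2 \<le> (f ^^ n) y"
      proof (cases "s = 1")
        case True
        have "fr n z" if "x \<le> z" "z \<le> 1" for z
          using that b True branch_free[OF b(1), of z n] free_1[of n] by (cases "z = 1") auto
        then obtain z where z: "x \<le> z" "z \<le> 1" "(f ^^ n) z = q2"
          using iter_ivt[of x 1 n q2] reg_inner[OF rx] n qq q by (auto simp: iter_1)
        have "z \<noteq> x" "z \<noteq> 1" using z n qq q by (auto simp: iter_1)
        then show ?thesis using z True by (intro exI[of _ z]) auto
      next
        case False
        then obtain i where i: "i < n" "ct i s" "s < 1" using ts by (auto simp: max_at_def)
        have fri: "fr i z" if "x \<le> z" "z \<le> s" for z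
          using branch_free[OF b(1), of z i] that b i by (cases "z = s") (auto simp: cut_def)
        have xi: "(f ^^ i) x < c"
          using iter_mono[of x s i] fri b i reg_inner[OF rx] by (simp add: cut_def)
        have pre: "\<exists>z. x < z \<and> z < s \<and> (f ^^ i) z = w" if w: "(f ^^ i) x < w" "w < c" for w
        proof -
          obtain z where z: "x \<le> z" "z \<le> s" "(f ^^ i) z = w"
            using iter_ivt[of x s i w] fri b i reg_inner[OF rx] w by (auto simp: cut_def)
          then have "z \<noteq> x" "z \<noteq> s" using w i by (auto simp: cut_def)
          then show ?thesis using z by (intro exI[of _ z]) auto
        qed
        have push: "(f ^^ n) z = (f ^^ (n - i)) ((f ^^ i) z)" for z
          using i(1) by (simp add: funpow_plus)
        have bi: "br (n - i) ((f ^^ i) x) c"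
          unfolding branch_def
        proof (intro conjI allI impI)
          show "0 \<le> (f ^^ i) x" using reg_inner(1)[OF reg_iter[OF rx]] by (simp add: less_imp_le)
          fix w assume "(f ^^ i) x < w \<and> w < c"
          then obtain z where z: "x < z" "z < s" "(f ^^ i) z = w" using pre by blast
          have "fr (i + (n - i)) z" using branch_free[OF b(1), of z n] z b i by simp
          then show "fr (n - i) w" using z unfolding free_add by simp
        qed (use xi c01 in auto)
        show ?thesis
        proof (rule ccontr)
          assume "\<not> ?thesis"
          then have small: "(f ^^ n) z < q2" if "x < z" "z < s" for z using that by force
          have low: "(f ^^ n) x < (f ^^ (n - i)) w" if "(f ^^ i) x < w" "w < c" for w
          proof -
            obtain z where z: "x < z" "z < s" "(f ^^ i) z = w" using pre \<open>_ < w\<close> \<open>w < c\<close> by blast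
            have "(f ^^ n) x < (f ^^ n) z" by (rule branch_mono[OF b(1) order_refl]) (use z b in auto)
            then show ?thesis using push[of z] z by simp
          qed
          show False
          proof (cases "\<exists>w. (f ^^ i) x < w \<and> w < c \<and> (f ^^ (n - i)) w \<ge> c")
            case True
            then obtain w where w: "(f ^^ i) x < w" "w < c" "(f ^^ (n - i)) w \<ge> c" by blast
            obtain k where k: "w < (f ^^ k) x" "(f ^^ k) x < c" using ac[of "c - w"] w by auto
            have "c < (f ^^ (n - i)) ((f ^^ k) x)"
              using branch_mono[OF bi order_refl, of w "(f ^^ k) x"] w k by simp
            moreover obtain z where "x < z" "z < s" "(f ^^ i) z = (f ^^ k) x"
              using pre[of "(f ^^ k) x"] w k by auto
            then have "(f ^^ (n - i)) ((f ^^ k) x) < q" using small[of z] push[of z] qq by simp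
            ultimately show False using av[of "k + (n - i)"] by (simp add: funpow_plus)
          next
            case False
            have "\<forall>w. (f ^^ i) x < w \<and> w < c \<longrightarrow> (f ^^ i) x < (f ^^ (n - i)) w \<and> (f ^^ (n - i)) w < c"
              using False low rec[OF i(1) xi] by (meson not_less order.strict_trans)
            then show False using no_trap[OF bi] i(1) by simp
          qed
        qed
      qed
      then obtain y where y: "x < y" "y < s" "q2 \<le> (f ^^ n) y" by blast
      obtain p4 where p4: "x \<le> p4" "p4 \<le> y" "(f ^^ n) p4 = q2"
        using branch_ivt[OF b(1), of x y n q2] b y n qq by auto
      obtain p3 where p3: "x \<le> p3" "p3 \<le> p4" "(f ^^ n) p3 = q1"
        using branch_ivt[OF b(1), of x p4 n q1] b y p4 n qq by auto
      have "p3 \<noteq> x" "p3 \<noteq> p4" using p3 p4 n qq by auto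
      then show ?thesis using p3 p4 y by (intro exI[of _ p3] exI[of _ p4]) auto
    qed
    then show "\<exists>n\<ge>N. \<forall>t s. max_at n t x s \<longrightarrow>
        (\<exists>p3 p4. x < p3 \<and> p3 < p4 \<and> p4 < s \<and> q2 - q1 \<le> (f ^^ n) p4 - (f ^^ n) p3)"
      using nN by (intro exI[of _ n]) auto
  qed
qed

end

section \<open>The two sides of the discontinuity\<close>

text \<open>
  The interval from \<open>c\<close> to \<open>rcut f c\<close> is the maximal homterval to the right of \<open>c\<close>; it is empty if preimages
  of \<open>c\<close> accumulate there.
\<close>

definition rcut :: "(real \<Rightarrow> real) \<Rightarrow> real \<Rightarrow> real" where
  "rcut f c = Inf {y. c < y \<and> y < 1 \<and> \<not> regular f c y}"

text \<open>
  Defined by reflection, so that statements about \<open>rcut\<close> transfer.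
\<close>

definition lcut :: "(real \<Rightarrow> real) \<Rightarrow> real \<Rightarrow> real" where
  "lcut f c = 1 - rcut (reflect f) (1 - c)"

lemma reflect_reflect: "reflect (reflect f) = f"
  by (simp add: reflect_def fun_eq_iff)

lemma rcut_reflect: "rcut (reflect f) (1 - c) = 1 - lcut f c"
  by (simp add: lcut_def)

lemma lcut_reflect: "lcut (reflect f) (1 - c) = 1 - rcut f c"
  by (simp add: lcut_def reflect_reflect)

context lorenz_dyn
begin

abbreviation "Q \<equiv> rcut f c"
abbreviation "L \<equiv> lcut f c"

lemma rcut_bounds: "c \<le> Q" "Q < 1"
  and rcut_reg: "\<And>y. c < y \<Longrightarrow> y < Q \<Longrightarrow> reg y"
  and rcut_lim: "\<And>w. Q < w \<Longrightarrow> \<exists>y. Q \<le> y \<and> c < y \<and> y < w \<and> y < 1 \<and> \<not> reg y"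
proof -
  define Y where "Y = {y. c < y \<and> y < 1 \<and> \<not> reg y}"
  have Q: "Q = Inf Y" by (simp add: rcut_def Y_def)
  have "\<not> hom c 1" by (rule not_hom_1)
  then have ne: "Y \<noteq> {}" using c01 by (auto simp: homterval_def Y_def)
  have bdd: "bdd_below Y" by (rule bdd_belowI[of _ c]) (auto simp: Y_def)
  show "c \<le> Q" unfolding Q by (rule cInf_greatest[OF ne]) (auto simp: Y_def)
  obtain y0 where "y0 \<in> Y" using ne by blast
  then show Q1: "Q < 1" unfolding Q using cInf_lower[OF _ bdd, of y0] by (auto simp: Y_def)
  show "reg y" if "c < y" "y < Q" for y
  proof (rule ccontr)
    assume "\<not> reg y"
    then have "y \<in> Y" using that Q1 by (simp add: Y_def)
    then show False using cInf_lower[OF _ bdd, of y] that Q by simp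
  qed
  show "\<exists>y. Q \<le> y \<and> c < y \<and> y < w \<and> y < 1 \<and> \<not> reg y" if w: "Q < w" for w
  proof -
    obtain y where "y \<in> Y" "y < w" using cInf_lessD[OF ne, of w] w Q by auto
    then show ?thesis using cInf_lower[OF _ bdd, of y] Q by (auto simp: Y_def)
  qed
qed

lemma lcut_bounds: "L \<le> c" "0 < L"
  and lcut_reg: "\<And>y. L < y \<Longrightarrow> y < c \<Longrightarrow> reg y"
  and lcut_lim: "\<And>w. w < L \<Longrightarrow> \<exists>y. y \<le> L \<and> w < y \<and> y < c \<and> 0 < y \<and> \<not> reg y"
proof -
  interpret R: lorenz_dyn "reflect f" "1 - c" by (rule reflect_dyn)
  show "L \<le> c" "0 < L" using R.rcut_bounds by (auto simp: rcut_reflect)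
  show "reg y" if "L < y" "y < c" for y
    using R.rcut_reg[of "1 - y"] that by (simp add: rcut_reflect regular_reflect)
  show "\<exists>y. y \<le> L \<and> w < y \<and> y < c \<and> 0 < y \<and> \<not> reg y" if "w < L" for w
  proof -
    have "1 - L < 1 - w" using that by simp
    then obtain y where "1 - L \<le> y \<and> 1 - c < y \<and> y < 1 - w \<and> y < 1 \<and> \<not> R.reg y"
      using R.rcut_lim[of "1 - w"] unfolding rcut_reflect by blast
    then show ?thesis by (intro exI[of _ "1 - y"]) (auto simp: regular_reflect)
  qed
qed

lemma hom_right: "c < Q \<Longrightarrow> hom c Q"
  using rcut_bounds rcut_reg c01 by (auto simp: homterval_def)

lemma hom_left: "L < c \<Longrightarrow> hom L c"
  using lcut_bounds lcut_reg c01 by (auto simp: homterval_def)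

text \<open>
  A homterval does not return to itself.
\<close>

lemma right_once: assumes "c < x" "x < Q" "0 < n" shows "\<not> (c < (f ^^ n) x \<and> (f ^^ n) x < Q)"
  using hom_wandering[OF hom_right, of "(f ^^ n) x" x 0 n] assms by auto

lemma left_once: assumes "L < x" "x < c" "0 < n" shows "\<not> (L < (f ^^ n) x \<and> (f ^^ n) x < c)"
  using hom_wandering[OF hom_left, of "(f ^^ n) x" x 0 n] assms by auto

lemma first_cut_left:
  assumes "w < c" "0 \<le> w" "ct k y" "y < c" "w < y"
  obtains q m where "ct m q" "q < c" "w < q" "br m q c"
proof -
  interpret R: lorenz_dyn "reflect f" "1 - c" by (rule reflect_dyn)
  obtain q m where "R.ct m q" "1 - c < q" "q < 1 - w" "R.br m (1 - c) q"
    by (rule R.first_cut_right[of "1 - w" k "1 - y"]) (use assms in \<open>auto simp: cut_reflect\<close>)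
  then show thesis using that[of m "1 - q"] by (simp add: cut_reflect branch_reflect)
qed

lemma free_nbhd:
  assumes "0 < x" "x < 1" "fr n x"
  obtains t s where "br n t s" "t < x" "x < s"
  using max_branch[OF assms] by blast

lemma irregular_iter: assumes "fr n y" "\<not> reg y" "0 < y" "y < 1" shows "\<not> reg ((f ^^ n) y)"
proof
  assume r: "reg ((f ^^ n) y)"
  obtain k where k: "ct k y" using not_reg_cut assms by blast
  have "n \<le> k" using k assms(1) by (auto simp: cut_def free_def not_less[symmetric])
  then have "(f ^^ (k - n)) ((f ^^ n) y) = c" using k by (simp add: funpow_plus cut_def)
  then show False using r by (auto simp: regular_def)
qed

text \<open>The orbit of a regular \<open>Q\<close> stays out of the homtervals next to \<open>c\<close>, because \<open>Q\<close> is a limit of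
  irregular points.\<close>

lemma rcut_orbit:
  assumes "reg Q" shows "\<not> (L < (f ^^ i) Q \<and> (f ^^ i) Q < Q \<and> (f ^^ i) Q \<noteq> c)"
proof
  assume *: "L < (f ^^ i) Q \<and> (f ^^ i) Q < Q \<and> (f ^^ i) Q \<noteq> c"
  define u where "u = (if (f ^^ i) Q < c then c else Q)"
  have u: "(f ^^ i) Q < u" "\<And>y. (f ^^ i) Q \<le> y \<Longrightarrow> y < u \<Longrightarrow> reg y"
    using * rcut_reg lcut_reg by (auto simp: u_def split: if_splits)
  obtain t s where ts: "br i t s" "t < Q" "Q < s"
    using free_nbhd[of Q i] reg_inner[OF assms] reg_free[OF assms] by blast
  have "isCont (f ^^ i) Q" by (rule isCont_iter) (use reg_inner[OF assms] reg_free[OF assms] in auto)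
  then have "\<forall>\<^sub>F y in at Q. (f ^^ i) y < u"
    using u(1) order_tendstoD(2) isCont_def by blast
  then obtain d where d: "0 < d" "\<And>y. y \<noteq> Q \<Longrightarrow> dist y Q < d \<Longrightarrow> (f ^^ i) y < u"
    unfolding eventually_at by blast
  obtain y where y: "Q \<le> y" "c < y" "y < min s (Q + d)" "y < 1" "\<not> reg y"
    using rcut_lim[of "min s (Q + d)"] ts d by auto
  have yQ: "Q < y" using y assms by (cases "y = Q") auto
  have "(f ^^ i) Q < (f ^^ i) y" by (rule branch_mono[OF ts(1) order_refl ts(2) yQ]) (use y in simp)
  moreover have "(f ^^ i) y < u" using d(2)[of y] yQ y by (simp add: dist_real_def)
  ultimately have "reg ((f ^^ i) y)" using u(2) by simp
  moreover have "fr i y" using branch_free[OF ts(1), of y i] ts yQ y by simp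
  ultimately show False using irregular_iter[of i y] y c01 by auto
qed

text \<open>
  A version of \<open>cross_gap\<close> in which the room is measured against the image of the middle interval.
\<close>

lemma cross_gap_rel:
  assumes b: "br n t s" "t < p1" "p1 < p2" "p2 < p3" "p3 < p4" "p4 < s"
    and l: "(f ^^ n) p3 - (f ^^ n) p2 \<le> (f ^^ n) p2 - (f ^^ n) p1"
      "(f ^^ n) p3 - (f ^^ n) p2 \<le> (f ^^ n) p4 - (f ^^ n) p3"
  shows "p3 - p2 \<le> 3 * (p4 - p3)"
proof -
  let ?a = "(f ^^ n) p1" and ?b = "(f ^^ n) p2" and ?d = "(f ^^ n) p3" and ?e = "(f ^^ n) p4"
  have m: "?a < ?b" "?b < ?d" "?d < ?e"
    using b by (auto intro!: branch_mono[OF b(1) order_refl])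
  define A where "A = ?b - ?a" define J where "J = ?d - ?b" define B where "B = ?e - ?d"
  have AB: "0 < A" "0 < J" "0 < B" "J \<le> A" "J \<le> B" using m l by (auto simp: A_def J_def B_def)
  have "A * J \<le> A * B" "J * J \<le> A * B" "B * J \<le> A * B"
    using AB by (auto intro!: mult_mono simp: mult.commute)
  then have "(A + J + B) * J \<le> 3 * (A * B)" by (simp add: algebra_simps)
  then have "(A + J + B) * J / (A * B) \<le> 3" using AB by (simp add: divide_le_eq)
  moreover have "cross_ratio ?a ?b ?d ?e = (A + J + B) * J / (A * B)"
    by (simp add: cross_ratio_def A_def J_def B_def)
  moreover have "cross_ratio p1 p2 p3 p4 \<le> cross_ratio ?a ?b ?d ?e" by (rule branch_cross[OF b])
  ultimately have "(p4 - p1) * (p3 - p2) / ((p2 - p1) * (p4 - p3)) \<le> 3" by (simp add: cross_ratio_def)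
  moreover have "0 < (p2 - p1) * (p4 - p3)" using b by simp
  ultimately have "(p4 - p1) * (p3 - p2) \<le> 3 * ((p2 - p1) * (p4 - p3))"
    by (simp add: pos_divide_le_eq)
  also have "\<dots> \<le> 3 * ((p4 - p1) * (p4 - p3))" using b by (auto intro!: mult_mono)
  finally have "(p4 - p1) * (p3 - p2) \<le> (p4 - p1) * (3 * (p4 - p3))" by (simp add: algebra_simps)
  then show ?thesis using b by (auto simp: mult_le_cancel_left)
qed

text \<open>
  The interval \<open>[f z, f Q]\<close> and its images are considered at a time at which the image is shorter than all
  earlier ones. A branch around it that is cut on the left at time \<open>j\<close> contains there a pullback of
  \<open>[z, Q]\<close>, whose image is one of the earlier images: this is the room on the left. With the same amount of room on the
  right, the branch would extend beyond \<open>f Q\<close> by a third of the interval; but preimages of \<open>c\<close>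
  accumulate at \<open>f Q\<close> from the right.
\<close>

lemma record_right:
  assumes Q: "c < Q" "reg Q" and z: "c < z" "z < Q"
  obtains N where "\<And>m. m \<ge> N \<Longrightarrow>
      (\<And>k. 1 \<le> k \<Longrightarrow> k \<le> m \<Longrightarrow> (f ^^ Suc m) Q - (f ^^ Suc m) z \<le> (f ^^ k) Q - (f ^^ k) z) \<Longrightarrow>
      (\<And>t s. max_at m t (f Q) s \<Longrightarrow> s < 1 \<Longrightarrow> \<exists>p4. f Q < p4 \<and> p4 < s \<and>
         (f ^^ Suc m) Q - (f ^^ Suc m) z \<le> (f ^^ m) p4 - (f ^^ m) (f Q)) \<Longrightarrow> False"
proof -
  have cQ: "0 < Q" "Q < 1" "0 < z" "z < 1" using Q z c01 rcut_bounds by auto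
  have regzQ: "reg y" if "z \<le> y" "y \<le> Q" for y
    using rcut_reg[of y] that z Q by (cases "y = Q") auto
  have fr1: "fr (Suc 0) y" if "c < y" for y using that by (simp add: free_def)
  have fzQ: "f z < f Q" using monoR[of z Q] z cQ by simp
  have rfQ: "reg (f Q)" "reg (f z)" using reg_iter[of _ 1] regzQ[of Q] regzQ[of z] z by auto
  have reg_between: "reg y" if y: "f z \<le> y" "y \<le> f Q" for y
  proof -
    obtain y' where "z \<le> y'" "y' \<le> Q" "(f ^^ 1) y' = y"
      by (rule iter_ivt[of z Q 1 y]) (use y z cQ fr1 in auto)
    then show ?thesis using reg_iter[OF regzQ, of y' 1] by simp
  qed
  \<comment> \<open>a third of the interval, the amount by which \<open>cross_gap_rel\<close> would extend the branch\<close>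
  define e where "e = (f Q - f z) / 3"
  have e: "0 < e" using fzQ by (simp add: e_def)
  have "isCont f Q" using isCont_iter[of Q 1] cQ reg_free[OF Q(2), of 1] by simp
  then have "\<forall>\<^sub>F y in at Q. f y < f Q + e"
    using e order_tendstoD(2)[of f "f Q" "at Q" "f Q + e"] by (simp add: isCont_def)
  then obtain d where d: "0 < d" "\<And>y. y \<noteq> Q \<Longrightarrow> dist y Q < d \<Longrightarrow> f y < f Q + e"
    unfolding eventually_at by blast
  obtain y where y: "Q \<le> y" "c < y" "y < Q + d" "y < 1" "\<not> reg y"
    using rcut_lim[of "Q + d"] d by auto
  have yQ: "Q < y" using y Q by (cases "y = Q") auto
  have fy: "f Q < f y" "f y < f Q + e" using monoR[of Q y] d(2)[of y] yQ y Q by (auto simp: dist_real_def)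
  have nfy: "\<not> reg (f y)" using irregular_iter[of 1 y] y c01 fr1[of y] by simp
  have fy1: "0 < f y" "f y < 1" using f_inner[of y] y c01 by auto
  obtain k0 where k0: "ct k0 (f y)" using not_reg_cut[OF fy1 nfy] .
  obtain l where "0 < l" "l \<le> f Q" "\<And>y. l < y \<Longrightarrow> y < f Q \<Longrightarrow> reg y"
    and l: "\<And>e. 0 < e \<Longrightarrow> \<exists>N. \<forall>n\<ge>N. \<forall>t s. br n t s \<longrightarrow> t < f Q \<longrightarrow> f Q < s \<longrightarrow> l - e < t \<and> 0 < t"
    proof (rule left_shrink[OF rfQ(1)], goal_cases)
    case (1 l) show ?case by (rule that) (fact 1)+
  qed
  obtain N1 where N1: "\<And>n t s. n \<ge> N1 \<Longrightarrow> br n t s \<Longrightarrow> t < f Q \<Longrightarrow> f Q < s \<Longrightarrow> 0 < t"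
    using l[OF zero_less_one] by blast
  show thesis
  proof (rule that[of "max N1 (Suc k0)"])
    fix m assume m: "m \<ge> max N1 (Suc k0)"
      and rec: "\<And>k. 1 \<le> k \<Longrightarrow> k \<le> m \<Longrightarrow> (f ^^ Suc m) Q - (f ^^ Suc m) z \<le> (f ^^ k) Q - (f ^^ k) z"
      and room: "\<And>t s. max_at m t (f Q) s \<Longrightarrow> s < 1 \<Longrightarrow> \<exists>p4. f Q < p4 \<and> p4 < s \<and>
         (f ^^ Suc m) Q - (f ^^ Suc m) z \<le> (f ^^ m) p4 - (f ^^ m) (f Q)"
    obtain t s where ts: "max_at m t (f Q) s" using max_at_exists[OF rfQ(1)] .
    then have b: "br m t s" "t < f Q" "f Q < s" by (auto simp: max_at_def)
    have t0: "0 < t" by (rule N1[OF _ b]) (use m in simp)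
    then obtain j where j: "j < m" "ct j t" using ts by (auto simp: max_at_def)
    have tz: "t < f z" using reg_between[of t] cut_not_reg[OF j(2)] b by force
    have sy: "s \<le> f y"
    proof (rule ccontr)
      assume "\<not> s \<le> f y"
      then have "fr m (f y)" using branch_free[OF b(1), of "f y" m] b fy by simp
      then show False using k0 m by (auto simp: cut_def free_def)
    qed
    obtain p4 where p4: "f Q < p4" "p4 < s"
       "(f ^^ Suc m) Q - (f ^^ Suc m) z \<le> (f ^^ m) p4 - (f ^^ m) (f Q)"
      using room[OF ts] sy fy1 by auto
    have zs: "f z < s" using fzQ b by simp
    have "c < (f ^^ j) (f z)" by (rule left_cut_above[OF b(1) t0 j(2) _ tz zs]) (use j in simp)
    moreover have "\<not> (c < (f ^^ Suc j) z \<and> (f ^^ Suc j) z < Q)" by (rule right_once[OF z]) simp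
    ultimately have Qj: "Q \<le> (f ^^ j) (f z)" by (simp add: funpow_swap1)
    obtain p' where p': "t < p'" "p' \<le> f z" "(f ^^ j) p' = Q"
      using left_cut_ivt[OF b(1) t0 j(2) less_imp_le[OF j(1)] tz zs Q(1) Qj] .
    have p's: "p' < s" using p' zs by simp
    have zj: "z \<le> (f ^^ j) p'" using p' z by simp
    obtain p1 where p1: "t < p1" "p1 \<le> p'" "(f ^^ j) p1 = z"
      using left_cut_ivt[OF b(1) t0 j(2) less_imp_le[OF j(1)] p'(1) p's z(1) zj] .
    have p1': "p1 < p'" using p1 p' z by (cases "p1 = p'") auto
    have "(f ^^ Suc m) Q - (f ^^ Suc m) z \<le> (f ^^ (m - j)) Q - (f ^^ (m - j)) z"
      by (rule rec) (use j in auto)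
    also have "\<dots> = (f ^^ m) p' - (f ^^ m) p1"
      using funpow_plus[of "m - j" j p'] funpow_plus[of "m - j" j p1] j p' p1 by simp
    also have "(f ^^ m) p' \<le> (f ^^ m) (f z)"
      using branch_mono[OF b(1) order_refl p'(1), of "f z"] p' zs by (cases "p' = f z") auto
    finally have "(f ^^ m) (f Q) - (f ^^ m) (f z) \<le> (f ^^ m) (f z) - (f ^^ m) p1"
      by (simp add: funpow_swap1)
    moreover have "(f ^^ m) (f Q) - (f ^^ m) (f z) \<le> (f ^^ m) p4 - (f ^^ m) (f Q)"
      using p4 by (simp add: funpow_swap1)
    ultimately have far: "f Q - f z \<le> 3 * (p4 - f Q)"
      using cross_gap_rel[OF b(1) p1(1) _ fzQ p4(1,2)] p1' p' by simp
    have "p4 < f Q + e" using p4(2) sy fy(2) by (meson less_le_trans less_trans)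
    then have "3 * (p4 - f Q) < 3 * e" by simp
    also have "3 * e = f Q - f z" by (simp add: e_def)
    finally show False using far by (meson not_less)
  qed
qed

lemma iter_Q_z_pos: assumes "c < z" "z < Q" "reg Q" shows "(f ^^ n) z < (f ^^ n) Q"
proof (rule iter_mono)
  fix y assume "z \<le> y" "y \<le> Q"
  then have "reg y" using rcut_reg[of y] assms by (cases "y = Q") auto
  then show "fr n y" by (rule reg_free)
qed (use assms c01 rcut_bounds in auto)

lemma iter_Q_z_tendsto: assumes "c < z" "z < Q" "reg Q" shows "(\<lambda>n. (f ^^ n) Q - (f ^^ n) z) \<longlonglongrightarrow> 0"
proof (rule lengths_tendsto_0)
  fix y assume "z \<le> y" "y \<le> Q"
  then show "reg y" using rcut_reg[of y] assms by (cases "y = Q") auto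
qed (use assms in auto)

lemma right_cut_below:
  assumes "br m t s" "s < 1" "ct i s" "i \<le> m" "t < y" "y < s"
  shows "(f ^^ i) y < c"
proof -
  interpret R: lorenz_dyn "reflect f" "1 - c" by (rule reflect_dyn)
  show ?thesis
    using R.left_cut_above[of m "1 - s" "1 - t" i "1 - y"] assms
    by (simp add: branch_reflect cut_reflect funpow_reflect)
qed

lemma right_cut_ivt:
  assumes "br m t s" "s < 1" "ct i s" "i \<le> m" "t < y" "y < s" "w < c" "(f ^^ i) y \<le> w"
  obtains z where "y \<le> z" "z < s" "(f ^^ i) z = w"
proof -
  interpret R: lorenz_dyn "reflect f" "1 - c" by (rule reflect_dyn)
  obtain z where "1 - s < z" "z \<le> 1 - y" "(reflect f ^^ i) z = 1 - w"
    by (rule R.left_cut_ivt[of m "1 - s" "1 - t" i "1 - y" "1 - w"])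
      (use assms in \<open>simp_all add: branch_reflect cut_reflect funpow_reflect\<close>)
  then show thesis using that[of "1 - z"] by (simp add: funpow_reflect)
qed

end

text \<open>
  A positive sequence that tends to zero is infinitely often smaller than ever before.
\<close>

lemma records:
  fixes g :: "nat \<Rightarrow> real"
  assumes pos: "\<And>n. 0 < g n" and lim: "g \<longlonglongrightarrow> 0"
  obtains m where "m \<ge> N" "\<And>k. 1 \<le> k \<Longrightarrow> k \<le> m \<Longrightarrow> g (Suc m) < g k"
proof -
  define d where "d = Min (g ` {..Suc N})"
  have d: "0 < d" unfolding d_def using pos by (subst Min_gr_iff) auto
  have dle: "d \<le> g i" if "i \<le> Suc N" for i unfolding d_def using that by (intro Min_le) auto
  have "\<forall>\<^sub>F n in sequentially. g n < d" using order_tendstoD(2)[OF lim d] .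
  then obtain n0 where n0: "g n0 < d" by (auto simp: eventually_sequentially)
  define n where "n = (LEAST n. g n < d)"
  have n: "g n < d" unfolding n_def by (rule LeastI[of _ n0]) (rule n0)
  have nN: "Suc N < n" using dle[of n] n by (cases "n \<le> Suc N") auto
  have ge: "d \<le> g k" if "k < n" for k using not_less_Least[of k "\<lambda>n. g n < d"] that unfolding n_def by force
  show thesis
  proof (rule that[of "n - 1"])
    show "g (Suc (n - 1)) < g k" if "1 \<le> k" "k \<le> n - 1" for k
    proof -
      have "k < n" using that nN by linarith
      then have "d \<le> g k" by (rule ge)
      moreover have "Suc (n - 1) = n" using nN by simp
      ultimately show ?thesis using n by simp
    qed
  qed (use nN in simp)
qed

context lorenz_dyn
begin

text \<open>
  If the orbit of \<open>Q\<close> avoided \<open>(r, c)\<close>, the pullback of that interval would provide room on the right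
  at every record time.
\<close>

lemma rcut_accumulates:
  assumes Q: "c < Q" "reg Q" and r: "ct k r" "0 < r" "r < c" "br k r c"
  shows "\<exists>i. r < (f ^^ i) Q \<and> (f ^^ i) Q < c"
proof (rule ccontr)
  assume no: "\<not> ?thesis"
  define z where "z = (c + Q) / 2"
  have z: "c < z" "z < Q" using Q by (auto simp: z_def)
  obtain N where N: "\<And>m. m \<ge> N \<Longrightarrow>
      (\<And>k. 1 \<le> k \<Longrightarrow> k \<le> m \<Longrightarrow> (f ^^ Suc m) Q - (f ^^ Suc m) z \<le> (f ^^ k) Q - (f ^^ k) z) \<Longrightarrow>
      (\<And>t s. max_at m t (f Q) s \<Longrightarrow> s < 1 \<Longrightarrow> \<exists>p4. f Q < p4 \<and> p4 < s \<and>
         (f ^^ Suc m) Q - (f ^^ Suc m) z \<le> (f ^^ m) p4 - (f ^^ m) (f Q)) \<Longrightarrow> False"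
    proof (rule record_right[OF Q z], goal_cases)
    case (1 N) show ?case by (rule that) (fact 1)+
  qed
  obtain lam where lam: "0 < lam"
    "\<And>n t s x j. br n t s \<Longrightarrow> s < 1 \<Longrightarrow> j < n \<Longrightarrow> ct j s \<Longrightarrow> t < x \<Longrightarrow> x < s \<Longrightarrow> (f ^^ j) x < r \<Longrightarrow>
       \<exists>p1 p2 y. x < y \<and> y < p1 \<and> p1 < p2 \<and> p2 < s \<and> lam \<le> (f ^^ n) p2 - (f ^^ n) p1 \<and>
         (\<forall>z. p1 < z \<and> z < p2 \<longrightarrow> r < (f ^^ j) z \<and> (f ^^ j) z < c) \<and> ct (j + k) y"
    proof (rule gap_right[OF r], goal_cases)
    case (1 lam) show ?case by (rule that) (fact 1)+
  qed
  note lim = iter_Q_z_tendsto[OF z Q(2)]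
  obtain N2 where N2: "\<And>n. n \<ge> N2 \<Longrightarrow> (f ^^ n) Q - (f ^^ n) z < lam"
    using order_tendstoD(2)[OF lim lam(1)] by (auto simp: eventually_sequentially)
  obtain m where m: "m \<ge> max N N2"
     "\<And>k. 1 \<le> k \<Longrightarrow> k \<le> m \<Longrightarrow> (f ^^ Suc m) Q - (f ^^ Suc m) z < (f ^^ k) Q - (f ^^ k) z"
    using records[OF _ lim, of "max N N2"] iter_Q_z_pos[OF z Q(2)] by auto
  show False
  proof (rule N[of m])
    show "N \<le> m" using m by simp
    show "(f ^^ Suc m) Q - (f ^^ Suc m) z \<le> (f ^^ k) Q - (f ^^ k) z" if "1 \<le> k" "k \<le> m" for k
      using m(2)[OF that] by simp
    fix t s assume ts: "max_at m t (f Q) s" "s < 1"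
    then have b: "br m t s" "t < f Q" "f Q < s" by (auto simp: max_at_def)
    obtain j where j: "j < m" "ct j s" using ts by (auto simp: max_at_def)
    have "(f ^^ j) (f Q) < c" by (rule right_cut_below[OF b(1) ts(2) j(2) _ b(2,3)]) (use j in simp)
    moreover have "(f ^^ Suc j) Q \<noteq> r" using reg_iter[OF Q(2), of "Suc j"] cut_not_reg[OF r(1)] by auto
    moreover have "\<not> (r < (f ^^ Suc j) Q \<and> (f ^^ Suc j) Q < c)" using no by blast
    ultimately have "(f ^^ j) (f Q) < r" by (simp add: funpow_swap1)
    then obtain p1 p2 y where p: "f Q < y" "y < p1" "p1 < p2" "p2 < s" "lam \<le> (f ^^ m) p2 - (f ^^ m) p1"
      using lam(2)[OF b(1) ts(2) j b(2,3)] by blast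
    have "(f ^^ m) (f Q) < (f ^^ m) p1" by (rule branch_mono[OF b(1) order_refl b(2)]) (use p in auto)
    moreover have "(f ^^ Suc m) Q - (f ^^ Suc m) z < lam" by (rule N2) (use m in simp)
    ultimately show "\<exists>p4. f Q < p4 \<and> p4 < s \<and>
         (f ^^ Suc m) Q - (f ^^ Suc m) z \<le> (f ^^ m) p4 - (f ^^ m) (f Q)"
      using p by (intro exI[of _ p2]) auto
  qed
qed

text \<open>
  If there are homtervals on both sides of \<open>c\<close>, the room on the right is an earlier image of the left one.
\<close>

lemma record_two_sided:
  assumes Q: "c < Q" "reg Q" and L: "L < c" "reg L" and z: "c < z" "z < Q" and y: "L < y" "y < c"
  obtains N where "\<And>m. m \<ge> N \<Longrightarrow>
      (\<And>k. 1 \<le> k \<Longrightarrow> k \<le> m \<Longrightarrow> (f ^^ Suc m) Q - (f ^^ Suc m) z \<le> (f ^^ k) Q - (f ^^ k) z) \<Longrightarrow>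
      (\<And>k. 1 \<le> k \<Longrightarrow> k \<le> m \<Longrightarrow> (f ^^ Suc m) Q - (f ^^ Suc m) z \<le> (f ^^ k) y - (f ^^ k) L) \<Longrightarrow> False"
proof -
  obtain N where N: "\<And>m. m \<ge> N \<Longrightarrow>
      (\<And>k. 1 \<le> k \<Longrightarrow> k \<le> m \<Longrightarrow> (f ^^ Suc m) Q - (f ^^ Suc m) z \<le> (f ^^ k) Q - (f ^^ k) z) \<Longrightarrow>
      (\<And>t s. max_at m t (f Q) s \<Longrightarrow> s < 1 \<Longrightarrow> \<exists>p4. f Q < p4 \<and> p4 < s \<and>
         (f ^^ Suc m) Q - (f ^^ Suc m) z \<le> (f ^^ m) p4 - (f ^^ m) (f Q)) \<Longrightarrow> False"
    proof (rule record_right[OF Q z], goal_cases)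
    case (1 N) show ?case by (rule that) (fact 1)+
  qed
  show thesis
  proof (rule that[of N])
    fix m assume m: "m \<ge> N"
      and r1: "\<And>k. 1 \<le> k \<Longrightarrow> k \<le> m \<Longrightarrow> (f ^^ Suc m) Q - (f ^^ Suc m) z \<le> (f ^^ k) Q - (f ^^ k) z"
      and r2: "\<And>k. 1 \<le> k \<Longrightarrow> k \<le> m \<Longrightarrow> (f ^^ Suc m) Q - (f ^^ Suc m) z \<le> (f ^^ k) y - (f ^^ k) L"
    show False
    proof (rule N[OF m r1])
      fix t s assume ts: "max_at m t (f Q) s" "s < 1"
      then have b: "br m t s" "t < f Q" "f Q < s" by (auto simp: max_at_def)
      obtain i where i: "i < m" "ct i s" using ts by (auto simp: max_at_def)
      have "(f ^^ i) (f Q) < c" by (rule right_cut_below[OF b(1) ts(2) i(2) _ b(2,3)]) (use i in simp)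
      then have iL: "(f ^^ i) (f Q) \<le> L" using rcut_orbit[OF Q(2), of "Suc i"] Q(1) by (simp add: funpow_swap1)
      obtain p' where p': "f Q \<le> p'" "p' < s" "(f ^^ i) p' = L"
        using right_cut_ivt[OF b(1) ts(2) i(2) less_imp_le[OF i(1)] b(2,3) L(1) iL] .
      have tp: "t < p'" using p' b by simp
      have yp: "(f ^^ i) p' \<le> y" using p' y by simp
      obtain p4 where p4: "p' \<le> p4" "p4 < s" "(f ^^ i) p4 = y"
        using right_cut_ivt[OF b(1) ts(2) i(2) less_imp_le[OF i(1)] tp p'(2) y(2) yp] .
      have "p' < p4" using p4 p' y by (cases "p' = p4") auto
      have "(f ^^ Suc m) Q - (f ^^ Suc m) z \<le> (f ^^ (m - i)) y - (f ^^ (m - i)) L"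
        by (rule r2) (use i in auto)
      also have "\<dots> = (f ^^ m) p4 - (f ^^ m) p'"
        using funpow_plus[of "m - i" i p4] funpow_plus[of "m - i" i p'] i p' p4 by simp
      also have "\<dots> \<le> (f ^^ m) p4 - (f ^^ m) (f Q)"
        using branch_mono[OF b(1) order_refl b(2), of p'] p' by (cases "p' = f Q") auto
      finally show "\<exists>p4. f Q < p4 \<and> p4 < s \<and>
         (f ^^ Suc m) Q - (f ^^ Suc m) z \<le> (f ^^ m) p4 - (f ^^ m) (f Q)"
        using p4 p' \<open>p' < p4\<close> by (intro exI[of _ p4]) auto
    qed
  qed
qed

text \<open>
  At the record times of the minimum of both lengths one of the two homtervals is the shorter one, and has
  room on both sides.
\<close>

lemma not_both_regular:
  assumes Q: "c < Q" "reg Q" and L: "L < c" "reg L" shows False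
proof -
  interpret R: lorenz_dyn "reflect f" "1 - c" by (rule reflect_dyn)
  define z where "z = (c + Q) / 2"
  have z: "c < z" "z < Q" using Q by (auto simp: z_def)
  define y where "y = (L + c) / 2"
  have y: "L < y" "y < c" using L by (auto simp: y_def)
  obtain N1 where N1: "\<And>m. m \<ge> N1 \<Longrightarrow>
      (\<And>k. 1 \<le> k \<Longrightarrow> k \<le> m \<Longrightarrow> (f ^^ Suc m) Q - (f ^^ Suc m) z \<le> (f ^^ k) Q - (f ^^ k) z) \<Longrightarrow>
      (\<And>k. 1 \<le> k \<Longrightarrow> k \<le> m \<Longrightarrow> (f ^^ Suc m) Q - (f ^^ Suc m) z \<le> (f ^^ k) y - (f ^^ k) L) \<Longrightarrow> False"
    proof (rule record_two_sided[OF Q L z y], goal_cases)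
    case (1 N) show ?case by (rule that) (fact 1)+
  qed
  obtain N2 where N2: "\<And>m. m \<ge> N2 \<Longrightarrow>
      (\<And>k. 1 \<le> k \<Longrightarrow> k \<le> m \<Longrightarrow> (f ^^ Suc m) y - (f ^^ Suc m) L \<le> (f ^^ k) y - (f ^^ k) L) \<Longrightarrow>
      (\<And>k. 1 \<le> k \<Longrightarrow> k \<le> m \<Longrightarrow> (f ^^ Suc m) y - (f ^^ Suc m) L \<le> (f ^^ k) Q - (f ^^ k) z) \<Longrightarrow> False"
  proof (rule R.record_two_sided[of "1 - y" "1 - z"])
    fix N assume N: "\<And>m. m \<ge> N \<Longrightarrow>
      (\<And>k. 1 \<le> k \<Longrightarrow> k \<le> m \<Longrightarrow> (reflect f ^^ Suc m) R.Q - (reflect f ^^ Suc m) (1 - y)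
          \<le> (reflect f ^^ k) R.Q - (reflect f ^^ k) (1 - y)) \<Longrightarrow>
      (\<And>k. 1 \<le> k \<Longrightarrow> k \<le> m \<Longrightarrow> (reflect f ^^ Suc m) R.Q - (reflect f ^^ Suc m) (1 - y)
          \<le> (reflect f ^^ k) (1 - z) - (reflect f ^^ k) R.L) \<Longrightarrow> False"
    show thesis
      by (rule that[of N], rule N) (simp_all add: funpow_reflect rcut_reflect lcut_reflect del: funpow.simps)
  qed (use Q L z y in \<open>simp_all add: rcut_reflect lcut_reflect regular_reflect\<close>)
  have ypos: "(f ^^ n) L < (f ^^ n) y" for n
    using R.iter_Q_z_pos[of "1 - y" n] y L by (simp add: rcut_reflect regular_reflect funpow_reflect)
  have ylim: "(\<lambda>n. (f ^^ n) y - (f ^^ n) L) \<longlonglongrightarrow> 0"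
    using R.iter_Q_z_tendsto[of "1 - y"] y L by (simp add: rcut_reflect regular_reflect funpow_reflect)
  define g where "g n = min ((f ^^ n) Q - (f ^^ n) z) ((f ^^ n) y - (f ^^ n) L)" for n
  have "g \<longlonglongrightarrow> min 0 0" unfolding g_def by (intro tendsto_min iter_Q_z_tendsto z Q ylim)
  then have glim: "g \<longlonglongrightarrow> 0" by simp
  have gpos: "0 < g n" for n using iter_Q_z_pos[OF z Q(2)] ypos by (simp add: g_def)
  obtain m where m: "m \<ge> max N1 N2" "\<And>k. 1 \<le> k \<Longrightarrow> k \<le> m \<Longrightarrow> g (Suc m) < g k"
    using records[OF gpos glim] by blast
  have gle: "g k \<le> (f ^^ k) Q - (f ^^ k) z" "g k \<le> (f ^^ k) y - (f ^^ k) L" for k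
    by (auto simp: g_def)
  consider "g (Suc m) = (f ^^ Suc m) Q - (f ^^ Suc m) z" | "g (Suc m) = (f ^^ Suc m) y - (f ^^ Suc m) L"
    unfolding g_def by linarith
  then show False
  proof cases
    case 1
    show False
    proof (rule N1[of m])
      show "N1 \<le> m" using m(1) by simp
      fix k assume k: "1 \<le> k" "k \<le> m"
      show "(f ^^ Suc m) Q - (f ^^ Suc m) z \<le> (f ^^ k) Q - (f ^^ k) z" using m(2)[OF k] gle(1)[of k] 1 by linarith
      show "(f ^^ Suc m) Q - (f ^^ Suc m) z \<le> (f ^^ k) y - (f ^^ k) L" using m(2)[OF k] gle(2)[of k] 1 by linarith
    qed
  next
    case 2
    show False
    proof (rule N2[of m])
      show "N2 \<le> m" using m(1) by simp
      fix k assume k: "1 \<le> k" "k \<le> m"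
      show "(f ^^ Suc m) y - (f ^^ Suc m) L \<le> (f ^^ k) y - (f ^^ k) L" using m(2)[OF k] gle(2)[of k] 2 by linarith
      show "(f ^^ Suc m) y - (f ^^ Suc m) L \<le> (f ^^ k) Q - (f ^^ k) z" using m(2)[OF k] gle(1)[of k] 2 by linarith
    qed
  qed
qed

text \<open>
  The image of \<open>(L, c)\<close> is a homterval that starts at \<open>c\<close>.
\<close>

lemma lcut_irregular:
  assumes L: "L < c" "ct l L" and u: "L < u" "u < c" shows "c < (f ^^ l) u \<and> (f ^^ l) u < Q"
proof -
  have b: "br l L c" by (rule hom_branch[OF hom_left[OF L(1)]])
  have L0: "0 < L" by (rule lcut_bounds)
  have above: "c < (f ^^ l) v" if "L < v" "v < c" for v
    by (rule left_cut_above[OF b L0 L(2) order_refl that])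
  have "(f ^^ l) u < Q"
  proof (rule ccontr)
    assume "\<not> ?thesis"
    define v where "v = (u + c) / 2"
    have v: "u < v" "v < c" using u by (auto simp: v_def)
    have "(f ^^ l) u < (f ^^ l) v" by (rule branch_mono[OF b order_refl u(1) v])
    then obtain y where y: "c < y" "y < (f ^^ l) v" "\<not> reg y"
      using rcut_lim[of "(f ^^ l) v"] \<open>\<not> _\<close> by auto
    have Lv: "L < v" using u v by simp
    obtain w where w: "L < w" "w \<le> v" "(f ^^ l) w = y"
      using left_cut_ivt[OF b L0 L(2) order_refl Lv v(2) y(1)] y(2) by (metis less_imp_le)
    then have "reg w" using lcut_reg v by simp
    then show False using reg_iter[of w l] w y by simp
  qed
  then show ?thesis using above[OF u] by simp
qed

lemma rcut_irregular:
  assumes Q: "c < Q" "ct l Q" and u: "c < u" "u < Q" shows "L < (f ^^ l) u \<and> (f ^^ l) u < c"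
proof -
  interpret R: lorenz_dyn "reflect f" "1 - c" by (rule reflect_dyn)
  show ?thesis
    using R.lcut_irregular[of l "1 - u"] Q u
    by (simp add: rcut_reflect lcut_reflect cut_reflect funpow_reflect)
qed

text \<open>
  If neither \<open>Q\<close> nor \<open>L\<close> is a preimage of \<open>c\<close>, use records for both. If just one of them is, it has bounded order and gives
  room by itself. If both are, the homtervals map into each other, so one of them returns to itself.
\<close>

lemma not_two_homtervals: "\<not> (c < Q \<and> L < c)"
proof
  assume *: "c < Q \<and> L < c"
  have bd: "0 < Q" "Q < 1" "0 < L" "L < 1" using c01 rcut_bounds lcut_bounds by auto
  interpret R: lorenz_dyn "reflect f" "1 - c" by (rule reflect_dyn)
  consider "reg Q" "reg L" | "reg Q" "\<not> reg L" | "\<not> reg Q" "reg L" | "\<not> reg Q" "\<not> reg L" by blast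
  then show False
  proof cases
    case 1 then show False using not_both_regular * by blast
  next
    case 2
    obtain k where k: "ct k L" using not_reg_cut bd 2 by blast
    have "br k L c" by (rule hom_branch[OF hom_left]) (use * in simp)
    then obtain i where "L < (f ^^ i) Q" "(f ^^ i) Q < c" using rcut_accumulates[of k L] * 2 k bd by blast
    then show False using rcut_orbit[OF 2(1), of i] * by auto
  next
    case 3
    obtain k where k: "ct k Q" using not_reg_cut bd 3 by blast
    have "br k c Q" by (rule hom_branch[OF hom_right]) (use * in simp)
    then obtain i where "1 - Q < (reflect f ^^ i) R.Q" "(reflect f ^^ i) R.Q < 1 - c"
      using R.rcut_accumulates[of k "1 - Q"] * 3 k bd
      by (auto simp: rcut_reflect cut_reflect branch_reflect regular_reflect)
    then show False using R.rcut_orbit[of i] * 3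
      by (auto simp: rcut_reflect lcut_reflect regular_reflect)
  next
    case 4
    obtain k where k: "ct k Q" using not_reg_cut bd 4 by blast
    obtain l where l: "ct l L" using not_reg_cut bd 4 by blast
    define u where "u = (c + Q) / 2"
    have u: "c < u" "u < Q" using * by (auto simp: u_def)
    have "L < (f ^^ k) u \<and> (f ^^ k) u < c" using rcut_irregular[of k u] * k u by simp
    then have "c < (f ^^ (k + l)) u \<and> (f ^^ (k + l)) u < Q"
      using lcut_irregular[of l "(f ^^ k) u"] * l by (simp add: funpow_plus)
    moreover have "0 < k" using k * by (cases k) (auto simp: cut_def)
    ultimately show False using right_once[OF u, of "k + l"] by simp
  qed
qed

lemma rcut_regular: assumes "c < Q" shows "reg Q"
proof (rule ccontr)
  assume "\<not> reg Q"
  then obtain k where k: "ct k Q" using not_reg_cut[of Q] assms c01 rcut_bounds by auto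
  have "L < c" using rcut_irregular[OF assms k, of "(c + Q) / 2"] assms by force
  then show False using not_two_homtervals assms by blast
qed

lemma rcut_orbit_near: assumes "c < Q" "0 < e" shows "\<exists>i. c - e < (f ^^ i) Q \<and> (f ^^ i) Q < c"
proof -
  have "L = c" using not_two_homtervals assms lcut_bounds by force
  then obtain y where y: "max 0 (c - e) < y" "y < c" "\<not> reg y"
    using lcut_lim[of "max 0 (c - e)"] assms c01 by auto
  obtain k where k: "ct k y" using not_reg_cut[of y] y c01 by auto
  obtain r m where r: "ct m r" "r < c" "max 0 (c - e) < r" "br m r c"
    by (rule first_cut_left[of "max 0 (c - e)" k y]) (use y k in auto)
  then obtain i where "r < (f ^^ i) Q \<and> (f ^^ i) Q < c"
    using rcut_accumulates[OF assms(1) rcut_regular[OF assms(1)], of m r] by auto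
  then show ?thesis using r by (intro exI[of _ i]) auto
qed

lemma lcut_regular: assumes "L < c" shows "reg L"
proof -
  interpret R: lorenz_dyn "reflect f" "1 - c" by (rule reflect_dyn)
  show ?thesis using R.rcut_regular assms by (simp add: rcut_reflect regular_reflect)
qed

lemma lcut_orbit_near: assumes "L < c" "0 < e" shows "\<exists>i. c < (f ^^ i) L \<and> (f ^^ i) L < c + e"
proof -
  interpret R: lorenz_dyn "reflect f" "1 - c" by (rule reflect_dyn)
  obtain i where "1 - c - e < (reflect f ^^ i) (1 - L) \<and> (reflect f ^^ i) (1 - L) < 1 - c"
    using R.rcut_orbit_near[of e] assms by (auto simp: rcut_reflect)
  then show ?thesis by (intro exI[of _ i]) (auto simp: funpow_reflect)
qed

end

section \<open>Almost every and generic orbits accumulate at the discontinuity\<close>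

context lorenz_dyn
begin

text \<open>
  Let \<open>x\<close> avoid \<open>(c, q)\<close>. If its orbit accumulates at \<open>c\<close> from the left, or eventually avoids a two-sided
  neighbourhood \<open>(r, q)\<close> with \<open>r\<close> a preimage of \<open>c\<close>, it belongs to one of the null sets above. Otherwise there is a
  homterval \<open>(L, c)\<close> and the orbit accumulates at \<open>L\<close>. It then follows the orbit of \<open>L\<close>, which comes close to
  \<open>c\<close> from the right.
\<close>

lemma visits_right_ae:
  assumes w: "Q < w" "w \<le> 1"
  shows "negligible {x. reg x \<and> (\<forall>n. \<not> (c < (f ^^ n) x \<and> (f ^^ n) x < w))}" (is "negligible ?F")
proof -
  obtain y where y: "c < y" "y < w" "y < 1" "\<not> reg y" using rcut_lim[OF w(1)] by blast
  obtain k where k: "ct k y" using not_reg_cut[of y] y c01 by auto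
  have cw: "c < w" using y by simp
  obtain q m where q: "ct m q" "c < q" "q < w" "br m c q"
    using first_cut_right[OF cw w(2) k y(1,2)] by blast
  have q1: "q < 1" using q w by simp
  have "\<exists>r k. ct k r \<and> 0 < r \<and> r < c \<and> br k r c \<and> L - 1 / real (Suc j) < r" for j
  proof -
    let ?w = "max 0 (L - 1 / real (Suc j))"
    have wL: "?w < L" using lcut_bounds by simp
    obtain y where y: "?w < y" "y < c" "0 < y" "\<not> reg y" using lcut_lim[OF wL] by blast
    obtain k where k: "ct k y" using not_reg_cut[of y] y c01 by auto
    have wc: "?w < c" "0 \<le> ?w" using y by auto
    obtain r l where "ct l r" "r < c" "?w < r" "br l r c"
      using first_cut_left[OF wc k y(2,1)] .
    then show ?thesis by (intro exI[of _ r] exI[of _ l]) auto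
  qed
  then obtain r l where r: "\<And>j. ct (l j) (r j)" "\<And>j. 0 < r j" "\<And>j. r j < c" "\<And>j. br (l j) (r j) c"
    "\<And>j. L - 1 / real (Suc j) < r j"
    by metis
  define G where "G j = {x. reg x \<and> (\<forall>n. \<not> (r j < (f ^^ n) x \<and> (f ^^ n) x < q))}" for j
  define H where "H p = {x. 0 < x \<and> x < 1 \<and> fr (fst p) x \<and> (f ^^ (fst p)) x \<in> G (snd p)}" for p
  let ?O = "{x. reg x \<and> (\<forall>n. \<not> (c < (f ^^ n) x \<and> (f ^^ n) x < q)) \<and>
      (\<forall>e>0. \<exists>n. c - e < (f ^^ n) x \<and> (f ^^ n) x < c)}"
  have G: "negligible (G j)" for j
    unfolding G_def by (rule avoid_two_sided_null[OF q(1,2) q1 q(4) r(1-4)])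
  have "negligible (H p)" for p unfolding H_def by (rule null_preimage[OF G])
  then have "negligible (\<Union>(range H))" by (intro negligible_countable_Union) auto
  moreover have "negligible ?O" by (rule avoid_right_accumulate_left_null[OF q(1,2) q1 q(4)])
  ultimately have "negligible (?O \<union> \<Union>(range H))" by (rule negligible_Un[rotated])
  then show ?thesis
  proof (rule negligible_subset, intro subsetI)
    fix x assume x: "x \<in> ?F"
    then have rx: "reg x" and av: "\<not> (c < (f ^^ n) x \<and> (f ^^ n) x < w)" for n by auto
    show "x \<in> ?O \<union> \<Union>(range H)"
    proof (rule ccontr)
      assume no: "x \<notin> ?O \<union> \<Union>(range H)"
      have "\<not> (c < (f ^^ n) x \<and> (f ^^ n) x < q)" for n using av[of n] q by auto
      then obtain e where e: "0 < e" "\<And>n. \<not> (c - e < (f ^^ n) x \<and> (f ^^ n) x < c)"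
        using no rx by blast
      have vis: "\<exists>n\<ge>N. r j < (f ^^ n) x \<and> (f ^^ n) x < c" for N j
      proof -
        have "x \<notin> H (N, j)" using no by blast
        then have "(f ^^ N) x \<notin> G j" using rx reg_free reg_inner[OF rx] by (simp add: H_def)
        then obtain n where n: "r j < (f ^^ n) ((f ^^ N) x)" "(f ^^ n) ((f ^^ N) x) < q"
          using reg_iter[OF rx] by (auto simp: G_def)
        have "(f ^^ (N + n)) x \<noteq> c" using rx by (simp add: regular_def)
        then have "(f ^^ (N + n)) x < c" using av[of "N + n"] n q by (force simp: funpow_plus)
        then show ?thesis using n by (intro exI[of _ "N + n"]) (simp add: funpow_plus)
      qed
      show False
      proof (cases "L = c")
        case True
        obtain j where j: "1 / real (Suc j) < e" using nat_approx_posE[OF e(1)] .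
        obtain n where "r j < (f ^^ n) x" "(f ^^ n) x < c" using vis by blast
        then show False using e(2)[of n] r(5)[of j] j True by simp
      next
        case False
        then have Lc: "L < c" using lcut_bounds by simp
        have rL: "reg L" by (rule lcut_regular[OF Lc])
        obtain i where i: "c < (f ^^ i) L" "(f ^^ i) L < q"
          using lcut_orbit_near[OF Lc, of "q - c"] q by auto
        have "isCont (f ^^ i) L" by (rule isCont_iter) (use reg_inner[OF rL] reg_free[OF rL] in auto)
        then have "\<forall>\<^sub>F y in nhds L. (f ^^ i) y \<in> {c<..<q}"
          using i by (intro topological_tendstoD) (auto simp: continuous_at tendsto_nhds_iff isCont_def)
        then obtain d where d: "0 < d" "\<And>y. dist y L < d \<Longrightarrow> (f ^^ i) y \<in> {c<..<q}"
          unfolding eventually_nhds_metric by blast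
        obtain j where j: "1 / real (Suc j) < d" using nat_approx_posE[OF d(1)] .
        obtain N where N: "\<And>n. n \<ge> N \<Longrightarrow> \<not> (L < (f ^^ n) x \<and> (f ^^ n) x < c)"
        proof (cases "\<exists>n. L < (f ^^ n) x \<and> (f ^^ n) x < c")
          case True
          then obtain n0 where n0: "L < (f ^^ n0) x" "(f ^^ n0) x < c" by blast
          show thesis
          proof (rule that[of "Suc n0"])
            fix n assume n: "n \<ge> Suc n0"
            then have "(f ^^ n) x = (f ^^ (n - n0)) ((f ^^ n0) x)" by (simp add: funpow_plus)
            then show "\<not> (L < (f ^^ n) x \<and> (f ^^ n) x < c)" using left_once[OF n0, of "n - n0"] n by simp
          qed
        qed (use that in blast)
        obtain n where n: "n \<ge> N" "r j < (f ^^ n) x" "(f ^^ n) x < c" using vis by blast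
        then have "(f ^^ n) x \<le> L" using N[of n] by auto
        then have "dist ((f ^^ n) x) L < d" using n r(5)[of j] j by (simp add: dist_real_def)
        then have "c < (f ^^ (n + i)) x \<and> (f ^^ (n + i)) x < q" using d(2) by (force simp: funpow_plus)
        then show False using av[of "n + i"] q by simp
      qed
    qed
  qed
qed

lemma visits_left_ae:
  assumes w: "w < L" "0 \<le> w"
  shows "negligible {x. reg x \<and> (\<forall>n. \<not> (w < (f ^^ n) x \<and> (f ^^ n) x < c))}" (is "negligible ?F")
proof -
  interpret R: lorenz_dyn "reflect f" "1 - c" by (rule reflect_dyn)
  let ?G = "{x. R.reg x \<and> (\<forall>n. \<not> (1 - c < (reflect f ^^ n) x \<and> (reflect f ^^ n) x < 1 - w))}"
  have "negligible ?G" by (rule R.visits_right_ae) (use w in \<open>auto simp: rcut_reflect\<close>)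
  then have "negligible ((\<lambda>x. 1 - x) ` ?G)"
    by (intro negligible_differentiable_image_negligible) (auto intro!: derivative_intros differentiable_on_diff)
  moreover have "?F \<subseteq> (\<lambda>x. 1 - x) ` ?G"
  proof
    fix x assume "x \<in> ?F"
    then have "1 - x \<in> ?G" by (auto simp: regular_reflect funpow_reflect)
    then show "x \<in> (\<lambda>x. 1 - x) ` ?G" by (intro image_eqI[of _ _ "1 - x"]) auto
  qed
  ultimately show ?thesis by (rule negligible_subset)
qed

definition visits :: "real set \<Rightarrow> real \<Rightarrow> bool" where
  "visits S x \<longleftrightarrow> (\<forall>N. \<exists>n\<ge>N. (f ^^ n) x \<in> S)"

text \<open>
  The typical points: the orbit accumulates at \<open>Q\<close> from the right and at \<open>L\<close> from the left.
\<close>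

definition good :: "real \<Rightarrow> bool" where
  "good x \<longleftrightarrow> reg x \<and> (\<forall>w>Q. visits {c<..<w} x) \<and> (\<forall>w<L. visits {w<..<c} x)"

lemma visits_iter: "visits S ((f ^^ m) x) \<longleftrightarrow> visits S x"
proof
  assume "visits S ((f ^^ m) x)"
  then show "visits S x" unfolding visits_def by (metis funpow_plus trans_le_add2)
next
  assume v: "visits S x"
  show "visits S ((f ^^ m) x)" unfolding visits_def
  proof
    fix N
    obtain n where "n \<ge> m + N" "(f ^^ n) x \<in> S" using v by (auto simp: visits_def)
    then show "\<exists>n\<ge>N. (f ^^ n) ((f ^^ m) x) \<in> S"
      by (intro exI[of _ "n - m"]) (auto simp: funpow_plus)
  qed
qed

lemma visits_mono: "visits S x \<Longrightarrow> S \<subseteq> T \<Longrightarrow> visits T x"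
  unfolding visits_def by blast

lemma good_iter: "good x \<Longrightarrow> good ((f ^^ m) x)"
  by (auto simp: good_def visits_iter reg_iter)

lemma visits_ae_of_visit_ae:
  assumes "negligible {x. reg x \<and> (\<forall>n. (f ^^ n) x \<notin> S)}"
  shows "negligible {x. reg x \<and> \<not> visits S x}"
proof -
  let ?F = "{x. reg x \<and> (\<forall>n. (f ^^ n) x \<notin> S)}"
  define H where "H N = {x. 0 < x \<and> x < 1 \<and> fr N x \<and> (f ^^ N) x \<in> ?F}" for N
  have "negligible (H N)" for N unfolding H_def by (rule null_preimage[OF assms])
  then have "negligible (\<Union>(range H))" by (intro negligible_countable_Union) auto
  then show ?thesis
  proof (rule negligible_subset, intro subsetI)
    fix x assume "x \<in> {x. reg x \<and> \<not> visits S x}"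
    then obtain N where rx: "reg x" and N: "\<And>n. n \<ge> N \<Longrightarrow> (f ^^ n) x \<notin> S" by (auto simp: visits_def)
    have "(f ^^ N) x \<in> ?F" using reg_iter[OF rx] N by (simp add: funpow_plus)
    then show "x \<in> \<Union>(range H)" using reg_inner[OF rx] reg_free[OF rx] by (auto simp: H_def)
  qed
qed

text \<open>
  Countably many conditions suffice.
\<close>

lemma good_iff:
  "good x \<longleftrightarrow> reg x \<and> (\<forall>j. visits {c<..<Q + (1 - Q) / Suc j} x) \<and> (\<forall>j. visits {L - L / Suc j<..<c} x)"
proof -
  have "0 < 1 - Q" "0 < L" using rcut_bounds lcut_bounds by auto
  have "\<exists>j. Q + (1 - Q) / Suc j \<le> w" if w: "Q < w" for w
  proof -
    obtain j where "inverse (real (Suc j)) < (w - Q) / (1 - Q)"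
      using reals_Archimedean[of "(w - Q) / (1 - Q)"] w \<open>0 < 1 - Q\<close> by auto
    then have "(1 - Q) / Suc j < w - Q" using \<open>0 < 1 - Q\<close> by (simp add: field_simps)
    then show ?thesis by (intro exI[of _ j]) simp
  qed
  moreover have "\<exists>j. w \<le> L - L / Suc j" if w: "w < L" for w
  proof -
    obtain j where "inverse (real (Suc j)) < (L - w) / L"
      using reals_Archimedean[of "(L - w) / L"] w \<open>0 < L\<close> by auto
    then have "L / Suc j < L - w" using \<open>0 < L\<close> by (simp add: field_simps)
    then show ?thesis by (intro exI[of _ j]) simp
  qed
  moreover have "Q < Q + (1 - Q) / Suc j" "L - L / Suc j < L" for j
    using \<open>0 < 1 - Q\<close> \<open>0 < L\<close> by auto
  ultimately have right: "(\<forall>w>Q. visits {c<..<w} x) \<longleftrightarrow> (\<forall>j. visits {c<..<Q + (1 - Q) / Suc j} x)"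
    and left: "(\<forall>w<L. visits {w<..<c} x) \<longleftrightarrow> (\<forall>j. visits {L - L / Suc j<..<c} x)"
  proof (safe, goal_cases)
    case (1 j) then show ?case by blast
  next
    case (2 w)
    then obtain j where "Q + (1 - Q) / Suc j \<le> w" by blast
    then have "{c<..<Q + (1 - Q) / Suc j} \<subseteq> {c<..<w}" by auto
    then show ?case using 2 visits_mono by blast
  next
    case (3 j) then show ?case by blast
  next
    case (4 w)
    then obtain j where "w \<le> L - L / Suc j" by blast
    then have "{L - L / Suc j<..<c} \<subseteq> {w<..<c}" by auto
    then show ?case using 4 visits_mono by blast
  qed
  then show ?thesis by (simp add: good_def)
qed

lemma good_ae: "negligible {x. 0 < x \<and> x < 1 \<and> \<not> good x}"
proof -
  have b: "0 < 1 - Q" "0 < L" using rcut_bounds lcut_bounds by auto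
  define A where "A j = {x. reg x \<and> \<not> visits {c<..<Q + (1 - Q) / Suc j} x}" for j
  define B where "B j = {x. reg x \<and> \<not> visits {L - L / Suc j<..<c} x}" for j
  have "negligible (A j)" for j
    unfolding A_def
  proof (rule visits_ae_of_visit_ae)
    have "(1 - Q) / Suc j \<le> (1 - Q) / 1" by (rule divide_left_mono) (use b in auto)
    then have "Q < Q + (1 - Q) / Suc j" "Q + (1 - Q) / Suc j \<le> 1" using b by auto
    from visits_right_ae[OF this]
    show "negligible {x. reg x \<and> (\<forall>n. (f ^^ n) x \<notin> {c<..<Q + (1 - Q) / Suc j})}" by simp
  qed
  moreover have "negligible (B j)" for j
    unfolding B_def
  proof (rule visits_ae_of_visit_ae)
    have "L / Suc j \<le> L / 1" by (rule divide_left_mono) (use b in auto)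
    then have "L - L / Suc j < L" "0 \<le> L - L / Suc j" using b by auto
    from visits_left_ae[OF this]
    show "negligible {x. reg x \<and> (\<forall>n. (f ^^ n) x \<notin> {L - L / Suc j<..<c})}" by simp
  qed
  ultimately have "negligible (\<Union>(range A) \<union> \<Union>(range B))"
    by (intro negligible_Un negligible_countable_Union) auto
  then have "negligible ((\<Union>(range A) \<union> \<Union>(range B)) \<union> {x. 0 < x \<and> x < 1 \<and> \<not> reg x})"
    using irregular_null by (rule negligible_Un)
  then show ?thesis
    by (rule negligible_subset) (auto simp: good_iff A_def B_def)
qed

subsection \<open>Limit sets\<close>

abbreviation "om \<equiv> omega_limit f c"

lemma omega_iff:
  assumes "reg x" shows "y \<in> om x \<longleftrightarrow> (\<forall>e>0. visits {y - e<..<y + e} x)"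
proof
  assume "y \<in> om x"
  then obtain r :: "nat \<Rightarrow> nat" where r: "filterlim r at_top sequentially" "(\<lambda>j. (f ^^ r j) x) \<longlonglongrightarrow> y"
    by (auto simp: omega_limit_def)
  show "\<forall>e>0. visits {y - e<..<y + e} x"
    unfolding visits_def
  proof (intro allI impI)
    fix e :: real and N assume "0 < e"
    then have "\<forall>\<^sub>F j in sequentially. dist ((f ^^ r j) x) y < e" using tendstoD[OF r(2)] by blast
    moreover have "\<forall>\<^sub>F j in sequentially. N \<le> r j" using r(1) by (simp add: filterlim_at_top)
    ultimately have "\<forall>\<^sub>F j in sequentially. dist ((f ^^ r j) x) y < e \<and> N \<le> r j"
      by (rule eventually_conj)
    then obtain j where "dist ((f ^^ r j) x) y < e" "N \<le> r j" by (auto simp: eventually_sequentially)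
    then show "\<exists>n\<ge>N. (f ^^ n) x \<in> {y - e<..<y + e}" by (intro exI[of _ "r j"]) (auto simp: dist_real_def)
  qed
next
  assume v: "\<forall>e>0. visits {y - e<..<y + e} x"
  have "\<exists>n\<ge>j. \<bar>(f ^^ n) x - y\<bar> < 1 / Suc j" for j
  proof -
    have "visits {y - 1 / Suc j<..<y + 1 / Suc j} x" using v by simp
    then obtain n where "n \<ge> j" "(f ^^ n) x \<in> {y - 1 / Suc j<..<y + 1 / Suc j}" unfolding visits_def by blast
    then show ?thesis by (intro exI[of _ n]) (auto simp: abs_less_iff)
  qed
  then obtain r :: "nat \<Rightarrow> nat" where r: "\<And>j. r j \<ge> j" "\<And>j. \<bar>(f ^^ r j) x - y\<bar> < 1 / Suc j" by metis
  have "filterlim r at_top sequentially"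
    unfolding filterlim_at_top
  proof
    fix Z show "\<forall>\<^sub>F j in sequentially. Z \<le> r j"
      unfolding eventually_sequentially using r(1) order_trans by blast
  qed
  moreover have "(\<lambda>j. (f ^^ r j) x - y) \<longlonglongrightarrow> 0"
  proof (rule Lim_null_comparison)
    show "\<forall>\<^sub>F j in sequentially. norm ((f ^^ r j) x - y) \<le> 1 / Suc j"
      using r(2) by (intro always_eventually allI) (simp add: less_imp_le)
    show "(\<lambda>j. 1 / real (Suc j)) \<longlonglongrightarrow> 0" using LIMSEQ_inverse_real_of_nat by (simp add: inverse_eq_divide)
  qed
  then have "(\<lambda>j. (f ^^ r j) x) \<longlonglongrightarrow> y" by (simp add: LIM_zero_iff)
  ultimately show "y \<in> om x" using assms by (auto simp: omega_limit_def regular_def)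
qed

lemma omega_iter: assumes "reg x" shows "om ((f ^^ m) x) = om x"
  using omega_iff[OF assms] omega_iff[OF reg_iter[OF assms]] by (auto simp: visits_iter)

lemma omega_visits: "reg x \<Longrightarrow> y \<in> om x \<Longrightarrow> a < y \<Longrightarrow> y < b \<Longrightarrow> visits {a<..<b} x"
proof -
  assume "reg x" "y \<in> om x" "a < y" "y < b"
  then have "visits {y - min (y - a) (b - y)<..<y + min (y - a) (b - y)} x" using omega_iff by simp
  then show ?thesis by (rule visits_mono) auto
qed

lemma omega_subset: "reg x \<Longrightarrow> om x \<subseteq> {0..1}"
proof
  fix y assume x: "reg x" "y \<in> om x"
  show "y \<in> {0..1}"
  proof (rule ccontr)
    assume "y \<notin> {0..1}"
    then consider "y < 0" | "1 < y" by force
    then show False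
    proof cases
      case 1
      then obtain n where "(f ^^ n) x < 0"
        using omega_visits[OF x, of "y - 1" 0] unfolding visits_def by auto
      then show False using reg_inner(1)[OF reg_iter[OF x(1), of n]] by simp
    next
      case 2
      then obtain n where "1 < (f ^^ n) x"
        using omega_visits[OF x, of 1 "y + 1"] unfolding visits_def by auto
      then show False using reg_inner(2)[OF reg_iter[OF x(1), of n]] by simp
    qed
  qed
qed

lemma omega_closed: assumes "reg x" shows "closed (om x)"
  unfolding closed_sequential_limits
proof (intro allI impI, elim conjE)
  fix u l assume u: "\<forall>n. u n \<in> om x" "u \<longlonglongrightarrow> l"
  show "l \<in> om x" unfolding omega_iff[OF assms]
  proof (intro allI impI)
    fix e :: real assume "0 < e"
    then have "\<forall>\<^sub>F n in sequentially. dist (u n) l < e" using tendstoD[OF u(2)] by blast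
    then obtain n where "dist (u n) l < e" by (auto simp: eventually_sequentially)
    then show "visits {l - e<..<l + e} x"
      using omega_visits[OF assms, of "u n" "l - e" "l + e"] u(1) by (auto simp: dist_real_def)
  qed
qed

lemma omega_forward: assumes x: "reg x" and y: "y \<in> om x" "y \<noteq> c" shows "f y \<in> om x"
  unfolding omega_iff[OF x]
proof (intro allI impI)
  fix e :: real assume e: "0 < e"
  have yi: "y \<in> {0..1} - {c}" using omega_subset[OF x] y by blast
  then obtain d where d: "0 < d" "\<And>z. z \<in> {0..1} - {c} \<Longrightarrow> dist z y < d \<Longrightarrow> dist (f z) (f y) < e"
    using cont e unfolding continuous_on_iff by blast
  show "visits {f y - e<..<f y + e} x"
    unfolding visits_def
  proof
    fix N
    obtain n where n: "n \<ge> N" "(f ^^ n) x \<in> {y - d<..<y + d}"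
      using omega_visits[OF x y(1), of "y - d" "y + d"] d(1) unfolding visits_def by auto
    have "(f ^^ n) x \<in> {0..1} - {c}"
      using reg_inner[OF reg_iter[OF x, of n]] x by (auto simp: regular_def)
    moreover have "dist ((f ^^ n) x) y < d" using n by (auto simp: dist_real_def)
    ultimately have "dist (f ((f ^^ n) x)) (f y) < e" by (rule d(2))
    then show "\<exists>n\<ge>N. (f ^^ n) x \<in> {f y - e<..<f y + e}"
      using n by (intro exI[of _ "Suc n"]) (auto simp: dist_real_def)
  qed
qed

lemma omega_forward_invariant: "reg x \<Longrightarrow> forward_invariant f c (om x)"
  using omega_subset omega_forward by (auto simp: forward_invariant_def)

lemma omega_forward_iter: assumes "reg x" "y \<in> om x" "fr n y" shows "(f ^^ n) y \<in> om x"
  using assms(3)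
proof (induction n)
  case 0 then show ?case using assms by simp
next
  case (Suc n) then show ?case using omega_forward[OF assms(1)] by (simp add: free_Suc)
qed

lemma good_reg: "good x \<Longrightarrow> reg x" by (simp add: good_def)

lemma good_omega_Q: assumes "good x" "\<And>n. \<not> (c < (f ^^ n) x \<and> (f ^^ n) x < Q)" shows "Q \<in> om x"
  unfolding omega_iff[OF good_reg[OF assms(1)]]
proof (intro allI impI)
  fix e :: real assume "0 < e"
  then have "visits {c<..<Q + e} x" using assms(1) by (simp add: good_def)
  then have v: "\<exists>n\<ge>N. c < (f ^^ n) x \<and> (f ^^ n) x < Q + e" for N unfolding visits_def by simp
  show "visits {Q - e<..<Q + e} x"
    unfolding visits_def
  proof
    fix N
    obtain n where n: "n \<ge> N" "c < (f ^^ n) x" "(f ^^ n) x < Q + e" using v by blast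
    then have "Q \<le> (f ^^ n) x" using assms(2)[of n] by auto
    then show "\<exists>n\<ge>N. (f ^^ n) x \<in> {Q - e<..<Q + e}" using n \<open>0 < e\<close> by (intro exI[of _ n]) auto
  qed
qed

text \<open>
  At least one of \<open>Q\<close>, \<open>L\<close> equals \<open>c\<close>.
\<close>

lemma good_omega_c: assumes "good x" shows "c \<in> om x"
  unfolding omega_iff[OF good_reg[OF assms]]
proof (intro allI impI)
  fix e :: real assume e: "0 < e"
  have "Q = c \<or> L = c" using not_two_homtervals rcut_bounds lcut_bounds by force
  then show "visits {c - e<..<c + e} x"
  proof
    assume "Q = c"
    then have "visits {c<..<c + e} x" using assms e by (simp add: good_def)
    then show ?thesis by (rule visits_mono) (use e in auto)
  next
    assume "L = c"
    then have "visits {c - e<..<c} x" using assms e by (simp add: good_def)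
    then show ?thesis by (rule visits_mono) (use e in auto)
  qed
qed

end

subsection \<open>Generic points\<close>

text \<open>
  Residual subsets of the unit interval, with the dense open sets taken in the real line; the end points
  are ignored.
\<close>

definition generic :: "real set \<Rightarrow> bool" where
  "generic X \<longleftrightarrow> (\<exists>\<G>. countable \<G> \<and> (\<forall>T\<in>\<G>. open T \<and> (\<forall>a b. 0 \<le> a \<and> a < b \<and> b \<le> 1 \<longrightarrow> T \<inter> {a<..<b} \<noteq> {})) \<and>
      {0<..<1} \<inter> \<Inter>\<G> \<subseteq> X)"

lemma generic_mono: "generic X \<Longrightarrow> {0<..<1} \<inter> X \<subseteq> Y \<Longrightarrow> generic Y"
  unfolding generic_def by (elim exE conjE) (intro exI conjI, assumption+, blast)

lemma generic_INT: assumes "\<And>i. generic (X (i::nat))" shows "generic (\<Inter>i. X i)"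
proof -
  obtain G where G: "\<And>i. countable (G i)"
    "\<And>i T. T \<in> G i \<Longrightarrow> open T \<and> (\<forall>a b. 0 \<le> a \<and> a < b \<and> b \<le> 1 \<longrightarrow> T \<inter> {a<..<b} \<noteq> {})"
    "\<And>i. {0<..<1} \<inter> \<Inter>(G i) \<subseteq> X i"
    using assms unfolding generic_def by metis
  show ?thesis
    unfolding generic_def
  proof (intro exI[of _ "\<Union>i. G i"] conjI ballI)
    show "countable (\<Union>i. G i)" using G(1) by simp
    show "open T" "\<forall>a b. 0 \<le> a \<and> a < b \<and> b \<le> 1 \<longrightarrow> T \<inter> {a<..<b} \<noteq> {}" if "T \<in> (\<Union>i. G i)" for T
      using that G(2) by blast+
    show "{0<..<1} \<inter> \<Inter>(\<Union>i. G i) \<subseteq> (\<Inter>i. X i)" using G(3) by blast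
  qed
qed

lemma generic_Int: assumes "generic X" "generic Y" shows "generic (X \<inter> Y)"
proof -
  have "generic (\<Inter>i::nat. if i = 0 then X else Y)" by (rule generic_INT) (use assms in auto)
  then show ?thesis by (rule generic_mono) (force split: if_splits)
qed

text \<open>
  Baire's theorem in a closed interval inside the open set in which \<open>R\<close> is residual.
\<close>

lemma residual_meets_generic:
  assumes "residual_in_some_open R"
  obtains a b where "0 \<le> a" "a < b" "b \<le> 1"
    "\<And>a' b' X. a \<le> a' \<Longrightarrow> a' < b' \<Longrightarrow> b' \<le> b \<Longrightarrow> generic X \<Longrightarrow> R \<inter> X \<inter> {a'<..<b'} \<noteq> {}"
proof -
  obtain U where U: "openin (top_of_set {0..1::real}) U" "U \<noteq> {}" "residual_in R U"
    using assms unfolding residual_in_some_open_def by blast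
  obtain V where V: "open V" "U = {0..1} \<inter> V" using U(1) by (auto simp: openin_open)
  obtain x where x: "x \<in> V" "0 \<le> x" "x \<le> 1" using U(2) V by auto
  obtain e where e: "0 < e" "ball x e \<subseteq> V" using V(1) x(1) open_contains_ball by blast
  define a where "a = max 0 (x - e)"
  define b where "b = min 1 (x + e)"
  have ab: "0 \<le> a" "a < b" "b \<le> 1" using x e by (auto simp: a_def b_def)
  have abU: "{a<..<b} \<subseteq> U"
  proof
    fix z assume "z \<in> {a<..<b}"
    then have "z \<in> ball x e" "0 \<le> z" "z \<le> 1" by (auto simp: a_def b_def dist_real_def)
    then show "z \<in> U" using e(2) V by auto
  qed
  obtain G where G0: "countable G" "\<forall>T\<in>G. openin (top_of_set U) T \<and> U \<subseteq> closure T" "U \<inter> \<Inter>G \<subseteq> R"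
    using U(3) unfolding residual_in_def by blast
  then have G: "countable G" "\<And>T. T \<in> G \<Longrightarrow> openin (top_of_set U) T" "\<And>T. T \<in> G \<Longrightarrow> U \<subseteq> closure T"
    "U \<inter> \<Inter>G \<subseteq> R" by simp_all
  show thesis
  proof (rule that[OF ab])
    fix a' b' X assume a': "a \<le> a'" "a' < b'" "b' \<le> b" and X: "generic X"
    obtain H where "countable H"
      "\<forall>T\<in>H. open T \<and> (\<forall>a b. 0 \<le> a \<and> a < b \<and> b \<le> 1 \<longrightarrow> T \<inter> {a<..<b} \<noteq> {})" "{0<..<1} \<inter> \<Inter>H \<subseteq> X"
      using X unfolding generic_def by blast
    then have H: "countable H" "\<And>T. T \<in> H \<Longrightarrow> open T"
      "\<And>T a b. T \<in> H \<Longrightarrow> 0 \<le> a \<Longrightarrow> a < b \<Longrightarrow> b \<le> 1 \<Longrightarrow> T \<inter> {a<..<b} \<noteq> {}" "{0<..<1} \<inter> \<Inter>H \<subseteq> X"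
      by simp_all
    define u where "u = (2 * a' + b') / 3"
    define v where "v = (a' + 2 * b') / 3"
    have uv: "a' < u" "u < v" "v < b'" using a' by (auto simp: u_def v_def)
    let ?S = "{u..v}"
    have SU: "?S \<subseteq> U" using abU uv a' by force
    define K where "K = insert ?S ((\<lambda>T. T \<inter> ?S) ` G \<union> (\<lambda>T. T \<inter> ?S) ` H)"
    have dense: "?S \<subseteq> closure (T \<inter> ?S)"
      if T: "\<And>\<alpha> \<beta>. u \<le> \<alpha> \<Longrightarrow> \<alpha> < \<beta> \<Longrightarrow> \<beta> \<le> v \<Longrightarrow> T \<inter> {\<alpha><..<\<beta>} \<noteq> {}" for T
    proof
      fix z assume z: "z \<in> ?S"
      show "z \<in> closure (T \<inter> ?S)"
        unfolding closure_approachable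
      proof (intro allI impI)
        fix d :: real assume d: "0 < d"
        have "T \<inter> {max u (z - d)<..<min v (z + d)} \<noteq> {}" by (rule T) (use z d uv in auto)
        then obtain t where "t \<in> T \<inter> {max u (z - d)<..<min v (z + d)}" by blast
        then show "\<exists>t\<in>T \<inter> ?S. dist t z < d" by (intro bexI[of _ t]) (auto simp: dist_real_def)
      qed
    qed
    have "?S \<subseteq> closure (\<Inter>K)"
    proof (rule Baire)
      show "countable K" using G(1) H(1) by (simp add: K_def)
      fix T assume "T \<in> K"
      then consider "T = ?S" | T' where "T' \<in> G" "T = T' \<inter> ?S" | T' where "T' \<in> H" "T = T' \<inter> ?S"
        unfolding K_def by blast
      then show "openin (top_of_set ?S) T \<and> ?S \<subseteq> closure T"
      proof cases
        case 1 then show ?thesis using closure_subset by auto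
      next
        case 2
        obtain W where W: "open W" "T' = U \<inter> W" using G(2)[OF 2(1)] by (auto simp: openin_open)
        have "T = ?S \<inter> W" using 2 W SU by blast
        then have "openin (top_of_set ?S) T" using W by (auto simp: openin_open)
        moreover have "?S \<subseteq> closure (T' \<inter> ?S)"
        proof (rule dense)
          fix \<alpha> \<beta> assume "u \<le> \<alpha>" "\<alpha> < \<beta>" "\<beta> \<le> v"
          then have mid: "(\<alpha> + \<beta>) / 2 \<in> {\<alpha><..<\<beta>}" "(\<alpha> + \<beta>) / 2 \<in> ?S" by auto
          then have "(\<alpha> + \<beta>) / 2 \<in> closure T'" using G(3)[OF 2(1)] SU by blast
          then show "T' \<inter> {\<alpha><..<\<beta>} \<noteq> {}"
            using mid(1) open_Int_closure_eq_empty[OF open_greaterThanLessThan, of \<alpha> \<beta> T'] by blast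
        qed
        ultimately show ?thesis using 2 by simp
      next
        case 3
        have "openin (top_of_set ?S) T" using 3 H(2)[OF 3(1)] by (auto simp: openin_open)
        moreover have "?S \<subseteq> closure (T' \<inter> ?S)"
          by (rule dense, rule H(3)[OF 3(1)]) (use uv a' ab in auto)
        ultimately show ?thesis using 3 by simp
      qed
    qed simp
    then have "\<Inter>K \<noteq> {}" using uv by auto
    then obtain z where z: "z \<in> \<Inter>K" by blast
    then have "z \<in> ?S" by (auto simp: K_def)
    then have "z \<in> {a'<..<b'}" "z \<in> U" "z \<in> {0<..<1}" using uv SU a' ab by auto
    moreover have "z \<in> \<Inter>G" "z \<in> \<Inter>H" using z by (auto simp: K_def)
    ultimately show "R \<inter> X \<inter> {a'<..<b'} \<noteq> {}" using G(4) H(4) by blast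
  qed
qed

lemma residual_generic_nonempty:
  assumes "residual_in_some_open R" "generic X" shows "R \<inter> X \<noteq> {}"
proof -
  obtain a b where "0 \<le> a" "a < b" "b \<le> 1" and
    m: "\<And>a' b' X. a \<le> a' \<Longrightarrow> a' < b' \<Longrightarrow> b' \<le> b \<Longrightarrow> generic X \<Longrightarrow> R \<inter> X \<inter> {a'<..<b'} \<noteq> {}"
  proof (rule residual_meets_generic[OF assms(1)], goal_cases)
    case (1 a b) show ?case by (rule that) (fact 1)+
  qed
  then show ?thesis using m[OF order_refl \<open>a < b\<close> order_refl assms(2)] by blast
qed

context lorenz_dyn
begin

lemma interval_meets_full:
  fixes a b :: real
  assumes "negligible {x. 0 < x \<and> x < 1 \<and> \<not> P x}" "0 \<le> a" "a < b" "b \<le> 1"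
  obtains x where "a < x" "x < b" "P x"
proof -
  have "\<not> {a<..<b} \<subseteq> {x. 0 < x \<and> x < 1 \<and> \<not> P x}"
  proof
    assume "{a<..<b} \<subseteq> {x. 0 < x \<and> x < 1 \<and> \<not> P x}"
    then have "negligible {a<..<b}" using assms(1) negligible_subset by blast
    moreover have "{a<..<b} \<noteq> {}" using assms(3) by simp
    ultimately show False using open_not_negligible[OF open_greaterThanLessThan, of a b] by blast
  qed
  then show thesis using that assms by auto
qed

lemma open_branch_set: "open {x. 0 < x \<and> x < 1 \<and> fr n x}"
proof (subst open_subopen, intro ballI)
  fix x assume "x \<in> {x. 0 < x \<and> x < 1 \<and> fr n x}"
  then obtain t s where ts: "br n t s" "t < x" "x < s" using free_nbhd[of x n] by blast
  then show "\<exists>T. open T \<and> x \<in> T \<and> T \<subseteq> {x. 0 < x \<and> x < 1 \<and> fr n x}"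
    using branchD[OF ts(1)] by (intro exI[of _ "{t<..<s}"]) auto
qed

text \<open>
  The points that enter an open set after time \<open>N\<close> form an open set, so density is enough.
\<close>

lemma generic_visits:
  assumes O: "open S"
    and dense: "\<And>N a b. 0 \<le> a \<Longrightarrow> a < b \<Longrightarrow> b \<le> 1 \<Longrightarrow> \<exists>x n. a < x \<and> x < b \<and> reg x \<and> N \<le> n \<and> (f ^^ n) x \<in> S"
  shows "generic {x. reg x \<and> visits S x}"
proof -
  define D where "D N = (\<Union>n\<in>{N..}. {x\<in>{x. 0 < x \<and> x < 1 \<and> fr n x}. (f ^^ n) x \<in> S})" for N
  define E where "E n = {x. 0 < x \<and> x < 1 \<and> fr n x}" for n
  have oE: "open (E n)" for n unfolding E_def by (rule open_branch_set)
  have oD: "open (D N)" for N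
    unfolding D_def
  proof (intro open_UN ballI)
    fix n
    have "continuous_on (E n) (f ^^ n)" by (rule iter_cont_on) (auto simp: E_def)
    then have "open (E n \<inter> (f ^^ n) -` S)" using continuous_on_open_vimage[OF oE] O by (metis Int_commute)
    moreover have "E n \<inter> (f ^^ n) -` S = {x\<in>{x. 0 < x \<and> x < 1 \<and> fr n x}. (f ^^ n) x \<in> S}"
      by (auto simp: E_def)
    ultimately show "open {x\<in>{x. 0 < x \<and> x < 1 \<and> fr n x}. (f ^^ n) x \<in> S}" by simp
  qed
  show ?thesis
    unfolding generic_def
  proof (intro exI[of _ "range D \<union> range E"] conjI ballI allI impI)
    fix T assume T: "T \<in> range D \<union> range E"
    then show "open T" using oD oE by auto
    fix a b :: real assume ab: "0 \<le> a \<and> a < b \<and> b \<le> 1"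
    from T consider N where "T = D N" | n where "T = E n" by blast
    then show "T \<inter> {a<..<b} \<noteq> {}"
    proof cases
      case 1
      obtain x n where x: "a < x" "x < b" "reg x" "N \<le> n" "(f ^^ n) x \<in> S" using dense ab by blast
      then have "x \<in> D N" unfolding D_def using reg_inner[OF x(3)] reg_free[OF x(3)] by auto
      then show ?thesis using 1 x by auto
    next
      case 2
      obtain x where "a < x" "x < b" "reg x" using interval_meets_full[OF irregular_null] ab by blast
      then have "x \<in> E n" using reg_inner reg_free by (simp add: E_def)
      then show ?thesis using 2 \<open>a < x\<close> \<open>x < b\<close> by auto
    qed
  next
    show "{0<..<1} \<inter> \<Inter>(range D \<union> range E) \<subseteq> {x. reg x \<and> visits S x}"
    proof
      fix x assume x: "x \<in> {0<..<1} \<inter> \<Inter>(range D \<union> range E)"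
      have "(f ^^ n) x \<noteq> c" for n
      proof -
        have "x \<in> E (Suc n)" using x by blast
        then show ?thesis by (simp add: E_def free_Suc)
      qed
      moreover have "\<exists>n\<ge>N. (f ^^ n) x \<in> S" for N
      proof -
        have "x \<in> D N" using x by blast
        then show ?thesis unfolding D_def by auto
      qed
      ultimately show "x \<in> {x. reg x \<and> visits S x}" using x by (auto simp: regular_def visits_def)
    qed
  qed auto
qed

lemma generic_visits_ae:
  assumes "open S" "negligible {x. 0 < x \<and> x < 1 \<and> \<not> (reg x \<and> visits S x)}"
  shows "generic {x. reg x \<and> visits S x}"
proof (rule generic_visits[OF assms(1)])
  fix N :: nat and a b :: real assume "0 \<le> a" "a < b" "b \<le> 1"
  then obtain x where "a < x" "x < b" "reg x \<and> visits S x" using interval_meets_full[OF assms(2)] by blast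
  then show "\<exists>x n. a < x \<and> x < b \<and> reg x \<and> N \<le> n \<and> (f ^^ n) x \<in> S" unfolding visits_def by blast
qed

lemma good_generic: "generic {x. good x}"
proof -
  have b: "0 < 1 - Q" "0 < L" using rcut_bounds lcut_bounds by auto
  have "generic {x. reg x \<and> visits {c<..<Q + (1 - Q) / Suc j} x}" for j
    by (rule generic_visits_ae[OF _ negligible_subset[OF good_ae]]) (auto simp: good_iff)
  moreover have "generic {x. reg x \<and> visits {L - L / Suc j<..<c} x}" for j
    by (rule generic_visits_ae[OF _ negligible_subset[OF good_ae]]) (auto simp: good_iff)
  ultimately have "generic ((\<Inter>j. {x. reg x \<and> visits {c<..<Q + (1 - Q) / Suc j} x}) \<inter>
      (\<Inter>j. {x. reg x \<and> visits {L - L / Suc j<..<c} x}))"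
    by (intro generic_Int generic_INT)
  then show ?thesis by (rule generic_mono) (auto simp: good_iff)
qed

subsection \<open>Recognising the attractors\<close>

text \<open>
  An attractor must be minimal when compared with \<open>Z\<close>, and almost every limit set is \<open>Z\<close>.
\<close>

lemma metrical_attractor_eq:
  assumes ae: "negligible {x. 0 < x \<and> x < 1 \<and> om x \<noteq> Z}" and Z: "closed Z" "forward_invariant f c Z"
    and att: "metrical_attractor f c A"
  shows "A = Z"
proof -
  have neg: "negligible ({x. 0 < x \<and> x < 1 \<and> om x \<noteq> Z} \<union> {0, 1})"
    by (intro negligible_Un ae) auto
  have pos: "\<not> negligible S" if "emeasure lebesgue S > 0" for S :: "real set"
    using that by (auto simp: negligible_iff_null_sets null_sets_def)
  have "\<not> negligible (basin f c A)" using att pos by (simp add: metrical_attractor_def)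
  then have "\<not> basin f c A \<subseteq> {x. 0 < x \<and> x < 1 \<and> om x \<noteq> Z} \<union> {0, 1}"
    using neg negligible_subset by blast
  then obtain x where "x \<in> basin f c A" "om x = Z" by (force simp: basin_def)
  then have ZA: "Z \<subseteq> A" by (simp add: basin_def)
  show ?thesis
  proof (rule ccontr)
    assume "A \<noteq> Z"
    then have "emeasure lebesgue (basin f c A - basin f c Z) > 0"
      using att ZA Z unfolding metrical_attractor_def by blast
    then have "\<not> negligible (basin f c A - basin f c Z)" by (rule pos)
    moreover have "basin f c A - basin f c Z \<subseteq> {x. 0 < x \<and> x < 1 \<and> om x \<noteq> Z} \<union> {0, 1}"
      by (force simp: basin_def)
    ultimately show False using neg negligible_subset by blast
  qed
qed

lemma topological_attractor_superset:
  assumes gen: "generic {x. Z \<subseteq> om x}" and att: "topological_attractor f c A"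
  shows "Z \<subseteq> A"
proof -
  have "residual_in_some_open (basin f c A)" using att by (simp add: topological_attractor_def)
  then have "basin f c A \<inter> {x. Z \<subseteq> om x} \<noteq> {}"
    using gen by (rule residual_generic_nonempty)
  then show ?thesis by (auto simp: basin_def)
qed

lemma topological_attractor_eq:
  assumes gen: "generic {x. om x = Z}" and Z: "closed Z" "forward_invariant f c Z"
    and att: "topological_attractor f c A"
  shows "A = Z"
proof (rule ccontr)
  have "Z \<subseteq> A" by (rule topological_attractor_superset[OF generic_mono[OF gen] att]) auto
  moreover assume "A \<noteq> Z"
  ultimately have "residual_in_some_open (basin f c A - basin f c Z)"
    using att Z unfolding topological_attractor_def by blast
  then have "(basin f c A - basin f c Z) \<inter> {x. om x = Z} \<noteq> {}"
    using gen by (rule residual_generic_nonempty)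
  then show False by (auto simp: basin_def)
qed

end

section \<open>The core limit set\<close>

text \<open>
  Change of variables.
\<close>

lemma measure_image_le:
  fixes g :: "real \<Rightarrow> real"
  assumes G: "compact G" and inj: "inj_on g G"
    and der: "\<And>x. x \<in> G \<Longrightarrow> (g has_real_derivative g' x) (at x)" "\<And>x. x \<in> G \<Longrightarrow> \<bar>g' x\<bar> \<le> M"
  shows "measure lebesgue (g ` G) \<le> M * measure lebesgue G"
proof -
  have Gl: "G \<in> lmeasurable" using G by (rule lmeasurable_compact)
  have "continuous_on G g"
    using der(1) by (meson DERIV_isCont continuous_at_imp_continuous_on)
  then have cg: "compact (g ` G)" using G by (rule compact_continuous_image)
  then have gl: "g ` G \<in> lmeasurable" by (rule lmeasurable_compact)
  have "(\<lambda>x. \<bar>g' x\<bar> * 1) absolutely_integrable_on G \<and> integral G (\<lambda>x. \<bar>g' x\<bar> * 1) = measure lebesgue (g ` G)"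
    by (subst has_absolute_integral_change_of_variables_1'[of G g g' "\<lambda>_. 1"])
      (use Gl gl inj der(1) in \<open>auto simp: fmeasurable_def has_field_derivative_at_within
         absolutely_integrable_on_const lmeasure_integral\<close>)
  then have I: "(\<lambda>x. \<bar>g' x\<bar>) integrable_on G"
    and eq: "measure lebesgue (g ` G) = integral G (\<lambda>x. \<bar>g' x\<bar>)"
    by (auto simp: absolutely_integrable_on_def)
  have "integral G (\<lambda>x. \<bar>g' x\<bar>) \<le> integral G (\<lambda>x. M)"
    using Gl der(2) I by (intro integral_le) (auto simp: integrable_on_const)
  also have "\<dots> = M * measure lebesgue G"
    using Gl lmeasure_integral[OF Gl] integral_mult_right[of G M "\<lambda>x. 1"] by simp
  finally show ?thesis using eq by simp
qed

context lorenz_dyn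
begin

text \<open>
  Typical points that do not visit the homterval next to \<open>c\<close>. Their orbits come close to \<open>Q\<close> and \<open>L\<close>
  without jumping over these points, which makes the branches around them extend as far as possible.
\<close>

definition core :: "real \<Rightarrow> bool" where
  "core x \<longleftrightarrow> good x \<and> (\<forall>n. \<not> (c < (f ^^ n) x \<and> (f ^^ n) x < Q)) \<and> (\<forall>n. \<not> (L < (f ^^ n) x \<and> (f ^^ n) x < c))"

lemma core_good: "core x \<Longrightarrow> good x" and core_reg: "core x \<Longrightarrow> reg x"
  by (auto simp: core_def good_def)

text \<open>
  A homterval next to \<open>c\<close> is visited at most once.
\<close>

lemma good_core: assumes "good x" obtains N where "core ((f ^^ N) x)"
proof -
  have "\<exists>N. \<forall>n\<ge>N. \<not> (c < (f ^^ n) x \<and> (f ^^ n) x < Q)"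
  proof (cases "\<exists>n. c < (f ^^ n) x \<and> (f ^^ n) x < Q")
    case True
    then obtain m where m: "c < (f ^^ m) x" "(f ^^ m) x < Q" by blast
    have "\<not> (c < (f ^^ n) x \<and> (f ^^ n) x < Q)" if "n \<ge> Suc m" for n
      using right_once[OF m, of "n - m"] that by (simp add: funpow_plus)
    then show ?thesis by blast
  qed blast
  then obtain N1 where N1: "\<And>n. n \<ge> N1 \<Longrightarrow> \<not> (c < (f ^^ n) x \<and> (f ^^ n) x < Q)" by blast
  have "\<exists>N. \<forall>n\<ge>N. \<not> (L < (f ^^ n) x \<and> (f ^^ n) x < c)"
  proof (cases "\<exists>n. L < (f ^^ n) x \<and> (f ^^ n) x < c")
    case True
    then obtain m where m: "L < (f ^^ m) x" "(f ^^ m) x < c" by blast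
    have "\<not> (L < (f ^^ n) x \<and> (f ^^ n) x < c)" if "n \<ge> Suc m" for n
      using left_once[OF m, of "n - m"] that by (simp add: funpow_plus)
    then show ?thesis by blast
  qed blast
  then obtain N2 where N2: "\<And>n. n \<ge> N2 \<Longrightarrow> \<not> (L < (f ^^ n) x \<and> (f ^^ n) x < c)" by blast
  have "core ((f ^^ max N1 N2) x)"
    using N1 N2 good_iter[OF assms] by (simp add: core_def funpow_plus)
  then show thesis by (rule that)
qed

lemma core_exists: obtains x where "core x"
  using interval_meets_full[OF good_ae, of 0 1] good_core by (metis order_refl zero_less_one)

text \<open>
  Points outside the limit set of some core point, in a form that is easily reflected.
\<close>

definition unvisited :: "real \<Rightarrow> bool" where
  "unvisited y \<longleftrightarrow> (\<exists>x e. core x \<and> 0 < e \<and> \<not> visits {y - e<..<y + e} x)"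

definition core_limit :: "real set" where
  "core_limit = {y. \<not> unvisited y}"

lemma core_limit_Inter: "core_limit = (\<Inter>x\<in>{x. core x}. om x)"
  by (auto simp: core_limit_def unvisited_def omega_iff core_reg)

lemma core_limit_closed: "closed core_limit"
  unfolding core_limit_Inter by (rule closed_INT) (use omega_closed core_reg in auto)

lemma core_limit_forward_invariant: "forward_invariant f c core_limit"
proof -
  obtain x where "core x" by (rule core_exists)
  then have sub: "core_limit \<subseteq> {0..1}" using omega_subset core_reg unfolding core_limit_Inter by blast
  show ?thesis
    unfolding forward_invariant_def
  proof (rule conjI[OF sub], rule subsetI)
    fix z assume "z \<in> f ` (core_limit - {c})"
    then obtain y where y: "y \<in> core_limit" "y \<noteq> c" "z = f y" by blast
    then have "f y \<in> om x" if "core x" for x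
      using omega_forward[OF core_reg[OF that], of y] that unfolding core_limit_Inter by blast
    then show "z \<in> core_limit" using y unfolding core_limit_Inter by blast
  qed
qed

lemma core_limit_subset_omega: assumes "good x" shows "core_limit \<subseteq> om x"
proof -
  obtain N where "core ((f ^^ N) x)" using good_core[OF assms] .
  then have "core_limit \<subseteq> om ((f ^^ N) x)" unfolding core_limit_Inter by blast
  then show ?thesis using omega_iter[OF good_reg[OF assms]] by simp
qed

lemma rcut_orbit_core_limit: assumes "c < Q" shows "\<not> unvisited ((f ^^ n) Q)"
proof -
  have "(f ^^ n) Q \<in> core_limit"
    unfolding core_limit_Inter
  proof
    fix x assume "x \<in> {x. core x}"
    then have x: "core x" by simp
    have "Q \<in> om x" by (rule good_omega_Q) (use x in \<open>auto simp: core_def\<close>)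
    then show "(f ^^ n) Q \<in> om x"
      by (rule omega_forward_iter[OF core_reg[OF x] _ reg_free[OF rcut_regular[OF assms]]])
  qed
  then show ?thesis by (simp add: core_limit_def)
qed

text \<open>
  A branch of \<open>f ^^ n\<close> around a core point can only end on the left at an image of \<open>c\<close> from the right. If
  \<open>Q = c\<close>, every core orbit follows such an image, so it belongs to all limit sets. If \<open>c < Q\<close>, the
  branch contains a preimage of \<open>Q\<close> and \<open>Q\<close> plays the same part.
\<close>

lemma extend_left:
  assumes x: "core x" and T: "max_at n t x s"
    and w: "0 \<le> b" "b < w" "w < (f ^^ n) x"
    and B: "\<And>y. b < y \<Longrightarrow> y \<le> (f ^^ n) x \<Longrightarrow> unvisited y"
  obtains y where "t < y" "y < x" "(f ^^ n) y = w"
proof -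
  have b: "br n t s" "t < x" "x < s" using T by (auto simp: max_at_def)
  have rx: "reg x" using x by (rule core_reg)
  have "\<exists>v. t < v \<and> v < x \<and> (f ^^ n) v \<le> w"
  proof (cases "t = 0")
    case True
    have "fr n z" if "0 \<le> z" "z \<le> x" for z
      using branch_free[OF b(1), of z n] that b True free_0[of n] by (cases "z = 0") auto
    moreover have "(f ^^ n) 0 \<le> w" "w \<le> (f ^^ n) x" "x \<le> 1" using w reg_inner[OF rx] by (auto simp: iter_0)
    ultimately obtain z where z: "0 \<le> z" "z \<le> x" "(f ^^ n) z = w"
      using iter_ivt[of 0 x n w] reg_inner[OF rx] by (metis less_imp_le order_refl)
    then have "z \<noteq> 0" "z \<noteq> x" using w by (auto simp: iter_0)
    then show ?thesis using z True by (intro exI[of _ z]) auto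
  next
    case False
    then obtain j where t0: "0 < t" and j: "j < n" "ct j t" using T by (auto simp: max_at_def)
    note ivt = left_cut_ivt[OF b(1) t0 j(2) less_imp_le[OF j(1)]]
    have push: "(f ^^ n) z = (f ^^ (n - j)) ((f ^^ j) z)" for z using j(1) by (simp add: funpow_plus)
    have cj: "c < (f ^^ j) x" by (rule left_cut_above[OF b(1) t0 j(2) _ b(2,3)]) (use j in simp)
    then have Qj: "Q \<le> (f ^^ j) x" using x by (force simp: core_def)
    show ?thesis
    proof (rule ccontr)
      assume "\<not> ?thesis"
      then have above: "w < (f ^^ n) v" if "t < v" "v < x" for v using that by force
      have up: "(f ^^ n) v < (f ^^ n) x" if "t < v" "v < x" for v
        by (rule branch_mono[OF b(1) order_refl that b(3)])
      show False
      proof (cases "c < Q")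
        case True
        obtain v where v: "t < v" "v \<le> x" "(f ^^ j) v = Q" using ivt[OF b(2,3) True Qj] .
        have "unvisited ((f ^^ n) v)"
          using above[of v] up[of v] v B w by (cases "v = x") auto
        then show False using rcut_orbit_core_limit[OF True, of "n - j"] push[of v] v by simp
      next
        case False
        then have Qc: "Q = c" using rcut_bounds by simp
        define u where "u = Inf ((f ^^ n) ` {t<..<x})"
        have bdd: "bdd_below ((f ^^ n) ` {t<..<x})" by (rule bdd_belowI[of _ w]) (use above in force)
        have ne: "(f ^^ n) ` {t<..<x} \<noteq> {}" using b by simp
        have wu: "w \<le> u" unfolding u_def by (rule cInf_greatest[OF ne]) (use above in force)
        have ule: "u \<le> (f ^^ n) v" if "t < v" "v < x" for v
          unfolding u_def by (rule cInf_lower[OF _ bdd]) (use that in auto)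
        have "u \<le> (f ^^ n) x" using ule[of "(t + x) / 2"] up[of "(t + x) / 2"] b by simp
        then have "unvisited u" using B wu w by simp
        moreover have "visits {u - e<..<u + e} x'" if x': "core x'" and e: "0 < e" for x' e
        proof -
          obtain v0 where v0: "t < v0" "v0 < x" "(f ^^ n) v0 < u + e"
            using cInf_lessD[OF ne, of "u + e"] e unfolding u_def by auto
          have v0s: "v0 < s" using v0 b by simp
          have c0: "c < (f ^^ j) v0" by (rule left_cut_above[OF b(1) t0 j(2) _ v0(1) v0s]) (use j in simp)
          have vis: "visits {c<..<(f ^^ j) v0} x'" using core_good[OF x'] c0 Qc by (simp add: good_def)
          show ?thesis unfolding visits_def
          proof
            fix N
            obtain i where i: "i \<ge> N" "c < (f ^^ i) x'" "(f ^^ i) x' < (f ^^ j) v0"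
              using vis unfolding visits_def by auto
            obtain v where v: "t < v" "v \<le> v0" "(f ^^ j) v = (f ^^ i) x'"
              using ivt[OF v0(1) v0s i(2) less_imp_le[OF i(3)]] .
            have "(f ^^ n) v \<le> (f ^^ n) v0"
              using branch_mono[OF b(1) order_refl v(1), of v0] v v0s by (cases "v = v0") auto
            moreover have "u \<le> (f ^^ n) v" using ule[of v] v v0 by simp
            moreover have "(f ^^ n) v = (f ^^ (i + (n - j))) x'" using push[of v] v by (simp add: funpow_plus)
            ultimately show "\<exists>i\<ge>N. (f ^^ i) x' \<in> {u - e<..<u + e}"
              using v0 e i by (intro exI[of _ "i + (n - j)"]) auto
          qed
        qed
        ultimately show False unfolding unvisited_def by blast
      qed
    qed
  qed
  then obtain v where v: "t < v" "v < x" "(f ^^ n) v \<le> w" by blast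
  obtain y where "v \<le> y" "y \<le> x" "(f ^^ n) y = w"
    using branch_ivt[OF b(1) v(1) less_imp_le[OF v(2)] b(3) order_refl v(3)] w by auto
  moreover from this have "y \<noteq> x" using w by auto
  ultimately show thesis using that[of y] v by auto
qed

end

lemma (in lorenz_dyn) visits_reflect:
  "lorenz_dyn.visits (reflect f) {a<..<b} x \<longleftrightarrow> visits {1 - b<..<1 - a} (1 - x)"
proof -
  interpret R: lorenz_dyn "reflect f" "1 - c" by (rule reflect_dyn)
  have "1 - z \<in> {a<..<b} \<longleftrightarrow> z \<in> {1 - b<..<1 - a}" for z by auto
  then show ?thesis by (simp add: R.visits_def visits_def funpow_reflect)
qed

lemma (in lorenz_dyn) good_reflect: "lorenz_dyn.good (reflect f) (1 - c) (1 - x) \<longleftrightarrow> good x"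
proof -
  interpret R: lorenz_dyn "reflect f" "1 - c" by (rule reflect_dyn)
  have "(\<forall>w>1 - L. visits {1 - w<..<c} x) \<longleftrightarrow> (\<forall>w<L. visits {w<..<c} x)"
  proof (intro iffI allI impI)
    fix w assume H: "\<forall>w>1 - L. visits {1 - w<..<c} x" "w < L"
    then have "visits {1 - (1 - w)<..<c} x" by (intro H(1)[rule_format]) simp
    then show "visits {w<..<c} x" by simp
  qed auto
  moreover have "(\<forall>w<1 - Q. visits {c<..<1 - w} x) \<longleftrightarrow> (\<forall>w>Q. visits {c<..<w} x)"
  proof (intro iffI allI impI)
    fix w assume H: "\<forall>w<1 - Q. visits {c<..<1 - w} x" "Q < w"
    then have "visits {c<..<1 - (1 - w)} x" by (intro H(1)[rule_format]) simp
    then show "visits {c<..<w} x" by simp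
  qed auto
  ultimately show ?thesis
    by (auto simp: R.good_def good_def regular_reflect rcut_reflect lcut_reflect visits_reflect)
qed

lemma (in lorenz_dyn) core_reflect: "lorenz_dyn.core (reflect f) (1 - c) (1 - x) \<longleftrightarrow> core x"
proof -
  interpret R: lorenz_dyn "reflect f" "1 - c" by (rule reflect_dyn)
  show ?thesis
    unfolding R.core_def core_def by (auto simp: good_reflect funpow_reflect rcut_reflect lcut_reflect)
qed

lemma (in lorenz_dyn) unvisited_reflect:
  assumes "unvisited (1 - y)" shows "lorenz_dyn.unvisited (reflect f) (1 - c) y"
proof -
  interpret R: lorenz_dyn "reflect f" "1 - c" by (rule reflect_dyn)
  obtain x e where x: "core x" "0 < e" "\<not> visits {1 - y - e<..<1 - y + e} x"
    using assms unfolding unvisited_def by blast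
  have "{1 - y - e<..<1 - y + e} = {1 - (y + e)<..<1 - (y - e)}" by (simp add: algebra_simps)
  then have "\<not> R.visits {y - e<..<y + e} (1 - x)" using x(3) visits_reflect[of "y - e" "y + e" "1 - x"] by simp
  moreover have "R.core (1 - x)" using x(1) core_reflect by simp
  ultimately show ?thesis unfolding R.unvisited_def using x(2) by blast
qed

context lorenz_dyn
begin

lemma extend_right:
  assumes x: "core x" and T: "max_at n t x s"
    and w: "b \<le> 1" "w < b" "(f ^^ n) x < w"
    and B: "\<And>y. y < b \<Longrightarrow> (f ^^ n) x \<le> y \<Longrightarrow> unvisited y"
  obtains y where "x < y" "y < s" "(f ^^ n) y = w"
proof -
  interpret R: lorenz_dyn "reflect f" "1 - c" by (rule reflect_dyn)
  have "R.core (1 - x)" using x core_reflect by simp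
  moreover have "R.max_at n (1 - s) (1 - x) (1 - t)"
    using T by (auto simp: R.max_at_def max_at_def branch_reflect cut_reflect)
  moreover have "R.unvisited y" if "1 - b < y" "y \<le> (reflect f ^^ n) (1 - x)" for y
    using B[of "1 - y"] that by (intro unvisited_reflect) (simp add: funpow_reflect)
  ultimately obtain y where "1 - s < y" "y < 1 - x" "(reflect f ^^ n) y = 1 - w"
    using R.extend_left[of "1 - x" n "1 - s" "1 - t" "1 - b" "1 - w"] w by (auto simp: funpow_reflect)
  then show thesis using that[of "1 - y"] by (simp add: funpow_reflect)
qed

text \<open>
  Room on the right bounds the slope of \<open>f ^^ n\<close>: the cross-ratio of the pair \<open>[u, p']\<close>, \<open>[v, p]\<close>, in
  which \<open>[u, v]\<close> is one of the outer intervals, does not decrease.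
\<close>

lemma koebe_right:
  assumes b: "br n t s" "t < u" "u < v" "v < p" "p < p'" "p' < s"
    and l: "0 < l" "l \<le> (f ^^ n) p' - (f ^^ n) p"
  shows "l * (p - v) * ((f ^^ n) v - (f ^^ n) u) \<le> v - u"
proof -
  let ?u = "(f ^^ n) u" and ?v = "(f ^^ n) v" and ?p = "(f ^^ n) p" and ?p' = "(f ^^ n) p'"
  have m: "?u < ?v" "?v < ?p" "?p < ?p'" using b by (auto intro!: branch_mono[OF b(1) order_refl])
  have r: "0 < ?u" "?p' < 1" using branch_inner[OF b(1), of u n] branch_inner[OF b(1), of p' n] b by auto
  have "cross_ratio u v p p' \<le> cross_ratio ?u ?v ?p ?p'" by (rule branch_cross[OF b])
  also have "\<dots> \<le> 1 / ((?v - ?u) * l)"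
    unfolding cross_ratio_def
  proof (rule frac_le)
    show "(?p' - ?u) * (?p - ?v) \<le> 1" using m r by (intro mult_le_one) auto
    show "(?v - ?u) * l \<le> (?v - ?u) * (?p' - ?p)" using l m by (intro mult_left_mono) auto
  qed (use l m in auto)
  finally have "(p' - u) * (p - v) / ((v - u) * (p' - p)) \<le> 1 / ((?v - ?u) * l)" by (simp add: cross_ratio_def)
  moreover have "0 < (v - u) * (p' - p)" "0 < (?v - ?u) * l" using b m l by auto
  ultimately have "(p' - u) * (p - v) * ((?v - ?u) * l) \<le> (v - u) * (p' - p)"
    by (simp add: pos_divide_le_eq pos_le_divide_eq)
  also have "\<dots> \<le> (v - u) * (p' - u)" using b by (intro mult_left_mono) auto
  finally have "(p' - u) * (l * (p - v) * (?v - ?u)) \<le> (p' - u) * (v - u)" by (simp add: algebra_simps)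
  then show ?thesis using b by (auto simp: mult_le_cancel_left)
qed

lemma koebe_left:
  assumes b: "br n t s" "t < p'" "p' < p" "p < u" "u < v" "v < s"
    and l: "0 < l" "l \<le> (f ^^ n) p - (f ^^ n) p'"
  shows "l * (u - p) * ((f ^^ n) v - (f ^^ n) u) \<le> v - u"
proof -
  interpret R: lorenz_dyn "reflect f" "1 - c" by (rule reflect_dyn)
  show ?thesis
    using R.koebe_right[of n "1 - s" "1 - t" "1 - v" "1 - u" "1 - p" "1 - p'" l] b l
    by (simp add: branch_reflect funpow_reflect)
qed

text \<open>
  The interval \<open>(a1, a2)\<close> is the window; the collar up to \<open>b1\<close> and \<open>b2\<close> provides the room for distortion bounds.
\<close>

definition window :: "real \<Rightarrow> real \<Rightarrow> real \<Rightarrow> real \<Rightarrow> bool" where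
  "window b1 a1 a2 b2 \<longleftrightarrow> 0 \<le> b1 \<and> b1 < a1 \<and> a1 < a2 \<and> a2 < b2 \<and> b2 \<le> 1 \<and> (\<forall>y. b1 < y \<and> y < b2 \<longrightarrow> unvisited y)"

text \<open>
  The four points are the preimages, under one branch of \<open>f ^^ n\<close>, of the window and of the middle of its collar.
\<close>

lemma window_pullback:
  assumes W: "window b1 a1 a2 b2" and x: "core x" and n: "a1 < (f ^^ n) x" "(f ^^ n) x < a2"
  obtains t s p1 p2 p3 p4 where "max_at n t x s" "br n t s" "t < p1" "p1 < p2" "p2 < x" "x < p3" "p3 < p4" "p4 < s"
    "(f ^^ n) p1 = (b1 + a1) / 2" "(f ^^ n) p2 = a1" "(f ^^ n) p3 = a2" "(f ^^ n) p4 = (a2 + b2) / 2"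
proof -
  obtain t s where T: "max_at n t x s" using max_at_exists[OF core_reg[OF x]] .
  then have b: "br n t s" "t < x" "x < s" by (auto simp: max_at_def)
  have U: "unvisited y" if "b1 < y" "y < b2" for y using W that by (simp add: window_def)
  have w: "0 \<le> b1" "b1 < a1" "a2 < b2" "b2 \<le> 1" using W by (auto simp: window_def)
  have left: "\<exists>y. t < y \<and> y < x \<and> (f ^^ n) y = z" if "b1 < z" "z < (f ^^ n) x" for z
    using extend_left[OF x T w(1) that] U n w by (metis order.strict_trans order_le_less_trans)
  have right: "\<exists>y. x < y \<and> y < s \<and> (f ^^ n) y = z" if "(f ^^ n) x < z" "z < b2" for z
    using extend_right[OF x T w(4) that(2,1)] U n w by (metis order.strict_trans order_less_le_trans)
  have mono: "u < v" if "t < u" "u < s" "t < v" "v < s" "(f ^^ n) u < (f ^^ n) v" for u v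
    using branch_mono[OF b(1) order_refl, of v u] that by (cases u v rule: linorder_cases) auto
  obtain p1 where p1: "t < p1" "p1 < x" "(f ^^ n) p1 = (b1 + a1) / 2" using left[of "(b1 + a1) / 2"] n w by auto
  obtain p2 where p2: "t < p2" "p2 < x" "(f ^^ n) p2 = a1" using left[of a1] n w by auto
  obtain p3 where p3: "x < p3" "p3 < s" "(f ^^ n) p3 = a2" using right[of a2] n w by auto
  obtain p4 where p4: "x < p4" "p4 < s" "(f ^^ n) p4 = (a2 + b2) / 2" using right[of "(a2 + b2) / 2"] n w by auto
  have "p1 < p2" using mono[of p1 p2] p1 p2 b w by simp
  moreover have "p3 < p4" using mono[of p3 p4] p3 p4 b w by simp
  ultimately show thesis using that[OF T b(1) p1(1) _ p2(2) p3(1) _ p4(2)] p1 p2 p3 p4 by simp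
qed

text \<open>
  On a homterval ending at \<open>x\<close> the images become arbitrarily short. At the times when \<open>x\<close> is in the window,
  the images have room on both sides, so their cross-ratio tends to zero; but it cannot drop
  below the length of the homterval.
\<close>

lemma returns_not_hom_left:
  assumes W: "window b1 a1 a2 b2" and x: "core x" "visits {a1<..<a2} x"
    and u: "0 < u" "u < x" "\<And>y. u \<le> y \<Longrightarrow> y < x \<Longrightarrow> reg y"
  shows False
proof -
  define l1 where "l1 = (a1 - b1) / 2"
  define l2 where "l2 = (b2 - a2) / 2"
  have l: "0 < l1" "0 < l2" using W by (auto simp: window_def l1_def l2_def)
  have lim: "(\<lambda>n. (f ^^ n) x - (f ^^ n) u) \<longlonglongrightarrow> 0"
    by (rule lengths_tendsto_0[OF u(2)]) (use u core_reg[OF x(1)] in \<open>force simp: le_less\<close>)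
  have small: "0 < min (l1 / 2) ((x - u) * (l1 / 2 * l2))" using u l by simp
  obtain N where N: "\<And>n. n \<ge> N \<Longrightarrow> (f ^^ n) x - (f ^^ n) u < min (l1 / 2) ((x - u) * (l1 / 2 * l2))"
    using order_tendstoD(2)[OF lim small] unfolding eventually_sequentially by blast
  obtain n where n: "n \<ge> N" "a1 < (f ^^ n) x" "(f ^^ n) x < a2" using x(2) unfolding visits_def by auto
  obtain t s p1 p2 p3 p4 where T: "max_at n t x s" and
    p: "br n t s" "t < p1" "p1 < p2" "p2 < x" "x < p3" "p3 < p4" "p4 < s"
    "(f ^^ n) p1 = (b1 + a1) / 2" "(f ^^ n) p2 = a1" "(f ^^ n) p3 = a2" "(f ^^ n) p4 = (a2 + b2) / 2"
    using window_pullback[OF W x(1) n(2,3)] .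
  let ?a = "(f ^^ n) p1" and ?b = "(f ^^ n) u" and ?d = "(f ^^ n) x" and ?e = "(f ^^ n) p4"
  have del: "?d - ?b < l1 / 2" "?d - ?b < (x - u) * (l1 / 2 * l2)" using N[OF n(1)] by auto
  have tu: "t < u"
  proof (rule ccontr)
    assume "\<not> t < u"
    then have "u \<le> t" "t < x" using T by (auto simp: max_at_def)
    then have "reg t" "t \<noteq> 0" using u by auto
    then show False using T cut_not_reg by (auto simp: max_at_def)
  qed
  have xs: "x < s" using p by simp
  have da: "l1 / 2 \<le> ?b - ?a" using del(1) n(2) p(8) by (simp add: l1_def field_simps)
  have pu: "p1 < u"
  proof (rule ccontr)
    assume "\<not> p1 < u"
    then have "?b \<le> ?a" using branch_mono[OF p(1) order_refl tu, of p1] p by (cases "u = p1") auto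
    then show False using da l by simp
  qed
  have xp: "x < p4" using p by simp
  have mon: "?b < ?d" "?d < ?e" using branch_mono[OF p(1) order_refl] tu u xs xp p by auto
  have de: "l2 \<le> ?e - ?d" using n(3) p(11) by (simp add: l2_def field_simps)
  have r: "0 < ?a" "?e < 1" using branch_inner[OF p(1), of p1 n] branch_inner[OF p(1), of p4 n] p by auto
  have "cross_ratio p1 u x p4 \<le> cross_ratio ?a ?b ?d ?e"
    by (rule branch_cross[OF p(1,2) pu u(2) xp p(7)])
  also have "\<dots> \<le> (?d - ?b) / (l1 / 2 * l2)"
    unfolding cross_ratio_def
  proof (rule frac_le)
    show "(?e - ?a) * (?d - ?b) \<le> ?d - ?b" using mon r by (intro mult_left_le_one_le) (use da l in auto)
    show "l1 / 2 * l2 \<le> (?b - ?a) * (?e - ?d)" using l da de by (intro mult_mono) auto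
  qed (use l mon in auto)
  also have "\<dots> < x - u" using del(2) l by (simp add: pos_divide_less_eq)
  finally have "(p4 - p1) * (x - u) / ((u - p1) * (p4 - x)) < x - u" by (simp add: cross_ratio_def)
  moreover have "0 < (u - p1) * (p4 - x)" using pu xp by simp
  ultimately have "(p4 - p1) * (x - u) < (x - u) * ((u - p1) * (p4 - x))" by (simp add: pos_divide_less_eq)
  also have "\<dots> \<le> (x - u) * (p4 - x)"
  proof (rule mult_left_mono)
    have "u - p1 \<le> 1" using branchD[OF p(1)] p u reg_inner[OF core_reg[OF x(1)]] by simp
    then show "(u - p1) * (p4 - x) \<le> p4 - x" using pu xp by (intro mult_left_le_one_le) auto
  qed (use u in simp)
  also have "\<dots> \<le> (x - u) * (p4 - p1)" using u pu by (intro mult_left_mono) auto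
  finally show False by (simp add: mult.commute)
qed

lemma window_reflect:
  assumes "window b1 a1 a2 b2"
  shows "lorenz_dyn.window (reflect f) (1 - c) (1 - b2) (1 - a2) (1 - a1) (1 - b1)"
proof -
  interpret R: lorenz_dyn "reflect f" "1 - c" by (rule reflect_dyn)
  have "R.unvisited y" if "1 - b2 < y" "y < 1 - b1" for y
    by (rule unvisited_reflect) (use that assms in \<open>auto simp: window_def\<close>)
  then show ?thesis using assms by (simp add: R.window_def window_def)
qed

lemma returns_not_hom_right:
  assumes W: "window b1 a1 a2 b2" and x: "core x" "visits {a1<..<a2} x"
    and u: "u < 1" "x < u" "\<And>y. x < y \<Longrightarrow> y \<le> u \<Longrightarrow> reg y"
  shows False
proof -
  interpret R: lorenz_dyn "reflect f" "1 - c" by (rule reflect_dyn)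
  show ?thesis
  proof (rule R.returns_not_hom_left[OF window_reflect[OF W]])
    show "R.core (1 - x)" using x core_reflect by simp
    show "R.visits {1 - a2<..<1 - a1} (1 - x)" using x(2) visits_reflect[of "1 - a2" "1 - a1" "1 - x"] by simp
    show "0 < 1 - u" "1 - u < 1 - x" using u by auto
    show "R.reg y" if "1 - u \<le> y" "y < 1 - x" for y
      using u(3)[of "1 - y"] that by (simp add: regular_reflect)
  qed
qed

text \<open>Branches around a point that keeps returning to a window shrink to the point.\<close>

lemma returns_shrink:
  assumes W: "window b1 a1 a2 b2" and x: "core x" "visits {a1<..<a2} x" and e: "0 < e"
  shows "\<exists>N. \<forall>n\<ge>N. \<forall>t s. br n t s \<longrightarrow> t < x \<longrightarrow> x < s \<longrightarrow> x - e < t \<and> s < x + e"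
proof -
  have rx: "reg x" using x(1) by (rule core_reg)
  obtain l where l: "0 < l" "l \<le> x" "\<And>y. l < y \<Longrightarrow> y < x \<Longrightarrow> reg y"
    "\<And>e. 0 < e \<Longrightarrow> \<exists>N. \<forall>n\<ge>N. \<forall>t s. br n t s \<longrightarrow> t < x \<longrightarrow> x < s \<longrightarrow> l - e < t \<and> 0 < t"
  proof (rule left_shrink[OF rx], goal_cases)
    case (1 l) show ?case by (rule that) (fact 1)+
  qed
  have "l = x"
  proof (rule ccontr)
    assume "l \<noteq> x"
    then have "0 < (l + x) / 2" "(l + x) / 2 < x" "\<And>y. (l + x) / 2 \<le> y \<Longrightarrow> y < x \<Longrightarrow> reg y"
      using l by auto
    then show False using returns_not_hom_left[OF W x] by blast
  qed
  then obtain N1 where N1: "\<And>n t s. n \<ge> N1 \<Longrightarrow> br n t s \<Longrightarrow> t < x \<Longrightarrow> x < s \<Longrightarrow> x - e < t"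
    using l(4)[OF e] by blast
  obtain r where r: "r < 1" "x \<le> r" "\<And>y. x < y \<Longrightarrow> y < r \<Longrightarrow> reg y"
    "\<And>e. 0 < e \<Longrightarrow> \<exists>N. \<forall>n\<ge>N. \<forall>t s. br n t s \<longrightarrow> t < x \<longrightarrow> x < s \<longrightarrow> s < r + e \<and> s < 1"
  proof (rule right_shrink[OF rx], goal_cases)
    case (1 l) show ?case by (rule that) (fact 1)+
  qed
  have "r = x"
  proof (rule ccontr)
    assume "r \<noteq> x"
    then have "(r + x) / 2 < 1" "x < (r + x) / 2" "\<And>y. x < y \<Longrightarrow> y \<le> (r + x) / 2 \<Longrightarrow> reg y"
      using r by auto
    then show False using returns_not_hom_right[OF W x] by blast
  qed
  then obtain N2 where N2: "\<And>n t s. n \<ge> N2 \<Longrightarrow> br n t s \<Longrightarrow> t < x \<Longrightarrow> x < s \<Longrightarrow> s < x + e"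
    using r(4)[OF e] by blast
  show ?thesis
  proof (intro exI[of _ "max N1 N2"] allI impI)
    fix n t s assume "max N1 N2 \<le> n" "br n t s" "t < x" "x < s"
    then show "x - e < t \<and> s < x + e" using N1[of n t s] N2[of n t s] by simp
  qed
qed

definition vis :: "real set \<Rightarrow> real set" where
  "vis S = {x. reg x \<and> visits S x}"

lemma vis_borel: assumes "open S" shows "vis S \<in> sets borel"
proof -
  let ?E = "\<lambda>n. {x. 0 < x \<and> x < 1 \<and> fr n x}"
  have oE: "open (?E n)" for n by (rule open_branch_set)
  have o: "open (?E n \<inter> (f ^^ n) -` S)" for n
  proof -
    have "continuous_on (?E n) (f ^^ n)" by (rule iter_cont_on) auto
    then show ?thesis using continuous_open_preimage oE assms by blast
  qed
  have "vis S = (\<Inter>n. ?E n) \<inter> (\<Inter>N. \<Union>n\<in>{N..}. ?E n \<inter> (f ^^ n) -` S)"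
  proof (intro set_eqI iffI)
    fix x assume "x \<in> vis S"
    then show "x \<in> (\<Inter>n. ?E n) \<inter> (\<Inter>N. \<Union>n\<in>{N..}. ?E n \<inter> (f ^^ n) -` S)"
      using reg_inner[of x] reg_free[of x] by (auto simp: vis_def visits_def)
  next
    fix x assume x: "x \<in> (\<Inter>n. ?E n) \<inter> (\<Inter>N. \<Union>n\<in>{N..}. ?E n \<inter> (f ^^ n) -` S)"
    have "(f ^^ n) x \<noteq> c" for n
    proof -
      have "fr (Suc n) x" using x by blast
      then show ?thesis by (simp add: free_Suc)
    qed
    moreover have "0 < x" "x < 1" using x by blast+
    ultimately show "x \<in> vis S" using x by (auto simp: vis_def visits_def regular_def)
  qed
  moreover have "(\<Inter>n. ?E n) \<inter> (\<Inter>N. \<Union>n\<in>{N..}. ?E n \<inter> (f ^^ n) -` S) \<in> sets borel"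
    using oE o by (intro sets.Int sets.countable_INT'' sets.countable_UN' borel_open) auto
  ultimately show ?thesis by simp
qed

lemma vis_iter: assumes "0 < x" "x < 1" "fr n x" shows "(f ^^ n) x \<in> vis S \<longleftrightarrow> x \<in> vis S"
proof -
  have "reg ((f ^^ n) x) \<longleftrightarrow> reg x" using irregular_iter assms reg_iter by blast
  then show ?thesis by (simp add: vis_def visits_iter)
qed

text \<open>
  Suppose that a compact set \<open>D\<close> of positive measure in the window is missed. At each return of \<open>x\<close> to the window the
  pullback of \<open>D\<close> is, by bounded distortion, a definite proportion of the small interval \<open>[p2, p3]\<close>
  around \<open>x\<close>, and it is disjoint from the invariant set \<open>vis S\<close>.
\<close>

lemma window_density:
  assumes W: "window b1 a1 a2 b2" and S: "open S"
    and pos: "\<not> negligible ({x. core x \<and> visits {a1<..<a2} x} \<inter> vis S)"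
  shows "negligible ({a1<..<a2} - vis S)"
proof (rule ccontr)
  let ?A = "{x. core x \<and> visits {a1<..<a2} x} \<inter> vis S"
  assume nn: "\<not> negligible ({a1<..<a2} - vis S)"
  define l1 where "l1 = (a1 - b1) / 2"
  define l2 where "l2 = (b2 - a2) / 2"
  define l where "l = min l1 l2"
  have l12: "0 < l1" "0 < l2" "l1 \<le> 1" using W by (auto simp: window_def l1_def l2_def)
  then have l: "0 < l" "l \<le> l1" "l \<le> l2" by (auto simp: l_def)
  have a01: "0 \<le> a1" "a2 \<le> 1" using W by (auto simp: window_def)
  define D0 where "D0 = {a1<..<a2} - vis S"
  have D0l: "D0 \<in> lmeasurable"
    unfolding D0_def by (rule fmeasurable_Diff) (use vis_borel[OF S] in auto)
  have "measure lebesgue D0 > 0"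
    using nn D0l by (simp add: negligible_iff_measure D0_def zero_less_measure_iff)
  obtain D where D: "closed D" "D \<subseteq> D0" "D0 - D \<in> lmeasurable"
    "emeasure lebesgue (D0 - D) < ennreal (measure lebesgue D0)"
    using sets_lebesgue_inner_closed[of D0 "measure lebesgue D0"] D0l \<open>measure lebesgue D0 > 0\<close>
    by (auto simp: fmeasurable_def)
  have "bounded D" using D(2) by (rule bounded_subset[rotated]) (auto simp: D0_def intro: bounded_subset[OF bounded_closed_interval[of a1 a2]])
  then have Dc: "compact D" using D(1) by (simp add: compact_eq_bounded_closed)
  have mD: "0 < measure lebesgue D"
  proof -
    have "measure lebesgue (D0 - D) < measure lebesgue D0"
      using D(3,4) by (simp add: emeasure_eq_measure2 ennreal_less_iff)
    moreover have "measure lebesgue (D0 - D) = measure lebesgue D0 - measure lebesgue D"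
      using D0l D(2) lmeasurable_compact[OF Dc] by (intro measurable_measure_Diff) (auto simp: fmeasurable_def)
    ultimately show ?thesis by simp
  qed
  \<comment> \<open>the slope of the branch on \<open>[p2, p3]\<close> is at most \<open>2 / (l * (p3 - p2))\<close>\<close>
  define k where "k = measure lebesgue D * l / 2"
  have k: "0 < k" using mD l by (simp add: k_def)
  have "negligible ?A"
  proof (rule porous_negligible[OF k])
    show "?A \<subseteq> {0..1}" using reg_inner by (force simp: vis_def)
    fix x e assume xA: "x \<in> ?A" and e: "0 < (e::real)"
    then have x: "core x" "visits {a1<..<a2} x" by auto
    have "0 < e / 2" using e by simp
    then obtain N where N: "\<forall>n\<ge>N. \<forall>t s. br n t s \<longrightarrow> t < x \<longrightarrow> x < s \<longrightarrow> x - e / 2 < t \<and> s < x + e / 2"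
      using returns_shrink[OF W x] by blast
    obtain n where n: "n \<ge> N" "a1 < (f ^^ n) x" "(f ^^ n) x < a2" using x(2) unfolding visits_def by auto
    obtain t s p1 p2 p3 p4 where T: "max_at n t x s" and
      p: "br n t s" "t < p1" "p1 < p2" "p2 < x" "x < p3" "p3 < p4" "p4 < s"
      "(f ^^ n) p1 = (b1 + a1) / 2" "(f ^^ n) p2 = a1" "(f ^^ n) p3 = a2" "(f ^^ n) p4 = (a2 + b2) / 2"
      using window_pullback[OF W x(1) n(2,3)] .
    have "t < x" "x < s" using p by auto
    then have ts: "x - e / 2 < t" "s < x + e / 2" using N n(1) p(1) by blast+
    have fl: "l \<le> (f ^^ n) p2 - (f ^^ n) p1" "l \<le> (f ^^ n) p4 - (f ^^ n) p3"
      using l p by (auto simp: l1_def l2_def field_simps)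
    define G where "G = {y \<in> {p2..p3}. (f ^^ n) y \<in> D}"
    have inT: "t < y \<and> y < s" if "y \<in> {p2..p3}" for y using that p by auto
    have cts: "continuous_on {p2..p3} (f ^^ n)"
    proof (rule iter_cont_on)
      show "{p2..p3} \<subseteq> {0..1}" using branchD(1,3)[OF p(1)] p by auto
      show "fr n z" if "z \<in> {p2..p3}" for z using branch_free[OF p(1) _ _ order_refl, of z] inT[OF that] by simp
    qed
    have "closed G"
    proof -
      have "closed ({p2..p3} \<inter> (f ^^ n) -` D)" by (rule continuous_closed_preimage[OF cts _ D(1)]) simp
      moreover have "G = {p2..p3} \<inter> (f ^^ n) -` D" by (auto simp: G_def)
      ultimately show ?thesis by simp
    qed
    then have "compact ({p2..p3} \<inter> G)" by (intro compact_Int_closed) auto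
    moreover have "{p2..p3} \<inter> G = G" by (auto simp: G_def)
    ultimately have Gc: "compact G" by simp
    have img: "(f ^^ n) ` G = D"
    proof
      show "D \<subseteq> (f ^^ n) ` G"
      proof
        fix w assume w: "w \<in> D"
        then have "a1 < w" "w < a2" using D(2) by (auto simp: D0_def)
        then obtain y where "p2 \<le> y" "y \<le> p3" "(f ^^ n) y = w"
          using branch_ivt[OF p(1), of p2 p3 n w] p by auto
        then show "w \<in> (f ^^ n) ` G" using w by (auto simp: G_def)
      qed
    qed (auto simp: G_def)
    have GI: "p2 < y \<and> y < p3" if "y \<in> G" for y
    proof -
      have "(f ^^ n) y \<noteq> a1" "(f ^^ n) y \<noteq> a2" using that D(2) by (auto simp: G_def D0_def)
      then have "y \<noteq> p2" "y \<noteq> p3" using p by auto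
      then show ?thesis using that by (auto simp: G_def)
    qed
    have "inj_on (f ^^ n) G"
    proof (rule inj_onI)
      fix u v assume "u \<in> G" "v \<in> G" "(f ^^ n) u = (f ^^ n) v"
      then show "u = v" using inT branch_mono[OF p(1) order_refl, of u v] branch_mono[OF p(1) order_refl, of v u]
        by (cases u v rule: linorder_cases) (auto simp: G_def)
    qed
    moreover have "\<exists>d. ((f ^^ n) has_real_derivative d) (at y) \<and> \<bar>d\<bar> \<le> 2 / (l * (p3 - p2))" if "y \<in> G" for y
    proof -
      have y: "p2 < y" "y < p3" using GI[OF that] by auto
      obtain d where d: "0 < d" "((f ^^ n) has_real_derivative d) (at y)"
        using iter_deriv[of y n] branch_free[OF p(1), of y n] branchD[OF p(1)] inT[of y] y by auto
      have lim: "((\<lambda>z. ((f ^^ n) z - (f ^^ n) y) / (z - y)) \<longlongrightarrow> d) (at y)"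
        using d(2) by (simp add: has_field_derivative_iff)
      have sl: "((f ^^ n) z - (f ^^ n) y) / (z - y) * (l * (p3 - z)) \<le> 1" if z: "y < z" "z < p3" for z
      proof -
        have "l * (p3 - z) * ((f ^^ n) z - (f ^^ n) y) \<le> z - y"
          by (rule koebe_right[OF p(1) _ z p(6,7) l(1) fl(2)]) (use y p in simp)
        then show ?thesis using z by (simp add: field_simps)
      qed
      have sr: "((f ^^ n) z - (f ^^ n) y) / (z - y) * (l * (y - p2)) \<le> 1" if z: "y < z" "z < p3" for z
      proof -
        have "l * (y - p2) * ((f ^^ n) z - (f ^^ n) y) \<le> z - y"
          by (rule koebe_left[OF p(1-3) y(1) z(1) _ l(1) fl(1)]) (use z p in simp)
        then show ?thesis using z by (simp add: field_simps)
      qed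
      \<comment> \<open>the bounds on difference quotients pass to the derivative\<close>
      have lr: "((\<lambda>z. ((f ^^ n) z - (f ^^ n) y) / (z - y)) \<longlongrightarrow> d) (at_right y)"
        using lim by (rule filterlim_mono) (auto simp: at_le)
      have ev: "\<forall>\<^sub>F z in at_right y. y < z \<and> z < p3"
        using y(2) eventually_at_right_real by (auto simp: eventually_at_right)
      have "d * (l * (p3 - y)) \<le> 1"
      proof (rule tendsto_upperbound)
        show "((\<lambda>z. ((f ^^ n) z - (f ^^ n) y) / (z - y) * (l * (p3 - z))) \<longlongrightarrow> d * (l * (p3 - y))) (at_right y)"
          by (intro tendsto_mult lr tendsto_const tendsto_diff tendsto_ident_at)
        show "\<forall>\<^sub>F z in at_right y. ((f ^^ n) z - (f ^^ n) y) / (z - y) * (l * (p3 - z)) \<le> 1"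
          using ev by (rule eventually_mono) (use sl in blast)
      qed simp
      moreover have "d * (l * (y - p2)) \<le> 1"
      proof (rule tendsto_upperbound)
        show "((\<lambda>z. ((f ^^ n) z - (f ^^ n) y) / (z - y) * (l * (y - p2))) \<longlongrightarrow> d * (l * (y - p2))) (at_right y)"
          by (intro tendsto_mult lr tendsto_const)
        show "\<forall>\<^sub>F z in at_right y. ((f ^^ n) z - (f ^^ n) y) / (z - y) * (l * (y - p2)) \<le> 1"
          using ev by (rule eventually_mono) (use sr in blast)
      qed simp
      ultimately have "d * (l * (p3 - p2)) \<le> 2" by (simp add: algebra_simps)
      then have "d \<le> 2 / (l * (p3 - p2))" using l y by (simp add: pos_le_divide_eq)
      then show ?thesis using d by (intro exI[of _ d]) auto
    qed
    then obtain g' where "\<And>y. y \<in> G \<Longrightarrow> ((f ^^ n) has_real_derivative g' y) (at y)"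
       "\<And>y. y \<in> G \<Longrightarrow> \<bar>g' y\<bar> \<le> 2 / (l * (p3 - p2))" by metis
    ultimately have "measure lebesgue ((f ^^ n) ` G) \<le> 2 / (l * (p3 - p2)) * measure lebesgue G"
      using measure_image_le[OF Gc] by blast
    then have big: "k * (p3 - p2) \<le> measure lebesgue G"
      using img l p by (simp add: k_def field_simps)
    have "G \<inter> ?A = {}"
    proof (rule ccontr)
      assume "G \<inter> ?A \<noteq> {}"
      then obtain y where y: "y \<in> G" "y \<in> vis S" by blast
      then have yr: "reg y" by (simp add: vis_def)
      have "(f ^^ n) y \<in> vis S" using vis_iter[of y n S] y yr reg_inner reg_free by blast
      then show False using y(1) D(2) by (auto simp: G_def D0_def)
    qed
    then show "\<exists>u v G. u \<le> x \<and> x \<le> v \<and> u < v \<and> v - u < e \<and> G \<in> lmeasurable \<and> G \<subseteq> {u..v} \<and>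
        G \<inter> ?A = {} \<and> k * (v - u) \<le> measure lebesgue G"
      using p ts big lmeasurable_compact[OF Gc]
      by (intro exI[of _ p2] exI[of _ p3] exI[of _ G]) (auto simp: G_def)
  qed
  then show False using pos by simp
qed

text \<open>
  If almost no orbit visited \<open>(a, b)\<close> infinitely often, almost every point that returns to the window would
  have a last visit. But by bounded distortion the pullbacks of \<open>(a, b)\<close> are a definite proportion of arbitrarily
  small intervals around it.
\<close>

lemma window_sub_positive:
  assumes W: "window b1 a1 a2 b2" and pos: "\<not> negligible {x. core x \<and> visits {a1<..<a2} x}"
    and ab: "a1 \<le> a" "a < b" "b \<le> a2"
  shows "\<not> negligible (vis {a<..<b})"
proof
  assume neg: "negligible (vis {a<..<b})"
  let ?E = "{x. core x \<and> visits {a1<..<a2} x}"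
  define EN where "EN N = {x \<in> ?E. \<forall>n\<ge>N. (f ^^ n) x \<notin> {a<..<b}}" for N
  define l1 where "l1 = (a1 - b1) / 2"
  define l2 where "l2 = (b2 - a2) / 2"
  define l where "l = min l1 l2"
  have l12: "0 < l1" "0 < l2" "l1 \<le> 1" using W by (auto simp: window_def l1_def l2_def)
  then have l: "0 < l" "l \<le> l1" "l \<le> l2" "l \<le> 1" by (auto simp: l_def)
  \<comment> \<open>the sum of the two one-sided slope bounds, with the length of \<open>[u, v]\<close> itself as the third term\<close>
  define k where "k = l * (b - a) / 3"
  have k: "0 < k" using l ab by (simp add: k_def)
  have "negligible (EN N)" for N
  proof (rule porous_negligible[OF k])
    show "EN N \<subseteq> {0..1}" using reg_inner core_reg by (force simp: EN_def)
    fix x e assume xE: "x \<in> EN N" and e: "0 < (e::real)"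
    then have x: "core x" "visits {a1<..<a2} x" by (auto simp: EN_def)
    have "0 < e / 2" using e by simp
    then obtain M where M: "\<forall>n\<ge>M. \<forall>t s. br n t s \<longrightarrow> t < x \<longrightarrow> x < s \<longrightarrow> x - e / 2 < t \<and> s < x + e / 2"
      using returns_shrink[OF W x] by blast
    obtain n where "n \<ge> max M N \<and> (f ^^ n) x \<in> {a1<..<a2}" using x(2) unfolding visits_def by blast
    then have n: "n \<ge> max M N" "a1 < (f ^^ n) x" "(f ^^ n) x < a2" by simp_all
    obtain t s p1 p2 p3 p4 where T: "max_at n t x s" and
      p: "br n t s" "t < p1" "p1 < p2" "p2 < x" "x < p3" "p3 < p4" "p4 < s"
      "(f ^^ n) p1 = (b1 + a1) / 2" "(f ^^ n) p2 = a1" "(f ^^ n) p3 = a2" "(f ^^ n) p4 = (a2 + b2) / 2"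
      using window_pullback[OF W x(1) n(2,3)] .
    have "t < x" "x < s" "n \<ge> M" using p n by auto
    then have ts: "x - e / 2 < t" "s < x + e / 2" using M p(1) by blast+
    have fl: "l \<le> (f ^^ n) p2 - (f ^^ n) p1" "l \<le> (f ^^ n) p4 - (f ^^ n) p3"
      using l p by (auto simp: l1_def l2_def field_simps)
    have tp: "t < p2" "p3 < s" "p2 \<le> p3" using p by auto
    obtain u where u: "p2 \<le> u" "u \<le> p3" "(f ^^ n) u = a"
      using branch_ivt[OF p(1) tp(1,3,2) order_refl, of a] p ab by auto
    obtain v where v: "p2 \<le> v" "v \<le> p3" "(f ^^ n) v = b"
      using branch_ivt[OF p(1) tp(1,3,2) order_refl, of b] p ab by auto
    have uv: "u < v"
    proof (rule ccontr)
      assume "\<not> u < v"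
      then have "b \<le> a" using branch_mono[OF p(1) order_refl, of v u] u v tp by (cases "u = v") auto
      then show False using ab by simp
    qed
    define J where "J = p3 - p2"
    define m where "m = v - u"
    have m: "l * (p3 - v) * (b - a) \<le> m" "l * (u - p2) * (b - a) \<le> m" "0 < m"
    proof -
      show "0 < m" using uv by (simp add: m_def)
      show "l * (p3 - v) * (b - a) \<le> m"
        using koebe_right[OF p(1), of u v p3 p4 l] u v uv p l fl \<open>0 < m\<close>
        by (cases "v = p3") (auto simp: m_def)
      show "l * (u - p2) * (b - a) \<le> m"
        using koebe_left[OF p(1), of p1 p2 u v l] u v uv p l fl \<open>0 < m\<close>
        by (cases "u = p2") (auto simp: m_def)
    qed
    have "l * (b - a) * J = l * (p3 - v) * (b - a) + l * (u - p2) * (b - a) + l * (b - a) * m"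
      by (simp add: J_def m_def algebra_simps)
    also have "\<dots> \<le> m + m + m"
    proof (intro add_mono m)
      have "b - a \<le> 1" using W ab by (simp add: window_def)
      then have "l * (b - a) \<le> 1" using l ab by (intro mult_le_one) auto
      then show "l * (b - a) * m \<le> m" using m(3) l ab by (intro mult_left_le_one_le) auto
    qed
    finally have big: "k * J \<le> m" by (simp add: k_def)
    have "{u<..<v} \<inter> EN N = {}"
    proof (rule ccontr)
      assume "{u<..<v} \<inter> EN N \<noteq> {}"
      then obtain y where y: "u < y" "y < v" "y \<in> EN N" by auto
      have "a < (f ^^ n) y" using branch_mono[OF p(1) order_refl, of u y] y u v tp by simp
      moreover have "(f ^^ n) y < b" using branch_mono[OF p(1) order_refl, of y v] y u v tp by simp
      ultimately show False using y(3) n(1) by (auto simp: EN_def)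
    qed
    then show "\<exists>u v G. u \<le> x \<and> x \<le> v \<and> u < v \<and> v - u < e \<and> G \<in> lmeasurable \<and> G \<subseteq> {u..v} \<and>
        G \<inter> EN N = {} \<and> k * (v - u) \<le> measure lebesgue G"
      using p ts big uv u v
      by (intro exI[of _ p2] exI[of _ p3] exI[of _ "{u<..<v}"]) (auto simp: J_def m_def)
  qed
  then have "negligible (\<Union>(range EN))" by (intro negligible_countable_Union) auto
  then have "negligible (\<Union>(range EN) \<union> vis {a<..<b})" using neg by (rule negligible_Un)
  then have "negligible ?E"
  proof (rule negligible_subset, intro subsetI)
    fix x assume x: "x \<in> ?E"
    show "x \<in> \<Union>(range EN) \<union> vis {a<..<b}"
    proof (cases "visits {a<..<b} x")
      case True then show ?thesis using x core_reg by (auto simp: vis_def)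
    next
      case False
      then obtain N where "\<forall>n\<ge>N. (f ^^ n) x \<notin> {a<..<b}" by (auto simp: visits_def)
      then have "x \<in> EN N" using x by (simp add: EN_def)
      then show ?thesis by blast
    qed
  qed
  then show False using pos by simp
qed

end

section \<open>The metric dichotomy\<close>

lemma generic_INT_countable:
  assumes "countable I" "\<And>i. i \<in> I \<Longrightarrow> generic (X i)" shows "generic (\<Inter>i\<in>I. X i)"
proof (cases "I = {}")
  case True
  have "generic UNIV" unfolding generic_def by (intro exI[of _ "{}"]) auto
  then show ?thesis using True by simp
next
  case False
  have "generic (\<Inter>n. X (from_nat_into I n))"
    by (rule generic_INT) (rule assms(2)[OF from_nat_into[OF False]])
  moreover have "(\<Inter>n. X (from_nat_into I n)) = \<Inter>(X ` range (from_nat_into I))"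
    by (simp add: image_image)
  moreover have "range (from_nat_into I) = I" by (rule range_from_nat_into[OF False assms(1)])
  ultimately show ?thesis by simp
qed

context lorenz_dyn
begin

lemma first_cut_interval:
  assumes "0 \<le> a" "a < b" "b \<le> 1" "\<not> hom a b"
  obtains k y where "a < y" "y < b" "ct k y" "br k a b"
proof -
  let ?P = "\<lambda>k. \<exists>y. a < y \<and> y < b \<and> ct k y"
  obtain y0 k0 where "a < y0" "y0 < b" "ct k0 y0" using not_hom_cut[OF assms] .
  then have ex: "?P k0" by blast
  define k where "k = (LEAST k. ?P k)"
  obtain y where y: "a < y" "y < b" "ct k y" using LeastI[of ?P, OF ex] unfolding k_def by blast
  have "fr k z" if z: "a < z" "z < b" for z
  proof (rule ccontr)
    assume nf: "\<not> fr k z"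
    then have "\<not> reg z" using reg_free by blast
    then obtain l where l: "ct l z" using not_reg_cut[of z] z assms by auto
    have "l < k" using nf l free_mono[of l z k] by (metis cut_def not_less)
    then show False using not_less_Least[of l ?P] l z unfolding k_def by blast
  qed
  then have "br k a b" using assms by (simp add: branch_def)
  then show thesis using that y by blast
qed

lemma covers_nbhd:
  assumes b: "br k a b" and y: "a < y" "y < b" "ct k y"
  obtains d where "0 < d" "\<And>w. \<bar>w - c\<bar> < d \<Longrightarrow> \<exists>z. a < z \<and> z < b \<and> (f ^^ k) z = w"
proof -
  define u where "u = (a + y) / 2"
  define v where "v = (y + b) / 2"
  have uv: "a < u" "u < y" "y < v" "v < b" using y by (auto simp: u_def v_def)
  have "(f ^^ k) u < (f ^^ k) y" by (rule branch_mono[OF b order_refl uv(1,2) y(2)])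
  moreover have "(f ^^ k) y < (f ^^ k) v" by (rule branch_mono[OF b order_refl y(1) uv(3,4)])
  ultimately have lt: "(f ^^ k) u < c" "c < (f ^^ k) v" using y by (auto simp: cut_def)
  show thesis
  proof (rule that[of "min (c - (f ^^ k) u) ((f ^^ k) v - c)"])
    show "0 < min (c - (f ^^ k) u) ((f ^^ k) v - c)" using lt by simp
    fix w assume "\<bar>w - c\<bar> < min (c - (f ^^ k) u) ((f ^^ k) v - c)"
    then have w: "(f ^^ k) u \<le> w" "w \<le> (f ^^ k) v" by linarith+
    have "u \<le> v" using uv by simp
    then obtain z where "u \<le> z" "z \<le> v" "(f ^^ k) z = w"
      using branch_ivt[OF b uv(1) _ uv(4) order_refl w] by blast
    then show "\<exists>z. a < z \<and> z < b \<and> (f ^^ k) z = w" using uv by (intro exI[of _ z]) auto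
  qed
qed

lemma reg_of_iter: assumes "0 < z" "z < 1" "fr k z" "reg ((f ^^ k) z)" shows "reg z"
  using irregular_iter assms by blast

lemma good_near_c: assumes "good x" "0 < d" obtains n where "n \<ge> N" "\<bar>(f ^^ n) x - c\<bar> < d"
proof -
  have "visits {c - d<..<c + d} x"
    using good_omega_c[OF assms(1)] assms(2) omega_iff[OF good_reg[OF assms(1)]] by blast
  then obtain n where "n \<ge> N \<and> (f ^^ n) x \<in> {c - d<..<c + d}" unfolding visits_def by blast
  then show thesis by (intro that[of n]) auto
qed

text \<open>
  The window is not a homterval, since orbits return to it; hence some image contains \<open>c\<close>. What holds almost
  everywhere in the window then holds almost everywhere near \<open>c\<close>, and so almost everywhere, as typical
  orbits come close to \<open>c\<close>. Thus the sets \<open>vis S\<close> satisfy a zero-one law.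
\<close>

lemma window_full:
  assumes W: "window b1 a1 a2 b2" and pos: "\<not> negligible {x. core x \<and> visits {a1<..<a2} x}"
  obtains k d where "0 < d" "br k a1 a2" "\<And>w. \<bar>w - c\<bar> < d \<Longrightarrow> \<exists>z. a1 < z \<and> z < a2 \<and> (f ^^ k) z = w"
    "\<And>S. open S \<Longrightarrow> \<not> negligible (vis S) \<Longrightarrow> negligible {x. 0 < x \<and> x < 1 \<and> x \<notin> vis S}"
proof -
  let ?I = "{a1<..<a2}" and ?E = "{x. core x \<and> visits {a1<..<a2} x}"
  have a: "0 \<le> a1" "a1 < a2" "a2 \<le> 1" using W by (auto simp: window_def)
  have "?E \<inter> vis ?I = ?E" using core_reg by (auto simp: vis_def)
  then have negI: "negligible (?I - vis ?I)" using window_density[OF W, of ?I] pos by simp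
  have "\<not> hom a1 a2"
  proof
    assume h: "hom a1 a2"
    have "{a1<..<a2} \<noteq> {}" using a by simp
    then have "\<not> negligible ?I" using open_not_negligible[OF open_greaterThanLessThan] by blast
    then have "\<not> ?I \<subseteq> ?I - vis ?I" using negI negligible_subset by blast
    then obtain x where x: "a1 < x" "x < a2" "x \<in> vis ?I" by auto
    then have "visits ?I x" by (simp add: vis_def)
    then obtain n where n: "n \<ge> Suc 0 \<and> (f ^^ n) x \<in> ?I" unfolding visits_def by blast
    then show False using hom_wandering[OF h, of "(f ^^ n) x" x 0 n] x by simp
  qed
  then obtain k y where k: "a1 < y" "y < a2" "ct k y" "br k a1 a2"
    using first_cut_interval[OF a] by blast
  obtain d where d: "0 < d" "\<And>w. \<bar>w - c\<bar> < d \<Longrightarrow> \<exists>z. a1 < z \<and> z < a2 \<and> (f ^^ k) z = w"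
  proof (rule covers_nbhd[OF k(4,1-3)], goal_cases)
    case (1 d) show ?case by (rule that) (fact 1)+
  qed
  have full: "negligible {x. 0 < x \<and> x < 1 \<and> x \<notin> vis S}" if neg: "negligible (?I - vis S)" for S
  proof -
    define S1 where "S1 = (f ^^ k) ` {x \<in> ?I - vis S. 0 < x \<and> x < 1 \<and> fr k x}"
    have S1: "negligible S1" unfolding S1_def by (rule null_image[OF neg])
    define H where "H n = {x. 0 < x \<and> x < 1 \<and> fr n x \<and> (f ^^ n) x \<in> S1}" for n
    have "negligible (H n)" for n unfolding H_def by (rule null_preimage[OF S1])
    then have "negligible (\<Union>(range H))" by (intro negligible_countable_Union) auto
    then have "negligible ({x. 0 < x \<and> x < 1 \<and> \<not> good x} \<union> \<Union>(range H))"
      by (rule negligible_Un[OF good_ae])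
    then show ?thesis
    proof (rule negligible_subset, intro subsetI)
      fix x assume x: "x \<in> {x. 0 < x \<and> x < 1 \<and> x \<notin> vis S}"
      show "x \<in> {x. 0 < x \<and> x < 1 \<and> \<not> good x} \<union> \<Union>(range H)"
      proof (cases "good x")
        case True
        obtain n where n: "\<bar>(f ^^ n) x - c\<bar> < d" using good_near_c[OF True d(1)] by blast
        obtain z where z: "a1 < z" "z < a2" "(f ^^ k) z = (f ^^ n) x" using d(2)[OF n] by blast
        have frz: "fr k z" by (rule branch_free[OF k(4) z(1,2) order_refl])
        have rx: "reg x" "fr n x" using good_reg[OF True] reg_free by auto
        have "(f ^^ n) x \<notin> vis S" using vis_iter[of x n S] x rx by simp
        then have "z \<notin> vis S" using vis_iter[of z k S] z a frz by simp
        then have "(f ^^ n) x \<in> S1" unfolding S1_def using z a frz by (intro image_eqI[of _ _ z]) auto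
        then show ?thesis using x rx by (auto simp: H_def)
      qed (use x in auto)
    qed
  qed
  have fullI: "negligible {x. 0 < x \<and> x < 1 \<and> x \<notin> vis ?I}" by (rule full[OF negI])
  have "negligible {x. 0 < x \<and> x < 1 \<and> x \<notin> vis S}" if S: "open S" "\<not> negligible (vis S)" for S
  proof (rule full, rule window_density[OF W S(1)])
    show "\<not> negligible (?E \<inter> vis S)"
    proof
      assume neg: "negligible (?E \<inter> vis S)"
      define H where "H n = {x. 0 < x \<and> x < 1 \<and> fr n x \<and> (f ^^ n) x \<in> ?E \<inter> vis S}" for n
      have "negligible (H n)" for n unfolding H_def by (rule null_preimage[OF neg])
      then have "negligible (\<Union>(range H))" by (intro negligible_countable_Union) auto
      then have "negligible ({x. 0 < x \<and> x < 1 \<and> \<not> good x} \<union> {x. 0 < x \<and> x < 1 \<and> x \<notin> vis ?I} \<union> \<Union>(range H))"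
        by (intro negligible_Un good_ae fullI)
      moreover have "vis S \<subseteq> {x. 0 < x \<and> x < 1 \<and> \<not> good x} \<union> {x. 0 < x \<and> x < 1 \<and> x \<notin> vis ?I} \<union> \<Union>(range H)"
      proof
        fix x assume x: "x \<in> vis S"
        then have rx: "reg x" by (simp add: vis_def)
        show "x \<in> {x. 0 < x \<and> x < 1 \<and> \<not> good x} \<union> {x. 0 < x \<and> x < 1 \<and> x \<notin> vis ?I} \<union> \<Union>(range H)"
        proof (cases "good x \<and> x \<in> vis ?I")
          case True
          then obtain N where N: "core ((f ^^ N) x)" using good_core by blast
          have "x \<in> H N"
            using N True x rx reg_inner[OF rx] reg_free[OF rx] by (auto simp: H_def vis_def visits_iter reg_iter)
          then show ?thesis by blast
        qed (use reg_inner[OF rx] in auto)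
      qed
      ultimately show False using S(2) negligible_subset by blast
    qed
  qed
  then show thesis using that[OF d(1) k(4) d(2)] by blast
qed

lemma omega_meets_closed_interval:
  assumes x: "reg x" and v: "visits {a..b} x" shows "\<exists>y\<in>om x. a \<le> y \<and> y \<le> b"
proof -
  have "\<forall>j. \<exists>n\<ge>j. (f ^^ n) x \<in> {a..b}" using v by (simp add: visits_def)
  then obtain r where r: "\<And>j::nat. r j \<ge> j" "\<And>j. (f ^^ r j) x \<in> {a..b}" by metis
  have sc: "seq_compact {a..b}" by (rule compact_imp_seq_compact[OF compact_Icc])
  have "\<exists>l\<in>{a..b}. \<exists>s. strict_mono s \<and> ((\<lambda>j. (f ^^ r j) x) \<circ> s) \<longlonglongrightarrow> l"
    by (rule sc[unfolded seq_compact_def, rule_format]) (rule r(2))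
  then obtain l and s :: "nat \<Rightarrow> nat" where
    l: "l \<in> {a..b}" "strict_mono s" "((\<lambda>j. (f ^^ r j) x) \<circ> s) \<longlonglongrightarrow> l" by blast
  have "filterlim (\<lambda>j. r (s j)) at_top sequentially"
    unfolding filterlim_at_top
  proof
    fix Z
    have "Z \<le> r (s j)" if "Z \<le> j" for j using that r(1)[of "s j"] seq_suble[OF l(2), of j] by linarith
    then show "\<forall>\<^sub>F j in sequentially. Z \<le> r (s j)" unfolding eventually_sequentially by blast
  qed
  then have "l \<in> om x"
    unfolding omega_limit_def using l(3) x by (auto simp: regular_def comp_def intro!: exI[of _ "\<lambda>j. r (s j)"])
  then show ?thesis using l(1) by auto
qed

text \<open>
  An orbit that is close to the fixed point \<open>0\<close> cannot leave without visiting the interval between \<open>u\<close> and \<open>f u\<close>.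
\<close>

lemma omega_near_0: assumes x: "good x" "0 \<in> om x" and e: "0 < e" shows "\<exists>y\<in>om x. 0 < y \<and> y < e"
proof -
  have rx: "reg x" using x(1) by (rule good_reg)
  have "0 \<in> {0..1} - {c}" using c01 by simp
  then obtain d where d: "0 < d" "\<And>z. z \<in> {0..1} - {c} \<Longrightarrow> dist z 0 < d \<Longrightarrow> dist (f z) (f 0) < e"
    using cont e unfolding continuous_on_iff by blast
  define u where "u = min d c / 2"
  have u: "0 < u" "u < d" "u < c" using d(1) c01 by (auto simp: u_def)
  have "dist (f u) (f 0) < e" using d(2)[of u] u c01 by (auto simp: dist_real_def)
  then have fu: "f u < e" using f_inner(1)[of u] u c01 by (simp add: f0 dist_real_def)
  have "visits {u..f u} x"
    unfolding visits_def
  proof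
    fix N
    have "visits {- u<..<u} x" using omega_visits[OF rx x(2)] u by simp
    then obtain n where n: "n \<ge> N \<and> (f ^^ n) x \<in> {- u<..<u}" unfolding visits_def by blast
    have "0 < (c - u)" using u by simp
    then obtain m where m: "m \<ge> n" "\<bar>(f ^^ m) x - c\<bar> < c - u" using good_near_c[OF x(1)] by blast
    let ?P = "\<lambda>i. n \<le> i \<and> u \<le> (f ^^ i) x"
    define i where "i = (LEAST i. ?P i)"
    have "u \<le> (f ^^ m) x" using m(2) by linarith
    then have "?P m" using m by blast
    then have i: "n \<le> i" "u \<le> (f ^^ i) x" using LeastI[of ?P m] unfolding i_def by blast+
    have "i \<noteq> n" using i n by auto
    then obtain i' where i': "i = Suc i'" "n \<le> i'" using i(1) by (cases i) auto
    have "\<not> ?P i'" using not_less_Least[of i' ?P] i' unfolding i_def by simp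
    then have "(f ^^ i') x < u" using i' by simp
    then have "f ((f ^^ i') x) < f u" using monoL[of "(f ^^ i') x" u] reg_inner(1)[OF reg_iter[OF rx]] u
      by (simp add: less_imp_le)
    then show "\<exists>n\<ge>N. (f ^^ n) x \<in> {u..f u}" using i i' n by (intro exI[of _ i]) auto
  qed
  then obtain y where "y \<in> om x" "u \<le> y" "y \<le> f u" using omega_meets_closed_interval[OF rx] by blast
  then show ?thesis using u fu by (intro bexI[of _ y]) auto
qed

lemma omega_near_1: assumes x: "good x" "1 \<in> om x" and e: "0 < e" shows "\<exists>y\<in>om x. 1 - e < y \<and> y < 1"
proof -
  interpret R: lorenz_dyn "reflect f" "1 - c" by (rule reflect_dyn)
  have om: "y \<in> R.om (1 - x) \<longleftrightarrow> 1 - y \<in> om x" for y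
  proof -
    have "R.reg (1 - x)" using good_reg[OF x(1)] by (simp add: regular_reflect)
    moreover have "{1 - (y + e)<..<1 - (y - e)} = {1 - y - e<..<1 - y + e}" for e :: real
      by (simp add: algebra_simps)
    ultimately show ?thesis
      using R.omega_iff[of "1 - x" y] omega_iff[OF good_reg[OF x(1)], of "1 - y"] by (simp add: visits_reflect)
  qed
  obtain y where "y \<in> R.om (1 - x)" "0 < y" "y < e"
    using R.omega_near_0[of "1 - x" e] x e om[of 0] good_reflect by auto
  then show ?thesis using om[of y] by (intro bexI[of _ "1 - y"]) auto
qed

text \<open>A limit point outside the core limit set can be placed in a window.\<close>

lemma window_exists:
  assumes x: "good x" and n: "\<not> om x \<subseteq> core_limit"
  obtains b1 a1 a2 b2 where "window b1 a1 a2 b2" "visits {a1<..<a2} x"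
    "b1 \<in> \<rat>" "a1 \<in> \<rat>" "a2 \<in> \<rat>" "b2 \<in> \<rat>"
proof -
  have rx: "reg x" using x by (rule good_reg)
  have cl: "open (- core_limit)" using core_limit_closed by (simp add: open_Compl)
  obtain y0 where y0: "y0 \<in> om x" "y0 \<notin> core_limit" using n by blast
  obtain e0 where e0: "0 < e0" "ball y0 e0 \<subseteq> - core_limit" using cl y0(2) open_contains_ball by blast
  have "\<exists>y\<in>om x. y \<notin> core_limit \<and> 0 < y \<and> y < 1"
  proof -
    have "y0 \<in> {0..1}" using omega_subset[OF rx] y0 by blast
    then consider "y0 = 0" | "y0 = 1" | "0 < y0 \<and> y0 < 1" by force
    then show ?thesis
    proof cases
      case 1
      have me: "0 < min e0 1" using e0 by simp
      have z: "0 \<in> om x" using y0 1 by simp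
      obtain y where y: "y \<in> om x" "0 < y" "y < min e0 1"
        using omega_near_0[OF x z me] by blast
      then have "y \<in> ball y0 e0" using 1 by (simp add: dist_real_def)
      then show ?thesis using y e0(2) by (intro bexI[of _ y]) auto
    next
      case 2
      have me: "0 < min e0 1" using e0 by simp
      have z: "1 \<in> om x" using y0 2 by simp
      obtain y where y: "y \<in> om x" "1 - min e0 1 < y" "y < 1"
        using omega_near_1[OF x z me] by blast
      then have "y \<in> ball y0 e0" using 2 by (simp add: dist_real_def)
      then show ?thesis using y e0(2) by (intro bexI[of _ y]) auto
    qed (use y0 in blast)
  qed
  then obtain y where y: "y \<in> om x" "y \<notin> core_limit" "0 < y" "y < 1" by blast
  obtain e1 where e1: "0 < e1" "ball y e1 \<subseteq> - core_limit" using cl y(2) open_contains_ball by blast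
  define e where "e = min e1 (min y (1 - y))"
  have e: "0 < e" "e \<le> e1" "e \<le> y" "e \<le> 1 - y" using e1 y by (auto simp: e_def)
  have ye: "y - e < y" "y < y + e" using e by auto
  obtain b1 where b1: "b1 \<in> \<rat>" "y - e < b1" "b1 < y" using Rats_dense_in_real[OF ye(1)] by blast
  obtain a1 where a1: "a1 \<in> \<rat>" "b1 < a1" "a1 < y" using Rats_dense_in_real[OF b1(3)] by blast
  obtain b2 where b2: "b2 \<in> \<rat>" "y < b2" "b2 < y + e" using Rats_dense_in_real[OF ye(2)] by blast
  obtain a2 where a2: "a2 \<in> \<rat>" "y < a2" "a2 < b2" using Rats_dense_in_real[OF b2(2)] by blast
  have "unvisited z" if "b1 < z" "z < b2" for z
  proof -
    have "z \<in> ball y e1" using that b1 b2 e by (auto simp: dist_real_def)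
    then show ?thesis using e1(2) by (auto simp: core_limit_def)
  qed
  then have "window b1 a1 a2 b2" using a1 a2 b1 b2 e by (auto simp: window_def)
  then show thesis using that omega_visits[OF rx y(1) a1(3) a2(2)] a1 a2 b1 b2 by blast
qed

lemma rational_interval: fixes y e :: real assumes "0 < e"
  obtains a b where "a \<in> \<rat>" "b \<in> \<rat>" "y - e < a" "a < y" "y < b" "b < y + e"
proof -
  have ye: "y - e < y" "y < y + e" using assms by auto
  show thesis using Rats_dense_in_real[OF ye(1)] Rats_dense_in_real[OF ye(2)] that by metis
qed

text \<open>
  If no window is returned to by a set of positive measure, then almost every limit set is contained in
  \<open>core_limit\<close>. Otherwise the zero-one law shows that almost every limit set is the set \<open>Z\<close> of points all of whose
  neighbourhoods are visited infinitely often by almost every orbit. As \<open>Z\<close> is a neighbourhood of \<open>c\<close> and forward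
  invariant, it also captures the limit sets of generic points.
\<close>

lemma metric_dichotomy:
  obtains "negligible {x. 0 < x \<and> x < 1 \<and> om x \<noteq> core_limit}"
  | Z where "closed Z" "forward_invariant f c Z" "negligible {x. 0 < x \<and> x < 1 \<and> om x \<noteq> Z}"
      "generic {x. om x = Z}"
proof -
  define E where "E a1 a2 = {x. core x \<and> visits {a1<..<a2} x}" for a1 a2
  show thesis
  proof (cases "\<exists>b1 a1 a2 b2. window b1 a1 a2 b2 \<and> \<not> negligible (E a1 a2)")
    case False
    define H where "H p = {x. 0 < x \<and> x < 1 \<and> fr (fst p) x \<and> (f ^^ (fst p)) x \<in> E (fst (snd p)) (snd (snd p))}" for p
    define I where "I = {p. negligible (E (fst (snd p)) (snd (snd p)))} \<inter> ((UNIV :: nat set) \<times> (\<rat> \<times> \<rat>))"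
    have cI: "countable I"
      unfolding I_def by (intro countable_Int2 countable_SIGMA) (auto intro: countable_rat)
    have "negligible (H p)" if "p \<in> I" for p
      unfolding H_def by (rule null_preimage) (use that in \<open>simp add: I_def\<close>)
    then have "negligible (\<Union>(H ` I))" using cI by (intro negligible_countable_Union) auto
    then have "negligible ({x. 0 < x \<and> x < 1 \<and> \<not> good x} \<union> \<Union>(H ` I))"
      by (rule negligible_Un[OF good_ae])
    then have "negligible {x. 0 < x \<and> x < 1 \<and> om x \<noteq> core_limit}"
    proof (rule negligible_subset, intro subsetI)
      fix x assume x: "x \<in> {x. 0 < x \<and> x < 1 \<and> om x \<noteq> core_limit}"
      show "x \<in> {x. 0 < x \<and> x < 1 \<and> \<not> good x} \<union> \<Union>(H ` I)"
      proof (cases "good x")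
        case True
        then have "\<not> om x \<subseteq> core_limit" using x core_limit_subset_omega by blast
        then obtain b1 a1 a2 b2 where w: "window b1 a1 a2 b2" "visits {a1<..<a2} x" "a1 \<in> \<rat>" "a2 \<in> \<rat>"
          using window_exists[OF True] by metis
        obtain N where N: "core ((f ^^ N) x)" using good_core[OF True] .
        have "negligible (E a1 a2)" using False w by blast
        then have "(N, a1, a2) \<in> I" using w by (simp add: I_def)
        moreover have "x \<in> H (N, a1, a2)"
          using x N w reg_free[OF good_reg[OF True]] by (simp add: H_def E_def visits_iter)
        ultimately show ?thesis by blast
      qed (use x in auto)
    qed
    then show thesis by (rule that(1))
  next
    case True
    then obtain b1 a1 a2 b2 where W: "window b1 a1 a2 b2" and pos: "\<not> negligible (E a1 a2)" by blast
    note pos' = pos[unfolded E_def]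
    obtain k d where d: "0 < d" "br k a1 a2" "\<And>w. \<bar>w - c\<bar> < d \<Longrightarrow> \<exists>z. a1 < z \<and> z < a2 \<and> (f ^^ k) z = w"
      and full: "\<And>S. open S \<Longrightarrow> \<not> negligible (vis S) \<Longrightarrow> negligible {x. 0 < x \<and> x < 1 \<and> x \<notin> vis S}"
    proof (rule window_full[OF W pos'], goal_cases)
      case (1 d k) show ?case by (rule that) (fact 1)+
    qed
    define Z where "Z = {y. \<forall>e>0. \<not> negligible (vis {y - e<..<y + e})}"
    have vis_mono: "vis S \<subseteq> vis T" if "S \<subseteq> T" for S T
      using that visits_mono by (auto simp: vis_def)
    have cQ: "countable (\<rat> \<times> \<rat> :: (real \<times> real) set)" by (intro countable_SIGMA) (auto intro: countable_rat)
    define P where "P = (\<rat> \<times> \<rat> :: (real \<times> real) set) \<inter> {p. negligible (vis {fst p<..<snd p})}"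
    define P' where "P' = (\<rat> \<times> \<rat> :: (real \<times> real) set) - P"
    have cP: "countable P" "countable P'" unfolding P_def P'_def using cQ by auto
    have n1: "negligible (\<Union>((\<lambda>p. vis {fst p<..<snd p}) ` P))"
      using cP by (intro negligible_countable_Union) (auto simp: P_def)
    have n2: "negligible (\<Union>((\<lambda>p. {x. 0 < x \<and> x < 1 \<and> x \<notin> vis {fst p<..<snd p}}) ` P'))"
    proof (rule negligible_countable_Union)
      fix T assume "T \<in> (\<lambda>p. {x. 0 < x \<and> x < 1 \<and> x \<notin> vis {fst p<..<snd p}}) ` P'"
      then obtain p where p: "p \<in> P'" "T = {x. 0 < x \<and> x < 1 \<and> x \<notin> vis {fst p<..<snd p}}" by blast
      have "\<not> negligible (vis {fst p<..<snd p})" using p(1) by (simp add: P'_def P_def)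
      then show "negligible T" unfolding p(2) by (rule full[OF open_greaterThanLessThan])
    qed (use cP in simp)
    have ZP': "(a, b) \<in> P'" if "y \<in> Z" "a \<in> \<rat>" "b \<in> \<rat>" "a < y" "y < b" for y a b
    proof -
      have "\<not> negligible (vis {y - min (y - a) (b - y)<..<y + min (y - a) (b - y)})"
        using that by (simp add: Z_def)
      moreover have "vis {y - min (y - a) (b - y)<..<y + min (y - a) (b - y)} \<subseteq> vis {a<..<b}"
        by (rule vis_mono) auto
      ultimately have "\<not> negligible (vis {a<..<b})" using negligible_subset by blast
      then show ?thesis using that by (simp add: P'_def P_def)
    qed
    have sub: "Z \<subseteq> om x" if x: "reg x" "\<And>p. p \<in> P' \<Longrightarrow> visits {fst p<..<snd p} x" for x
    proof
      fix y assume y: "y \<in> Z"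
      show "y \<in> om x" unfolding omega_iff[OF x(1)]
      proof (intro allI impI)
        fix e :: real assume "0 < e"
        obtain a b where ab: "a \<in> \<rat>" "b \<in> \<rat>" "y - e < a" "a < y" "y < b" "b < y + e"
          using rational_interval[OF \<open>0 < e\<close>] .
        have "visits {a<..<b} x" using x(2)[OF ZP'[OF y ab(1,2,4,5)]] by simp
        then show "visits {y - e<..<y + e} x" by (rule visits_mono) (use ab in auto)
      qed
    qed
    have ae: "negligible {x. 0 < x \<and> x < 1 \<and> om x \<noteq> Z}"
    proof (rule negligible_subset)
      show "negligible ({x. 0 < x \<and> x < 1 \<and> \<not> good x} \<union> (\<Union>((\<lambda>p. vis {fst p<..<snd p}) ` P) \<union>
         \<Union>((\<lambda>p. {x. 0 < x \<and> x < 1 \<and> x \<notin> vis {fst p<..<snd p}}) ` P')))"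
        by (intro negligible_Un good_ae n1 n2)
      show "{x. 0 < x \<and> x < 1 \<and> om x \<noteq> Z} \<subseteq> {x. 0 < x \<and> x < 1 \<and> \<not> good x} \<union>
         (\<Union>((\<lambda>p. vis {fst p<..<snd p}) ` P) \<union>
         \<Union>((\<lambda>p. {x. 0 < x \<and> x < 1 \<and> x \<notin> vis {fst p<..<snd p}}) ` P'))"
      proof (rule subsetI, rule ccontr)
        fix x assume x: "x \<in> {x. 0 < x \<and> x < 1 \<and> om x \<noteq> Z}" and nx: "x \<notin> {x. 0 < x \<and> x < 1 \<and> \<not> good x} \<union>
         (\<Union>((\<lambda>p. vis {fst p<..<snd p}) ` P) \<union>
         \<Union>((\<lambda>p. {x. 0 < x \<and> x < 1 \<and> x \<notin> vis {fst p<..<snd p}}) ` P'))"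
        have rx: "reg x" using x nx good_reg by blast
        have "Z \<subseteq> om x"
        proof (rule sub[OF rx])
          fix p assume "p \<in> P'"
          then have "x \<in> vis {fst p<..<snd p}" using x nx by blast
          then show "visits {fst p<..<snd p} x" by (simp add: vis_def)
        qed
        moreover have "om x \<subseteq> Z"
        proof
          fix y assume y: "y \<in> om x"
          show "y \<in> Z" unfolding Z_def
          proof (intro CollectI allI impI)
            fix e :: real assume "0 < e"
            obtain a b where ab: "a \<in> \<rat>" "b \<in> \<rat>" "y - e < a" "a < y" "y < b" "b < y + e"
              using rational_interval[OF \<open>0 < e\<close>] .
            have "x \<in> vis {a<..<b}" using omega_visits[OF rx y ab(4,5)] rx by (simp add: vis_def)
            moreover have "(a, b) \<in> P \<Longrightarrow> x \<notin> vis {a<..<b}" using nx by force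
            ultimately have "(a, b) \<notin> P" by blast
            then have "\<not> negligible (vis {a<..<b})" using ab by (simp add: P_def)
            moreover have "vis {a<..<b} \<subseteq> vis {y - e<..<y + e}" by (rule vis_mono) (use ab in auto)
            ultimately show "\<not> negligible (vis {y - e<..<y + e})" using negligible_subset by blast
          qed
        qed
        ultimately show False using x by blast
      qed
    qed
    obtain xs where xs: "good xs" "om xs = Z"
    proof -
      have "negligible ({x. 0 < x \<and> x < 1 \<and> \<not> good x} \<union> {x. 0 < x \<and> x < 1 \<and> om x \<noteq> Z})"
        by (intro negligible_Un good_ae ae)
      then have "negligible {x. 0 < x \<and> x < 1 \<and> \<not> (good x \<and> om x = Z)}"
        by (rule negligible_subset) auto
      then show thesis using interval_meets_full[of "\<lambda>x. good x \<and> om x = Z" 0 1] that by auto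
    qed
    have rxs: "reg xs" using xs(1) by (rule good_reg)
    have Zc: "closed Z" using omega_closed[OF rxs] xs by simp
    have Zf: "forward_invariant f c Z" using omega_forward_invariant[OF rxs] xs by simp
    have IZ: "y \<in> Z" if y: "a1 < y" "y < a2" for y
      unfolding Z_def
    proof (intro CollectI allI impI)
      fix e :: real assume e: "0 < e"
      have "\<not> negligible (vis {max a1 (y - e)<..<min a2 (y + e)})"
        by (rule window_sub_positive[OF W pos']) (use e y in auto)
      moreover have "vis {max a1 (y - e)<..<min a2 (y + e)} \<subseteq> vis {y - e<..<y + e}"
        by (rule vis_mono) auto
      ultimately show "\<not> negligible (vis {y - e<..<y + e})" using negligible_subset by blast
    qed
    have VZ: "w \<in> Z" if w: "\<bar>w - c\<bar> < d" for w
    proof -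
      obtain z where z: "a1 < z" "z < a2" "(f ^^ k) z = w" using d(3)[OF w] by blast
      have "(f ^^ k) z \<in> om xs"
        by (rule omega_forward_iter[OF rxs]) (use IZ[OF z(1,2)] xs branch_free[OF d(2) z(1,2) order_refl] in auto)
      then show ?thesis using z xs by simp
    qed
    have up: "om x \<subseteq> Z" if x: "good x" for x
    proof
      have rx: "reg x" using x by (rule good_reg)
      obtain n where n: "\<bar>(f ^^ n) x - c\<bar> < d" using good_near_c[OF x d(1)] by blast
      have stay: "(f ^^ m) x \<in> Z" if "m \<ge> n" for m
      proof -
        have "(f ^^ (m - n)) ((f ^^ n) x) \<in> om xs"
          by (rule omega_forward_iter[OF rxs]) (use VZ[OF n] xs reg_free[OF reg_iter[OF rx]] in auto)
        then show ?thesis using that xs by (simp add: funpow_plus)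
      qed
      fix y assume y: "y \<in> om x"
      have "y \<in> closure Z" unfolding closure_approachable
      proof (intro allI impI)
        fix e :: real assume e: "0 < e"
        have "visits {y - e<..<y + e} x" using omega_visits[OF rx y] e by simp
        then obtain m where "m \<ge> n \<and> (f ^^ m) x \<in> {y - e<..<y + e}" unfolding visits_def by blast
        then show "\<exists>z\<in>Z. dist z y < e" using stay by (intro bexI[of _ "(f ^^ m) x"]) (auto simp: dist_real_def)
      qed
      then show "y \<in> Z" using Zc by simp
    qed
    have "generic (\<Inter>p\<in>P'. {x. reg x \<and> visits {fst p<..<snd p} x})"
    proof (rule generic_INT_countable[OF cP(2)])
      fix p assume p: "p \<in> P'"
      have "negligible {x. 0 < x \<and> x < 1 \<and> x \<notin> vis {fst p<..<snd p}}"
        by (rule full) (use p in \<open>auto simp: P'_def P_def\<close>)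
      then show "generic {x. reg x \<and> visits {fst p<..<snd p} x}"
        by (intro generic_visits_ae) (auto simp: vis_def)
    qed
    then have "generic ((\<Inter>p\<in>P'. {x. reg x \<and> visits {fst p<..<snd p} x}) \<inter> {x. good x})"
      using good_generic by (rule generic_Int)
    then have "generic {x. om x = Z}"
    proof (rule generic_mono, intro subsetI)
      fix x assume x: "x \<in> {0<..<1} \<inter> ((\<Inter>p\<in>P'. {x. reg x \<and> visits {fst p<..<snd p} x}) \<inter> {x. good x})"
      then have "Z \<subseteq> om x" using good_reg by (intro sub) auto
      then show "x \<in> {x. om x = Z}" using up x by auto
    qed
    then show thesis using that(2) Zc Zf ae by blast
  qed
qed

end

section \<open>The topological dichotomy\<close>

context lorenz_dyn
begin

lemma hom_pullback:
  assumes b: "br n t s" "t < u" "u < v" "v < s" and h: "hom ((f ^^ n) u) ((f ^^ n) v)"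
  shows "hom u v"
  unfolding homterval_def
proof (intro conjI allI impI)
  show "0 \<le> u" "u < v" "v \<le> 1" using branchD[OF b(1)] b by auto
  fix z assume z: "u < z \<and> z < v"
  have "(f ^^ n) u < (f ^^ n) z" by (rule branch_mono[OF b(1) order_refl b(2)]) (use z b in auto)
  moreover have "(f ^^ n) z < (f ^^ n) v" by (rule branch_mono[OF b(1) order_refl]) (use z b in auto)
  ultimately have "reg ((f ^^ n) z)" using homD(1)[OF h] by blast
  moreover have "fr n z" using branch_free[OF b(1), of z n] z b by auto
  moreover have "0 < z" "z < 1" using branchD[OF b(1)] z b by auto
  ultimately show "reg z" using reg_of_iter by blast
qed

lemma hom_image: assumes h: "hom u v" and ab: "u < a" "a < b" "b < v"
  shows "hom ((f ^^ n) a) ((f ^^ n) b)"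
  unfolding homterval_def
proof (intro conjI allI impI)
  note br = hom_branch[OF h, of n]
  have "reg a" "reg b" using homD(1)[OF h] ab by auto
  then show "0 \<le> (f ^^ n) a" "(f ^^ n) b \<le> 1" using reg_inner[OF reg_iter] by (auto simp: less_imp_le)
  show "(f ^^ n) a < (f ^^ n) b" by (rule branch_mono[OF br order_refl ab])
  fix w assume w: "(f ^^ n) a < w \<and> w < (f ^^ n) b"
  have wle: "(f ^^ n) a \<le> w" "w \<le> (f ^^ n) b" using w by auto
  obtain z where "a \<le> z" "z \<le> b" "(f ^^ n) z = w"
    using branch_ivt[OF br ab(1) less_imp_le[OF ab(2)] ab(3) order_refl wle] .
  then show "reg w" using reg_iter[OF homD(1)[OF h, of z], of n] ab by auto
qed

text \<open>
  The distance of the two orbits tends to zero.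
\<close>

lemma hom_same_omega:
  assumes h: "hom u v" and x: "u < x" "x < v" and y: "u < y" "y < v" shows "om x \<subseteq> om y"
proof (cases "x = y")
  case False
  have rx: "reg x" and ry: "reg y" using homD(1)[OF h] x y by auto
  have lim: "(\<lambda>n. \<bar>(f ^^ n) x - (f ^^ n) y\<bar>) \<longlonglongrightarrow> 0"
  proof (cases "x < y")
    case True
    have "(\<lambda>n. (f ^^ n) y - (f ^^ n) x) \<longlonglongrightarrow> 0"
      by (rule lengths_tendsto_0[OF True]) (use homD(1)[OF h] x y in auto)
    then have "(\<lambda>n. \<bar>(f ^^ n) y - (f ^^ n) x\<bar>) \<longlonglongrightarrow> 0" by (rule tendsto_rabs_zero)
    then show ?thesis by (simp add: abs_minus_commute)
  next
    case False
    then have "y < x" using \<open>x \<noteq> y\<close> by simp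
    then have "(\<lambda>n. (f ^^ n) x - (f ^^ n) y) \<longlonglongrightarrow> 0"
      by (rule lengths_tendsto_0) (use homD(1)[OF h] x y in auto)
    then show ?thesis by (rule tendsto_rabs_zero)
  qed
  show ?thesis
  proof
    fix w assume w: "w \<in> om x"
    show "w \<in> om y" unfolding omega_iff[OF ry]
    proof (intro allI impI)
      fix e :: real assume e: "0 < e"
      then have e2: "0 < e / 2" by simp
      obtain N0 where N0: "\<And>n. n \<ge> N0 \<Longrightarrow> \<bar>(f ^^ n) x - (f ^^ n) y\<bar> < e / 2"
        using order_tendstoD(2)[OF lim e2] unfolding eventually_sequentially by blast
      have v: "visits {w - e / 2<..<w + e / 2} x" using omega_visits[OF rx w] e2 by simp
      show "visits {w - e<..<w + e} y" unfolding visits_def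
      proof
        fix N
        obtain n where "n \<ge> max N0 N \<and> (f ^^ n) x \<in> {w - e / 2<..<w + e / 2}"
          using v unfolding visits_def by blast
        then have n: "n \<ge> N0" "n \<ge> N" "w - e / 2 < (f ^^ n) x" "(f ^^ n) x < w + e / 2" by auto
        then have "w - e < (f ^^ n) y \<and> (f ^^ n) y < w + e" using N0[OF n(1)] by linarith
        then show "\<exists>n\<ge>N. (f ^^ n) y \<in> {w - e<..<w + e}" using n by (intro exI[of _ n]) auto
      qed
    qed
  qed
qed simp

text \<open>
  Every interval has an image that contains a neighbourhood of \<open>c\<close>, hence a point of the given orbit.
\<close>

lemma generic_visits_of_orbit:
  assumes no: "\<And>u v. \<not> hom u v" and S: "open S"
    and near: "\<And>N d. 0 < d \<Longrightarrow> \<exists>x i n. reg x \<and> \<bar>(f ^^ i) x - c\<bar> < d \<and> i + N \<le> n \<and> (f ^^ n) x \<in> S"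
  shows "generic {x. reg x \<and> visits S x}"
proof (rule generic_visits[OF S])
  fix N :: nat and a b :: real assume ab: "0 \<le> a" "a < b" "b \<le> 1"
  obtain k y where k: "a < y" "y < b" "ct k y" "br k a b" using first_cut_interval[OF ab no] .
  obtain d where d: "0 < d" "\<And>w. \<bar>w - c\<bar> < d \<Longrightarrow> \<exists>z. a < z \<and> z < b \<and> (f ^^ k) z = w"
  proof (rule covers_nbhd[OF k(4,1-3)], goal_cases)
    case (1 d) show ?case by (rule that) (fact 1)+
  qed
  obtain x i n where x: "reg x" "\<bar>(f ^^ i) x - c\<bar> < d" "i + N \<le> n" "(f ^^ n) x \<in> S"
    using near[OF d(1)] by blast
  obtain z where z: "a < z" "z < b" "(f ^^ k) z = (f ^^ i) x" using d(2)[OF x(2)] by blast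
  have "reg z"
  proof (rule reg_of_iter)
    show "0 < z" "z < 1" using z ab by auto
    show "fr k z" by (rule branch_free[OF k(4) z(1,2) order_refl])
    show "reg ((f ^^ k) z)" using z(3) reg_iter[OF x(1)] by simp
  qed
  moreover have "(f ^^ (k + (n - i))) z = (f ^^ (n - i)) ((f ^^ k) z)" by (simp add: funpow_plus)
  then have "(f ^^ (k + (n - i))) z = (f ^^ n) x" using z(3) x(3) by (simp add: funpow_plus)
  ultimately show "\<exists>x n. a < x \<and> x < b \<and> reg x \<and> N \<le> n \<and> (f ^^ n) x \<in> S"
    using z x by (intro exI[of _ z] exI[of _ "k + (n - i)"]) auto
qed

text \<open>
  The common limit set is the closure of the union of the limit sets of all typical points.
\<close>

lemma generic_omega_constant:
  assumes no: "\<And>u v. \<not> hom u v"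
  obtains Z where "generic {x. om x = Z}"
proof -
  define Z where "Z = closure (\<Union>x\<in>{x. good x}. om x)"
  define P where "P = (\<rat> \<times> \<rat> :: (real \<times> real) set) \<inter> {p. \<exists>x. good x \<and> visits {fst p<..<snd p} x}"
  have "countable (\<rat> \<times> \<rat> :: (real \<times> real) set)" by (intro countable_SIGMA) (auto intro: countable_rat)
  then have cP: "countable P" unfolding P_def by auto
  have gen: "generic {x. reg x \<and> visits {fst p<..<snd p} x}" if p: "p \<in> P" for p
  proof -
    obtain x where x: "good x" "visits {fst p<..<snd p} x" using p by (auto simp: P_def)
    show ?thesis
    proof (rule generic_visits_of_orbit[OF no open_greaterThanLessThan])
      fix N :: nat and d :: real assume "0 < d"
      then obtain i where i: "\<bar>(f ^^ i) x - c\<bar> < d" using good_near_c[OF x(1)] by blast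
      obtain n where "n \<ge> i + N \<and> (f ^^ n) x \<in> {fst p<..<snd p}" using x(2) unfolding visits_def by blast
      then show "\<exists>x i n. reg x \<and> \<bar>(f ^^ i) x - c\<bar> < d \<and> i + N \<le> n \<and> (f ^^ n) x \<in> {fst p<..<snd p}"
        using i good_reg[OF x(1)] by blast
    qed
  qed
  have "generic ((\<Inter>p\<in>P. {x. reg x \<and> visits {fst p<..<snd p} x}) \<inter> {x. good x})"
    by (intro generic_Int generic_INT_countable cP gen good_generic)
  then have "generic {x. om x = Z}"
  proof (rule generic_mono, intro subsetI)
    fix x assume x: "x \<in> {0<..<1} \<inter> ((\<Inter>p\<in>P. {x. reg x \<and> visits {fst p<..<snd p} x}) \<inter> {x. good x})"
    then have gx: "good x" and vx: "\<And>p. p \<in> P \<Longrightarrow> visits {fst p<..<snd p} x" by auto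
    have rx: "reg x" using gx by (rule good_reg)
    have "om x \<subseteq> (\<Union>x\<in>{x. good x}. om x)" using gx by (intro UN_upper) simp
    then have "om x \<subseteq> Z" unfolding Z_def by (rule order_trans[OF _ closure_subset])
    moreover have "(\<Union>x\<in>{x. good x}. om x) \<subseteq> om x"
    proof
      fix y assume "y \<in> (\<Union>x\<in>{x. good x}. om x)"
      then obtain x' where x': "good x'" "y \<in> om x'" by blast
      show "y \<in> om x" unfolding omega_iff[OF rx]
      proof (intro allI impI)
        fix e :: real assume "0 < e"
        obtain a b where ab: "a \<in> \<rat>" "b \<in> \<rat>" "y - e < a" "a < y" "y < b" "b < y + e"
          using rational_interval[OF \<open>0 < e\<close>] .
        have "visits {a<..<b} x'" by (rule omega_visits[OF good_reg[OF x'(1)] x'(2) ab(4,5)])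
        then have "(a, b) \<in> P" using ab x' by (auto simp: P_def)
        then have "visits {a<..<b} x" using vx[of "(a, b)"] by simp
        then show "visits {y - e<..<y + e} x" by (rule visits_mono) (use ab in auto)
      qed
    qed
    then have "Z \<subseteq> om x" unfolding Z_def by (rule closure_minimal[OF _ omega_closed[OF rx]])
    ultimately show "x \<in> {x. om x = Z}" by blast
  qed
  then show thesis by (rule that)
qed

text \<open>
  The half \<open>S\<close> of the component \<open>M\<close> is moved monotonically until it first meets \<open>M\<close> again, because \<open>c \<in> M\<close>;
  at that time its image is connected and lies in \<open>M\<close>.
\<close>

lemma half_returns:
  assumes Z: "closed Z" "Z \<subseteq> {0..1}" "forward_invariant f c Z"
    and M: "M = connected_component_set Z c" "c \<in> M"
    and S: "connected S" "S \<subseteq> M - {c}"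
    and ret: "x \<in> S" "0 < n" "(f ^^ n) x \<in> M" "reg x"
  obtains k where "0 < k" "(f ^^ k) ` S \<subseteq> M" "\<And>i. i \<le> k \<Longrightarrow> (f ^^ i) ` S \<subseteq> Z \<and> connected ((f ^^ i) ` S)"
    "\<And>z. z \<in> S \<Longrightarrow> fr k z"
proof -
  have MZ: "M \<subseteq> Z" unfolding M(1) by (rule connected_component_subset)
  let ?P = "\<lambda>k. 0 < k \<and> (f ^^ k) ` S \<inter> M \<noteq> {}"
  define k where "k = (LEAST k. ?P k)"
  have "?P n" using ret by blast
  then have k: "0 < k" "(f ^^ k) ` S \<inter> M \<noteq> {}" using LeastI[of ?P n] unfolding k_def by blast+
  have before: "(f ^^ i) ` S \<inter> M = {}" if "0 < i" "i < k" for i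
    using not_less_Least[of i ?P] that unfolding k_def by blast
  have frk: "fr k z" if z: "z \<in> S" for z
    unfolding free_def
  proof (intro allI impI)
    fix i assume i: "i < k"
    show "(f ^^ i) z \<noteq> c"
    proof (cases "i = 0")
      case True then show ?thesis using z S by auto
    next
      case False then show ?thesis using before[of i] i z M(2) by auto
    qed
  qed
  have inZ: "(f ^^ i) z \<in> Z" if z: "z \<in> S" "i \<le> k" for z i
    using z(2)
  proof (induction i)
    case 0 then show ?case using z S MZ by auto
  next
    case (Suc i)
    then have "(f ^^ i) z \<in> Z" "(f ^^ i) z \<noteq> c" using frk[OF z(1)] by (auto simp: free_def)
    then show ?case using Z(3) by (auto simp: forward_invariant_def)
  qed
  have con: "connected ((f ^^ i) ` S)" if "i \<le> k" for i
  proof (rule connected_continuous_image[OF iter_cont_on S(1)])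
    show "S \<subseteq> {0..1}" using S MZ Z by blast
    show "fr i z" if "z \<in> S" for z using free_mono[OF frk[OF that] \<open>i \<le> k\<close>] .
  qed
  have "(f ^^ k) ` S \<subseteq> M"
  proof -
    have "connected (M \<union> (f ^^ k) ` S)"
      using con[of k] k(2) by (intro connected_Un) (auto simp: M(1))
    moreover have "M \<union> (f ^^ k) ` S \<subseteq> Z" using MZ inZ by auto
    ultimately have "M \<union> (f ^^ k) ` S \<subseteq> M"
      using connected_component_maximal[of c "M \<union> (f ^^ k) ` S" Z] M by blast
    then show ?thesis by blast
  qed
  then show thesis using that[OF k(1) _ _ frk] inZ con by blast
qed

text \<open>
  The family \<open>F\<close> consists of the component of \<open>c\<close> and of the images of its two halves before they
  return. It is forward invariant and contains the tail of the orbit of \<open>x\<close>, so the closures of its members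
  make up the whole limit set.
\<close>

lemma omega_cycle:
  assumes x: "good x" and Z: "Z = om x" and d: "0 < d" "\<And>w. \<bar>w - c\<bar> < d \<Longrightarrow> w \<in> Z"
  shows "cycle_of_intervals f c Z"
proof -
  have rx: "reg x" using x by (rule good_reg)
  have Zc: "closed Z" and Zs: "Z \<subseteq> {0..1}" and Zf: "forward_invariant f c Z"
    using omega_closed[OF rx] omega_subset[OF rx] omega_forward_invariant[OF rx] Z by auto
  define M where "M = connected_component_set Z c"
  have MZ: "M \<subseteq> Z" unfolding M_def by (rule connected_component_subset)
  have V: "{c - d<..<c + d} \<subseteq> M"
    unfolding M_def
  proof (rule connected_component_maximal)
    show "{c - d<..<c + d} \<subseteq> Z" using d(2) by (auto simp: abs_less_iff)
  qed (use d in auto)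
  have cM: "c \<in> M" using V d(1) by auto
  have cM': "connected M" unfolding M_def by simp
  have return: "\<exists>z n. z \<in> S \<and> 0 < n \<and> (f ^^ n) z \<in> M \<and> reg z" if ab: "{a<..<b} \<subseteq> S" "0 \<le> a" "a < b" "b \<le> 1" for S a b
  proof -
    obtain z where z: "a < z" "z < b" "good z" using interval_meets_full[OF good_ae ab(2-4)] .
    obtain n where n: "n \<ge> Suc 0" "\<bar>(f ^^ n) z - c\<bar> < d" using good_near_c[OF z(3) d(1)] .
    have "(f ^^ n) z \<in> M" using n V by (auto simp: abs_less_iff)
    then show ?thesis using z n good_reg ab(1) by (intro exI[of _ z] exI[of _ n]) auto
  qed
  have seg: "{min u c..max u c} \<subseteq> M" if "u \<in> M" for u
    using connected_contains_Icc[OF cM'] that cM by (simp add: min_def max_def)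
  define A where "A = M \<inter> {c<..}"
  define B where "B = M \<inter> {..<c}"
  have iM: "is_interval M" using cM' by (simp add: is_interval_connected_1)
  have "convex M" using iM by (simp add: is_interval_convex)
  then have "convex A" "convex B" unfolding A_def B_def by (simp_all add: convex_Int)
  then have conA: "connected A" and conB: "connected B" by (simp_all add: convex_connected)
  have AB: "A \<subseteq> M - {c}" "B \<subseteq> M - {c}" "M - {c} \<subseteq> A \<union> B" by (auto simp: A_def B_def)
  have "{c<..<c + min d (1 - c)} \<subseteq> {c - d<..<c + d}" using d(1) by auto
  then have "{c<..<c + min d (1 - c)} \<subseteq> A" using V unfolding A_def by auto
  moreover have "0 \<le> c" "c < c + min d (1 - c)" "c + min d (1 - c) \<le> 1" using d(1) c01 by auto
  ultimately obtain za na where za: "za \<in> A" "0 < na" "(f ^^ na) za \<in> M" "reg za"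
    using return by blast
  have "{c - min d c<..<c} \<subseteq> {c - d<..<c + d}" using d(1) by auto
  then have "{c - min d c<..<c} \<subseteq> B" using V unfolding B_def by auto
  moreover have "0 \<le> c - min d c" "c - min d c < c" "c \<le> 1" using d(1) c01 by auto
  ultimately obtain zb nb where zb: "zb \<in> B" "0 < nb" "(f ^^ nb) zb \<in> M" "reg zb"
    using return by blast
  obtain k where k: "0 < k" "(f ^^ k) ` A \<subseteq> M" "\<And>i. i \<le> k \<Longrightarrow> (f ^^ i) ` A \<subseteq> Z \<and> connected ((f ^^ i) ` A)"
    "\<And>z. z \<in> A \<Longrightarrow> fr k z"
  proof (rule half_returns[OF Zc Zs Zf M_def cM conA AB(1) za], goal_cases)
    case (1 k) show ?case by (rule that) (fact 1)+
  qed
  obtain l where l: "0 < l" "(f ^^ l) ` B \<subseteq> M" "\<And>i. i \<le> l \<Longrightarrow> (f ^^ i) ` B \<subseteq> Z \<and> connected ((f ^^ i) ` B)"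
    "\<And>z. z \<in> B \<Longrightarrow> fr l z"
  proof (rule half_returns[OF Zc Zs Zf M_def cM conB AB(2) zb], goal_cases)
    case (1 k) show ?case by (rule that) (fact 1)+
  qed
  define F where "F = insert M ((\<lambda>i. (f ^^ i) ` A) ` {1..<k} \<union> (\<lambda>i. (f ^^ i) ` B) ` {1..<l})"
  have finF: "finite F" by (simp add: F_def)
  have Fcases: "T = M \<or> (\<exists>i<k. T = (f ^^ i) ` A) \<or> (\<exists>i<l. T = (f ^^ i) ` B)" if "T \<in> F" for T
    using that unfolding F_def by auto
  have FZcon: "T \<subseteq> Z \<and> connected T" if "T \<in> F" for T
    using Fcases[OF that]
  proof (elim disjE exE conjE)
    fix i assume "i < k" "T = (f ^^ i) ` A" then show ?thesis using k(3)[of i] by simp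
  next
    fix i assume "i < l" "T = (f ^^ i) ` B" then show ?thesis using l(3)[of i] by simp
  qed (use MZ cM' in simp)
  then have FZ: "\<And>T. T \<in> F \<Longrightarrow> T \<subseteq> Z" and Fcon: "\<And>T. T \<in> F \<Longrightarrow> connected T" by simp_all
  have step: "f z \<in> \<Union>F" if z: "z \<in> \<Union>F" "z \<noteq> c" for z
  proof -
    have goA: "(f ^^ Suc i) y \<in> \<Union>F" if y: "y \<in> A" "i < k" for y i
    proof (cases "Suc i = k")
      case True
      then have "(f ^^ Suc i) y \<in> M" using k(2) y(1) by blast
      then show ?thesis by (simp add: F_def del: funpow.simps)
    next
      case False
      then have "Suc i \<in> {1..<k}" using y(2) by simp
      then have "(f ^^ Suc i) ` A \<in> (\<lambda>i. (f ^^ i) ` A) ` {1..<k}" by (rule imageI)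
      then have "(f ^^ Suc i) ` A \<in> F" unfolding F_def by blast
      then show ?thesis using y(1) by blast
    qed
    have goB: "(f ^^ Suc i) y \<in> \<Union>F" if y: "y \<in> B" "i < l" for y i
    proof (cases "Suc i = l")
      case True
      then have "(f ^^ Suc i) y \<in> M" using l(2) y(1) by blast
      then show ?thesis by (simp add: F_def del: funpow.simps)
    next
      case False
      then have "Suc i \<in> {1..<l}" using y(2) by simp
      then have "(f ^^ Suc i) ` B \<in> (\<lambda>i. (f ^^ i) ` B) ` {1..<l}" by (rule imageI)
      then have "(f ^^ Suc i) ` B \<in> F" unfolding F_def by blast
      then show ?thesis using y(1) by blast
    qed
    obtain T where T: "T \<in> F" "z \<in> T" using z(1) by blast
    from Fcases[OF T(1)] T(2) consider "z \<in> M" | i y where "y \<in> A" "i < k" "z = (f ^^ i) y"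
      | i y where "y \<in> B" "i < l" "z = (f ^^ i) y"
      by blast
    then show ?thesis
    proof cases
      case 1
      then have "z \<in> A \<or> z \<in> B" using z AB(3) by blast
      then show ?thesis using goA[of z 0] goB[of z 0] k(1) l(1) by auto
    next
      case 2 then show ?thesis using goA[of y i] by simp
    next
      case 3 then show ?thesis using goB[of y i] by simp
    qed
  qed
  obtain n where n: "\<bar>(f ^^ n) x - c\<bar> < d" using good_near_c[OF x d(1)] by blast
  have stay: "(f ^^ (n + m)) x \<in> \<Union>F" for m
  proof (induction m)
    case 0
    have "(f ^^ n) x \<in> M" using n V by (auto simp: abs_less_iff)
    then show ?case by (simp add: F_def)
  next
    case (Suc m)
    have "(f ^^ (n + m)) x \<noteq> c" using rx by (simp add: regular_def)
    then show ?case using step[OF Suc] by simp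
  qed
  have "Z \<subseteq> closure (\<Union>F)"
  proof
    fix y assume y: "y \<in> Z"
    show "y \<in> closure (\<Union>F)" unfolding closure_approachable
    proof (intro allI impI)
      fix e :: real assume e: "0 < e"
      have "visits {y - e<..<y + e} x" using omega_visits[OF rx, of y] y Z e by simp
      then obtain i where i: "i \<ge> n \<and> (f ^^ i) x \<in> {y - e<..<y + e}" unfolding visits_def by blast
      then have "(f ^^ i) x \<in> \<Union>F" using stay[of "i - n"] by simp
      then show "\<exists>z\<in>\<Union>F. dist z y < e" using i by (intro bexI[of _ "(f ^^ i) x"]) (auto simp: dist_real_def)
    qed
  qed
  moreover have "closure (\<Union>F) \<subseteq> Z" using FZ Zc by (intro closure_minimal) auto
  moreover have "closure (\<Union>F) = \<Union>(closure ` F)" using finF by (induction F) auto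
  ultimately have eq: "Z = \<Union>(closure ` F)" by auto
  have two: "\<exists>u\<in>T. \<exists>v\<in>T. u < v" if T: "T \<in> F" for T
  proof -
    define p where "p = min d (1 - c)"
    define q where "q = min d c"
    have pq: "0 < p" "p \<le> d" "0 < q" "q \<le> d" using d(1) c01 by (auto simp: p_def q_def)
    have ab: "c + p / 3 \<in> A" "c + p / 2 \<in> A" "c + p / 3 < c + p / 2"
      "c - q / 2 \<in> B" "c - q / 3 \<in> B" "c - q / 2 < c - q / 3"
      using V pq unfolding A_def B_def by (auto simp: subset_iff)
    have distinct: "\<exists>u\<in>(f ^^ i) ` S. \<exists>v\<in>(f ^^ i) ` S. u < v"
      if S: "u0 \<in> S" "v0 \<in> S" "u0 < v0" "connected S" "S \<subseteq> {0..1}" "\<And>z. z \<in> S \<Longrightarrow> fr i z" for S u0 v0 i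
    proof -
      have "(f ^^ i) u0 < (f ^^ i) v0"
      proof (rule iter_mono)
        fix z assume "u0 \<le> z" "z \<le> v0"
        then have "z \<in> S" using connected_contains_Icc[OF S(4,1,2)] by auto
        then show "fr i z" by (rule S(6))
      qed (use S in auto)
      then show ?thesis using S(1,2) by blast
    qed
    have sub: "A \<subseteq> {0..1}" "B \<subseteq> {0..1}" using AB MZ Zs by blast+
    from Fcases[OF T] consider "T = M" | i where "i < k" "T = (f ^^ i) ` A" | i where "i < l" "T = (f ^^ i) ` B"
      by blast
    then show ?thesis
    proof cases
      case 1 then show ?thesis using ab AB by blast
    next
      case 2
      show ?thesis unfolding 2(2)
        by (rule distinct[OF ab(1-3) conA sub(1)]) (use free_mono[OF k(4)] 2(1) in auto)
    next
      case 3
      show ?thesis unfolding 3(2)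
        by (rule distinct[OF ab(4-6) conB sub(2)]) (use free_mono[OF l(4)] 3(1) in auto)
    qed
  qed
  show ?thesis
    unfolding cycle_of_intervals_def
  proof (intro conjI exI[of _ "closure ` F"] ballI)
    show "forward_invariant f c Z" by (rule Zf)
    show "finite (closure ` F)" using finF by simp
    show "closure ` F \<noteq> {}" by (simp add: F_def)
    show "Z = \<Union>(closure ` F)" by (rule eq)
    fix I assume "I \<in> closure ` F"
    then obtain T where T: "T \<in> F" "I = closure T" by blast
    show "is_interval I" unfolding T(2) is_interval_connected_1
      by (rule connected_imp_connected_closure[OF Fcon[OF T(1)]])
    show "\<exists>x\<in>I. \<exists>y\<in>I. x < y" using two[OF T(1)] closure_subset[of T] T(2) by blast
  qed
qed

text \<open>
  Minimality of \<open>A\<close> against \<open>core_limit\<close> gives an open set in which generic limit sets leave \<open>core_limit\<close>. It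
  contains no homterval, and covering branches spread this to all of \<open>[0, 1]\<close>. Hence
  generic limit sets coincide with \<open>A\<close>, contain a window, and therefore a neighbourhood of \<open>c\<close>.
\<close>

lemma topological_attractor_cycle:
  assumes ae: "negligible {x. 0 < x \<and> x < 1 \<and> om x \<noteq> core_limit}"
    and att: "topological_attractor f c A" and ne: "A \<noteq> core_limit"
  shows "cycle_of_intervals f c A"
proof -
  have "generic {x. core_limit \<subseteq> om x}"
    by (rule generic_mono[OF good_generic]) (use core_limit_subset_omega in auto)
  then have KA: "core_limit \<subseteq> A" using att by (rule topological_attractor_superset)
  then have "residual_in_some_open (basin f c A - basin f c core_limit)"
    using att ne core_limit_closed core_limit_forward_invariant unfolding topological_attractor_def by blast
  then obtain a b where ab: "0 \<le> a" "a < b" "b \<le> 1" and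
    res: "\<And>a' b' X. a \<le> a' \<Longrightarrow> a' < b' \<Longrightarrow> b' \<le> b \<Longrightarrow> generic X \<Longrightarrow>
        (basin f c A - basin f c core_limit) \<inter> X \<inter> {a'<..<b'} \<noteq> {}"
  proof (rule residual_meets_generic, goal_cases)
    case (1 a b) show ?case by (rule that) (fact 1)+
  qed
  \<comment> \<open>a homterval inside \<open>(a, b)\<close> would carry points with both kinds of limit sets\<close>
  have no_ab: "\<not> hom u v" if uv: "a \<le> u" "v \<le> b" for u v
  proof
    assume h: "hom u v"
    have "(basin f c A - basin f c core_limit) \<inter> {x. good x} \<inter> {u<..<v} \<noteq> {}"
      by (rule res[OF uv(1) homD(3)[OF h] uv(2) good_generic])
    then obtain x where "x \<in> (basin f c A - basin f c core_limit) \<inter> {x. good x} \<inter> {u<..<v}" by blast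
    then have x: "x \<in> basin f c A - basin f c core_limit" "u < x" "x < v" by simp_all
    obtain y where y: "u < y" "y < v" "om y = core_limit"
      using interval_meets_full[OF ae homD(2-4)[OF h]] .
    have "om x \<subseteq> core_limit" using hom_same_omega[OF h x(2,3) y(1,2)] y(3) by simp
    then show False using x(1) by (auto simp: basin_def)
  qed
  obtain x0 where "x0 \<in> (basin f c A - basin f c core_limit) \<inter> {x. good x} \<inter> {a<..<b}"
    using res[OF order_refl ab(2) order_refl good_generic] by blast
  then have x0: "x0 \<in> basin f c A - basin f c core_limit" "good x0" "a < x0" "x0 < b" by simp_all
  then have "\<not> om x0 \<subseteq> core_limit" by (auto simp: basin_def)
  then obtain b1 a1 a2 b2 where W: "window b1 a1 a2 b2" "visits {a1<..<a2} x0"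
    using window_exists[OF x0(2)] by metis
  obtain M where M: "core ((f ^^ M) x0)" using good_core[OF x0(2)] .
  define x1 where "x1 = (f ^^ M) x0"
  have x1: "core x1" "visits {a1<..<a2} x1" "reg x1" "good x1"
    using M W(2) core_reg core_good by (auto simp: x1_def visits_iter)
  have r0: "reg x0" using x0(2) by (rule good_reg)
  obtain t0 s0 where ts0: "br M t0 s0" "t0 < x0" "x0 < s0"
    using free_nbhd[of x0 M] reg_inner[OF r0] reg_free[OF r0] by blast
  define u0 where "u0 = (max t0 a + x0) / 2"
  define v0 where "v0 = (x0 + min s0 b) / 2"
  have uv0: "t0 < u0" "a < u0" "u0 < x0" "x0 < v0" "v0 < s0" "v0 < b"
    using ts0 x0 by (auto simp: u0_def v0_def max_def min_def)
  have U1: "(f ^^ M) u0 < x1" "x1 < (f ^^ M) v0"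
    unfolding x1_def using uv0 by (auto intro!: branch_mono[OF ts0(1) order_refl])
  have a01: "0 \<le> a1" "a1 < a2" "a2 \<le> 1" using W(1) by (auto simp: window_def)
  have pull: "\<exists>n t s p2 p3. n \<ge> N \<and> br n t s \<and> t < p2 \<and> p2 < x1 \<and> x1 < p3 \<and> p3 < s \<and> x1 - e < p2 \<and> p3 < x1 + e \<and>
       (f ^^ n) p2 = a1 \<and> (f ^^ n) p3 = a2" if e: "0 < e" for N e
  proof -
    obtain N' where N': "\<forall>n\<ge>N'. \<forall>t s. br n t s \<longrightarrow> t < x1 \<longrightarrow> x1 < s \<longrightarrow> x1 - e < t \<and> s < x1 + e"
      using returns_shrink[OF W(1) x1(1,2) e] by blast
    obtain n where "n \<ge> max N N' \<and> (f ^^ n) x1 \<in> {a1<..<a2}" using x1(2) unfolding visits_def by blast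
    then have n: "n \<ge> N" "n \<ge> N'" "a1 < (f ^^ n) x1" "(f ^^ n) x1 < a2" by auto
    obtain t s p1 p2 p3 p4 where T: "max_at n t x1 s" and
      p: "br n t s" "t < p1" "p1 < p2" "p2 < x1" "x1 < p3" "p3 < p4" "p4 < s"
      "(f ^^ n) p1 = (b1 + a1) / 2" "(f ^^ n) p2 = a1" "(f ^^ n) p3 = a2" "(f ^^ n) p4 = (a2 + b2) / 2"
      using window_pullback[OF W(1) x1(1) n(3,4)] .
    have "t < x1" "x1 < s" using p by auto
    then have "x1 - e < t" "s < x1 + e" using N' n(2) p(1) by blast+
    then show ?thesis using n(1) p
      by (intro exI[of _ n] exI[of _ t] exI[of _ s] exI[of _ p2] exI[of _ p3]) auto
  qed
  \<comment> \<open>a homterval in the window would be pulled back to one inside \<open>(a, b)\<close>\<close>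
  have no_I: "\<not> hom u v" if uv: "a1 < u" "v < a2" for u v
  proof
    assume h: "hom u v"
    have uvl: "u < v" by (rule homD(3)[OF h])
    define e where "e = min (x1 - (f ^^ M) u0) ((f ^^ M) v0 - x1)"
    have e: "0 < e" using U1 by (simp add: e_def)
    obtain n t s p2 p3 where p: "br n t s" "t < p2" "p2 < x1" "x1 < p3" "p3 < s" "x1 - e < p2" "p3 < x1 + e"
       "(f ^^ n) p2 = a1" "(f ^^ n) p3 = a2" using pull[OF e, of 0] by blast
    have p23: "p2 \<le> p3" using p by simp
    have au: "(f ^^ n) p2 \<le> u" "u \<le> (f ^^ n) p3" "(f ^^ n) p2 \<le> v" "v \<le> (f ^^ n) p3"
      using p uv uvl by auto
    obtain u' where u': "p2 \<le> u'" "u' \<le> p3" "(f ^^ n) u' = u"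
      using branch_ivt[OF p(1,2) p23 p(5) order_refl au(1,2)] .
    obtain v' where v': "p2 \<le> v'" "v' \<le> p3" "(f ^^ n) v' = v"
      using branch_ivt[OF p(1,2) p23 p(5) order_refl au(3,4)] .
    have tu: "t < u'" "v' < s" "t < v'" "u' < s" using u' v' p by auto
    have uv': "u' < v'"
    proof (rule ccontr)
      assume "\<not> u' < v'"
      then have "v \<le> u" using branch_mono[OF p(1) order_refl tu(3), of u'] u' v' tu by (cases "u' = v'") auto
      then show False using uvl by simp
    qed
    have h1: "hom u' v'" by (rule hom_pullback[OF p(1) tu(1) uv' tu(2)]) (use h u' v' in simp)
    have in1: "(f ^^ M) u0 \<le> u'" "u' \<le> (f ^^ M) v0" "(f ^^ M) u0 \<le> v'" "v' \<le> (f ^^ M) v0"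
      using u' v' p(6,7) unfolding e_def by linarith+
    have uv00: "u0 \<le> v0" using uv0 by simp
    obtain u2 where u2: "u0 \<le> u2" "u2 \<le> v0" "(f ^^ M) u2 = u'"
      using branch_ivt[OF ts0(1) uv0(1) uv00 uv0(5) order_refl in1(1,2)] .
    obtain v2 where v2: "u0 \<le> v2" "v2 \<le> v0" "(f ^^ M) v2 = v'"
      using branch_ivt[OF ts0(1) uv0(1) uv00 uv0(5) order_refl in1(3,4)] .
    have tu2: "t0 < u2" "v2 < s0" "t0 < v2" "u2 < s0" using u2 v2 uv0 by auto
    have uv2: "u2 < v2"
    proof (rule ccontr)
      assume "\<not> u2 < v2"
      then have "v' \<le> u'" using branch_mono[OF ts0(1) order_refl tu2(3), of u2] u2 v2 tu2 by (cases "u2 = v2") auto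
      then show False using uv' by simp
    qed
    have "hom u2 v2" by (rule hom_pullback[OF ts0(1) tu2(1) uv2 tu2(2)]) (use h1 u2 v2 in simp)
    then show False using no_ab[of u2 v2] u2 v2 uv0 by simp
  qed
  have notI: "\<not> hom a1 a2"
  proof
    assume "hom a1 a2"
    then have "hom ((2 * a1 + a2) / 3) ((a1 + 2 * a2) / 3)" by (rule hom_subset) (use a01 in auto)
    then show False using no_I[of "(2 * a1 + a2) / 3" "(a1 + 2 * a2) / 3"] a01 by simp
  qed
  obtain k y where k: "a1 < y" "y < a2" "ct k y" "br k a1 a2" using first_cut_interval[OF a01 notI] .
  obtain d where d: "0 < d" "\<And>w. \<bar>w - c\<bar> < d \<Longrightarrow> \<exists>z. a1 < z \<and> z < a2 \<and> (f ^^ k) z = w"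
  proof (rule covers_nbhd[OF k(4,1-3)], goal_cases)
    case (1 d) show ?case by (rule that) (fact 1)+
  qed
  have no: "\<not> hom u v" for u v
  proof
    assume h: "hom u v"
    obtain x where x: "u < x" "x < v" "good x" using interval_meets_full[OF good_ae homD(2-4)[OF h]] .
    obtain n where n: "\<bar>(f ^^ n) x - c\<bar> < d" using good_near_c[OF x(3) d(1)] by blast
    define u' where "u' = (u + x) / 2"
    define v' where "v' = (x + v) / 2"
    have uv': "u < u'" "u' < x" "x < v'" "v' < v" using x by (auto simp: u'_def v'_def)
    have u'v': "u' < v'" using uv' by simp
    have him: "hom ((f ^^ n) u') ((f ^^ n) v')" by (rule hom_image[OF h uv'(1) u'v' uv'(4)])
    have mm: "(f ^^ n) u' < (f ^^ n) x" "(f ^^ n) x < (f ^^ n) v'"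
      using uv' by (auto intro!: branch_mono[OF hom_branch[OF h] order_refl])
    define p where "p = max ((f ^^ n) u') ((c - d + (f ^^ n) x) / 2)"
    define q where "q = min ((f ^^ n) v') ((c + d + (f ^^ n) x) / 2)"
    have nc: "c - d < (f ^^ n) x" "(f ^^ n) x < c + d" using n by linarith+
    then have "p < (f ^^ n) x" "c - d < p" "(f ^^ n) x < q" "q < c + d"
      using mm by (auto simp: p_def q_def less_max_iff_disj min_less_iff_disj)
    then have pq: "p < q" "\<bar>p - c\<bar> < d" "\<bar>q - c\<bar> < d" using nc by linarith+
    have "hom p q" by (rule hom_subset[OF him _ pq(1)]) (auto simp: p_def q_def)
    obtain p' where p': "a1 < p'" "p' < a2" "(f ^^ k) p' = p" using d(2)[OF pq(2)] by blast
    obtain q' where q': "a1 < q'" "q' < a2" "(f ^^ k) q' = q" using d(2)[OF pq(3)] by blast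
    have "p' < q'"
    proof (rule ccontr)
      assume "\<not> p' < q'"
      then have "q \<le> p" using branch_mono[OF k(4) order_refl q'(1), of p'] p' q' by (cases "p' = q'") auto
      then show False using pq by simp
    qed
    then have "hom p' q'" by (intro hom_pullback[OF k(4) p'(1) _ q'(2)]) (use \<open>hom p q\<close> p' q' in auto)
    then show False using no_I p' q' by blast
  qed
  obtain Z where gZ: "generic {x. om x = Z}" using generic_omega_constant[OF no] .
  have "generic ({x. om x = Z} \<inter> {x. good x})" by (rule generic_Int[OF gZ good_generic])
  then have "(basin f c A - basin f c core_limit) \<inter> ({x. om x = Z} \<inter> {x. good x}) \<inter> {a<..<b} \<noteq> {}"
    by (rule res[OF order_refl ab(2) order_refl])
  then obtain xs where xs: "om xs = Z" "good xs" by blast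
  have rs: "reg xs" using xs(2) by (rule good_reg)
  have Zc: "closed Z" using omega_closed[OF rs] xs by simp
  have AZ: "A = Z"
    by (rule topological_attractor_eq[OF gZ Zc _ att]) (use omega_forward_invariant[OF rs] xs in simp)
  \<comment> \<open>points close to the core point \<open>x1\<close> first follow it to a neighbourhood of \<open>c\<close> and later cover the window\<close>
  have genI: "generic {x. reg x \<and> visits {u<..<v} x}" if uv: "a1 < u" "u < v" "v < a2" for u v
  proof (rule generic_visits_of_orbit[OF no open_greaterThanLessThan])
    fix N :: nat and \<delta> :: real assume \<delta>: "0 < \<delta>"
    obtain i where i: "\<bar>(f ^^ i) x1 - c\<bar> < \<delta>" using good_near_c[OF x1(4) \<delta>] by blast
    have "isCont (f ^^ i) x1" by (rule isCont_iter) (use reg_inner[OF x1(3)] reg_free[OF x1(3)] in auto)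
    then obtain e where e: "0 < e" "\<And>z. dist z x1 < e \<Longrightarrow> dist ((f ^^ i) z) ((f ^^ i) x1) < \<delta> - \<bar>(f ^^ i) x1 - c\<bar>"
      using i unfolding continuous_at_eps_delta by (metis diff_gt_0_iff_gt)
    obtain n t s p2 p3 where n: "n \<ge> i + N" and p: "br n t s" "t < p2" "p2 < x1" "x1 < p3" "p3 < s" "x1 - e < p2" "p3 < x1 + e"
       "(f ^^ n) p2 = a1" "(f ^^ n) p3 = a2" using pull[OF e(1), of "i + N"] by blast
    have uv01: "0 \<le> u" "v \<le> 1" using uv a01 by auto
    obtain w where w: "u < w" "w < v" "good w" using interval_meets_full[OF good_ae uv01(1) uv(2) uv01(2)] .
    have aw: "(f ^^ n) p2 \<le> w" "w \<le> (f ^^ n) p3" using w uv p by auto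
    have p23: "p2 \<le> p3" using p by simp
    obtain z where z: "p2 \<le> z" "z \<le> p3" "(f ^^ n) z = w"
      using branch_ivt[OF p(1,2) p23 p(5) order_refl aw] .
    have "reg z"
    proof (rule reg_of_iter)
      show "0 < z" "z < 1" using z p branchD[OF p(1)] by auto
      show "fr n z" using branch_free[OF p(1), of z n] z p by simp
      show "reg ((f ^^ n) z)" using z w good_reg by simp
    qed
    moreover have "dist z x1 < e" using z p by (auto simp: dist_real_def)
    then have "\<bar>(f ^^ i) z - c\<bar> < \<delta>" using e(2)[of z] by (auto simp: dist_real_def)
    ultimately show "\<exists>x i n. reg x \<and> \<bar>(f ^^ i) x - c\<bar> < \<delta> \<and> i + N \<le> n \<and> (f ^^ n) x \<in> {u<..<v}"
      using n z w by (intro exI[of _ z] exI[of _ i] exI[of _ n]) auto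
  qed
  have IZ: "y \<in> Z" if y: "a1 < y" "y < a2" for y
  proof (rule ccontr)
    assume "y \<notin> Z"
    then have "y \<in> - Z" by simp
    then obtain e where e: "0 < e" "ball y e \<subseteq> - Z" using Zc open_contains_ball[of "- Z"] by (auto simp: open_Compl)
    define h where "h = min (e / 2) (min (y - a1) (a2 - y) / 2)"
    have h: "0 < h" "h < e" "a1 < y - h" "y + h < a2" using e y by (auto simp: h_def min_def field_simps)
    have hh: "y - h < y + h" using h by simp
    have "generic ({x. reg x \<and> visits {y - h<..<y + h} x} \<inter> {x. om x = Z})"
      by (rule generic_Int[OF genI[OF h(3) hh h(4)] gZ])
    then have "(basin f c A - basin f c core_limit) \<inter> ({x. reg x \<and> visits {y - h<..<y + h} x} \<inter> {x. om x = Z}) \<inter> {a<..<b} \<noteq> {}"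
      by (rule res[OF order_refl ab(2) order_refl])
    then obtain x where x: "reg x" "visits {y - h<..<y + h} x" "om x = Z" by blast
    have "visits {y - h..y + h} x" using x(2) by (rule visits_mono) auto
    then obtain z where "z \<in> Z" "y - h \<le> z" "z \<le> y + h" using omega_meets_closed_interval[OF x(1)] x(3) by blast
    then show False using e(2) h(2) by (force simp: dist_real_def subset_iff)
  qed
  have VZ: "w \<in> Z" if w: "\<bar>w - c\<bar> < d" for w
  proof -
    obtain z where z: "a1 < z" "z < a2" "(f ^^ k) z = w" using d(2)[OF w] by blast
    have "(f ^^ k) z \<in> om xs"
      by (rule omega_forward_iter[OF rs]) (use IZ[OF z(1,2)] xs branch_free[OF k(4) z(1,2) order_refl] in auto)
    then show ?thesis using z xs by simp
  qed
  have "cycle_of_intervals f c Z" by (rule omega_cycle[OF xs(2) xs(1)[symmetric] d(1) VZ])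
  then show ?thesis using AZ by simp
qed

theorem attractors:
  assumes top: "topological_attractor f c A" and met: "metrical_attractor f c A'"
  shows "A' \<subseteq> A \<and> (\<not> cycle_of_intervals f c A \<longrightarrow> A = A')"
proof (rule metric_dichotomy)
  assume ae: "negligible {x. 0 < x \<and> x < 1 \<and> om x \<noteq> core_limit}"
  have A': "A' = core_limit" by (rule metrical_attractor_eq[OF ae core_limit_closed core_limit_forward_invariant met])
  have "generic {x. core_limit \<subseteq> om x}"
    by (rule generic_mono[OF good_generic]) (use core_limit_subset_omega in auto)
  then have "core_limit \<subseteq> A" using top by (rule topological_attractor_superset)
  then show ?thesis using topological_attractor_cycle[OF ae top] A' by blast
next
  fix Z assume Z: "closed Z" "forward_invariant f c Z" "negligible {x. 0 < x \<and> x < 1 \<and> om x \<noteq> Z}"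
    "generic {x. om x = Z}"
  have "A' = Z" by (rule metrical_attractor_eq[OF Z(3,1,2) met])
  moreover have "A = Z" by (rule topological_attractor_eq[OF Z(4,1,2) top])
  ultimately show ?thesis by simp
qed

end

section \<open>The attractors of a contracting Lorenz map\<close>

lemma nth_deriv_interior:
  assumes "Ck_on m f S" "i < m" "open U" "U \<subseteq> S" "x \<in> U"
  shows "(nth_deriv_within S i f has_real_derivative nth_deriv_within S (Suc i) f x) (at x)"
proof -
  have "nth_deriv_within S i f differentiable (at x within S)"
    using assms by (auto simp: Ck_on_def differentiable_on_def)
  then have "(nth_deriv_within S i f has_vector_derivative nth_deriv_within S (Suc i) f x) (at x within S)"
    by (simp add: vector_derivative_works nth_deriv_within_def)
  then show ?thesis
    using at_within_open_subset[OF assms(5,3,4)] by (simp add: has_real_derivative_iff_has_vector_derivative)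
qed

text \<open>
  In the interior of the domain the derivatives within the domain are ordinary derivatives.
\<close>

lemma lorenz_cross_of_lorenz_map:
  assumes lm: "lorenz_map f c" and C3: "Ck_on 3 f ({0..1} - {c})" and S: "negative_schwarzian f c"
  shows "lorenz_cross f c"
proof
  let ?S = "punctured c"
  have c: "0 < c" "c < 1" using lm by (auto simp: lorenz_map_def)
  then show "0 < c" "c < 1" .
  show "f 0 = 0" "f 1 = 1" using lm by (auto simp: lorenz_map_def)
  have "nth_deriv_within ?S 0 f differentiable_on ?S" using C3 by (auto simp: Ck_on_def)
  then have "f differentiable_on ?S" by (simp add: nth_deriv_within_def)
  then show cont: "continuous_on ?S f" by (rule differentiable_imp_continuous_on)
  define U where "U = {0<..<1} - {c}"
  have U: "open U" "U \<subseteq> ?S" unfolding U_def by (auto intro: open_Diff)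
  have d: "(nth_deriv_within ?S i f has_real_derivative nth_deriv_within ?S (Suc i) f x) (at x)"
    if "i < 3" "0 < x" "x < 1" "x \<noteq> c" for i x
    by (rule nth_deriv_interior[OF C3 that(1) U]) (use that in \<open>auto simp: U_def\<close>)
  have d0: "(f has_real_derivative nth_deriv_within ?S 1 f x) (at x)" if "0 < x" "x < 1" "x \<noteq> c" for x
    using d[of 0 x] that by (simp add: nth_deriv_within_def)
  have pos: "0 < nth_deriv_within ?S 1 f x" if "0 < x" "x < 1" "x \<noteq> c" for x
    using lm that by (auto simp: lorenz_map_def)
  show "\<exists>d>0. (f has_real_derivative d) (at x)" if "0 < x" "x < 1" "x \<noteq> c" for x
    using d0[OF that] pos[OF that] by blast
  show "f x < f y" if "0 \<le> x" "x < y" "y < c" for x y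
  proof (rule DERIV_pos_imp_increasing_open[OF that(2)])
    fix z assume "x < z" "z < y"
    then show "\<exists>d. (f has_real_derivative d) (at z) \<and> 0 < d" using d0[of z] pos[of z] that c by auto
  next
    show "continuous_on {x..y} f" by (rule continuous_on_subset[OF cont]) (use that c in auto)
  qed
  show "f x < f y" if "c < x" "x < y" "y \<le> 1" for x y
  proof (rule DERIV_pos_imp_increasing_open[OF that(2)])
    fix z assume "x < z" "z < y"
    then show "\<exists>d. (f has_real_derivative d) (at z) \<and> 0 < d" using d0[of z] pos[of z] that c by auto
  next
    show "continuous_on {x..y} f" by (rule continuous_on_subset[OF cont]) (use that c in auto)
  qed
  show "0 \<le> f x \<and> f x \<le> 1" if "0 \<le> x" "x \<le> 1" "x \<noteq> c" for x
  proof -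
    have "f x \<in> f ` ?S" using that by auto
    then have "f x \<in> {0..1}" using lm unfolding lorenz_map_def by blast
    then show ?thesis by simp
  qed
  show "cross_ratio a b d e < cross_ratio (f a) (f b) (f d) (f e)"
    if o: "0 < a" "a < b" "b < d" "d < e" "e < 1" "e < c \<or> c < a" for a b d e
  proof -
    have "\<exists>l r. l < a \<and> e < r \<and> 0 \<le> l \<and> r \<le> 1 \<and> (r \<le> c \<or> c \<le> l)"
      using o(6)
    proof
      assume "e < c" then show ?thesis using o c by (intro exI[of _ 0] exI[of _ c]) auto
    next
      assume "c < a" then show ?thesis using o c by (intro exI[of _ c] exI[of _ 1]) auto
    qed
    then obtain l r where lr: "l < a" "e < r" "0 \<le> l" "r \<le> 1" "r \<le> c \<or> c \<le> l" by blast
    have in0: "0 < x" "x < 1" "x \<noteq> c" if "l < x" "x < r" for x using that lr by auto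
    show ?thesis
    proof (rule schwarzian_cross[of l r f "nth_deriv_within ?S 1 f" "nth_deriv_within ?S 2 f" "nth_deriv_within ?S 3 f"])
      fix x assume x: "l < x" "x < r"
      show "(f has_real_derivative nth_deriv_within ?S 1 f x) (at x)" by (rule d0[OF in0[OF x]])
      show "(nth_deriv_within ?S 1 f has_real_derivative nth_deriv_within ?S 2 f x) (at x)"
        using d[of 1 x] in0[OF x] by (simp add: numeral_2_eq_2)
      show "(nth_deriv_within ?S 2 f has_real_derivative nth_deriv_within ?S 3 f x) (at x)"
        using d[of 2 x] in0[OF x] by (simp add: numeral_3_eq_3 numeral_2_eq_2)
      show p: "0 < nth_deriv_within ?S 1 f x" by (rule pos[OF in0[OF x]])
      have "x \<in> ?S" using in0[OF x] by auto
      then have "schwarzian ?S f x < 0" using S p unfolding negative_schwarzian_def by auto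
      then show "nth_deriv_within ?S 3 f x / nth_deriv_within ?S 1 f x -
          3 / 2 * (nth_deriv_within ?S 2 f x / nth_deriv_within ?S 1 f x)\<^sup>2 < 0"
        by (simp add: schwarzian_def)
    qed (use lr o in auto)
  qed
qed

theorem corollary4:
  fixes f :: "real \<Rightarrow> real" and c :: real and \<Lambda> \<Lambda>' :: "real set"
  assumes "lorenz_map f c"
    and "Ck_on 3 f ({0..1} - {c})"
    and "contracting f c"
    and "non_flat f c"
    and "negative_schwarzian f c"
    and "\<not> (\<exists>P. periodic_attractor f c P)"
    and "topological_attractor f c \<Lambda>"
    and "metrical_attractor f c \<Lambda>'"
  shows "\<Lambda>' \<subseteq> \<Lambda> \<and> (\<not> cycle_of_intervals f c \<Lambda> \<longrightarrow> \<Lambda> = \<Lambda>')"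
proof -
  interpret lorenz_cross f c by (rule lorenz_cross_of_lorenz_map[OF assms(1,2,5)])
  interpret lorenz_dyn f c
  proof
    fix a b n assume "br n a b" "0 < n" "\<forall>x. a < x \<and> x < b \<longrightarrow> a < (f ^^ n) x \<and> (f ^^ n) x < b"
    then show False using trapped_branch_attractor assms(6) by blast
  qed
  show ?thesis by (rule attractors[OF assms(7,8)])
qed

end
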